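(* Let $k$ be an algebraically closed field of characteristic zero and let $G$ be a nontrivial finite subgroup of the Cremona group of rank one $\mathrm{Cr}_1=\mathrm{PSL}_2(k)=\mathrm{Aut}(\mathbf P^1)$. Associate with $G$ the formal power series $S_G(t)=\sum_{n\ge 0}s_nt^n\in\mathbf Z[[t]]$ defined as follows. (a) If $G$ is the rotation group of a regular tetrahedron, octahedron, or icosahedron, then $$S_G(t)=t^{2a-1}(1+t^{4a-6})\Big(\sum_{n\ge 0}t^{2na}\Big)\Big(\sum_{n\ge 0}t^{(4a-4)n}\Big)+t^{4a-5}\sum_{n\ge 0}t^{(4a-4)n},$$ where $a=3$, $4$, or $6$, respectively. (b) If $G$ is either a dihedral group of order $2\ell\ge 4$ or a cyclic group of order $\ell\ge 2$, then $$S_G(t)=\sum_{n\ge 0}t^{2\ell(n+1)-1}.$$ Suppose that the coefficient $s_d$ of $S_G(t)$ is different from zero. Then there exists a polynomial homogeneous self-compression $\widetilde\varphi=(\widetilde\varphi_1,\widetilde\varphi_2)\colon \mathbf A^2\to\mathbf A^2$ of degree $d$ of the binary group $\widetilde G:=\nu^{-1}(G)\subset \mathrm{SL}_2(k)$, where $\nu\colon\mathrm{SL}_2(k)\to\mathrm{PSL}_2(k)$ is the canonical homomorphism, such that its descent $\varphi\colon\mathbf P^1\to\mathbf P^1$ is a nontrivial self-compression of the group $G$.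
   Context: A self-compression of a finite group $H\subseteq \mathrm{Bir}(X)$ ($X$ an irreducible algebraic variety over $k$, $\mathrm{Bir}(X)$ its group of birational self-maps) is a dominant rational map $\varphi\colon X\dashrightarrow X$ that is $H$-equivariant, i.e. $\varphi\circ h=h\circ\varphi$ for all $h\in H$; it is nontrivial if it is not a birational isomorphism. The group $\widetilde G\subset\mathrm{SL}_2(k)$ acts on $\mathbf A^2$ by linear transformations. A map $\widetilde\varphi=(\widetilde\varphi_1,\widetilde\varphi_2)\colon\mathbf A^2\to\mathbf A^2$ is polynomial homogeneous of degree $d$ if $\widetilde\varphi_1,\widetilde\varphi_2\in k[x_1,x_2]$ are forms of degree $d$. Let $\pi\colon\mathbf A^2\setminus\{0\}\to\mathbf P^1$ be the natural projection. If $\widetilde\varphi$ is a polynomial homogeneous self-compression of $\widetilde G$, its descent is the unique morphism $\varphi\colon\mathbf P^1\to\mathbf P^1$ such that $\varphi\circ\pi=\pi\circ\widetilde\varphi$ (as rational maps on $\mathbf A^2\setminus\{0\}$); it is a self-compression of $G$ acting naturally on $\mathbf P^1$. *)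

theory Defs
  imports
    "HOL-Analysis.Analysis"
    "HOL-Computational_Algebra.Computational_Algebra"
    "HOL-Algebra.Elementary_Groups"
begin

section \<open>Rational self-maps and self-compressions\<close>

text \<open>
  An irreducible variety is represented by its Zariski topology (all points of the type) and by the
  regular maps from its open subsets to itself.  A rational self-map is represented by a nonempty
  open set together with a map regular on it; the values outside that set are irrelevant, and two
  representatives are identified by \<open>rmap_eq\<close>.
\<close>

record 'p variety =
  zariski :: "'p topology"
  regular_on :: "'p set \<Rightarrow> ('p \<Rightarrow> 'p) \<Rightarrow> bool"

type_synonym 'p rmap = "'p set \<times> ('p \<Rightarrow> 'p)"

definition is_rmap :: "'p variety \<Rightarrow> 'p rmap \<Rightarrow> bool" where
  "is_rmap X F \<longleftrightarrow> openin (zariski X) (fst F) \<and> fst F \<noteq> {} \<and> regular_on X (fst F) (snd F)"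

definition rmap_eq :: "'p variety \<Rightarrow> 'p rmap \<Rightarrow> 'p rmap \<Rightarrow> bool" where
  "rmap_eq X F F' \<longleftrightarrow>
     (\<exists>W. openin (zariski X) W \<and> W \<noteq> {} \<and> W \<subseteq> fst F \<inter> fst F' \<and> (\<forall>p\<in>W. snd F p = snd F' p))"

definition rmap_comp :: "'p rmap \<Rightarrow> 'p rmap \<Rightarrow> 'p rmap" where
  "rmap_comp F F' = ({p \<in> fst F'. snd F' p \<in> fst F}, snd F \<circ> snd F')"

abbreviation total_rmap :: "('p \<Rightarrow> 'p) \<Rightarrow> 'p rmap" where
  "total_rmap f \<equiv> (UNIV, f)"

definition dominant :: "'p variety \<Rightarrow> 'p rmap \<Rightarrow> bool" where
  "dominant X F \<longleftrightarrow> zariski X closure_of (snd F ` fst F) = topspace (zariski X)"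

definition birational_iso :: "'p variety \<Rightarrow> 'p rmap \<Rightarrow> bool" where
  "birational_iso X F \<longleftrightarrow> is_rmap X F \<and>
     (\<exists>F'. is_rmap X F' \<and> rmap_eq X (rmap_comp F F') (total_rmap id)
         \<and> rmap_eq X (rmap_comp F' F) (total_rmap id))"

definition self_compression :: "'p variety \<Rightarrow> 'p rmap set \<Rightarrow> 'p rmap \<Rightarrow> bool" where
  "self_compression X H F \<longleftrightarrow> is_rmap X F \<and> dominant X F \<and>
     (\<forall>h\<in>H. rmap_eq X (rmap_comp F h) (rmap_comp h F))"

definition nontrivial_self_compression :: "'p variety \<Rightarrow> 'p rmap set \<Rightarrow> 'p rmap \<Rightarrow> bool" where
  "nontrivial_self_compression X H F \<longleftrightarrow> self_compression X H F \<and> \<not> birational_iso X F"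


section \<open>The affine plane\<close>

text \<open>
  The ring \<open>k[x\<^sub>1,x\<^sub>2]\<close> is rendered as \<open>k[x\<^sub>1][x\<^sub>2]\<close>: the coefficient of
  \<open>x\<^sub>1\<^sup>i x\<^sub>2\<^sup>j\<close> in \<open>p\<close> is \<open>coeff (coeff p j) i\<close>.
\<close>

definition eval2 :: "'a::field poly poly \<Rightarrow> 'a^2 \<Rightarrow> 'a" where
  "eval2 p v = poly (poly p [:v $ 2:]) (v $ 1)"

text \<open>As usual, the zero polynomial counts as a form of every degree.\<close>

definition is_form :: "nat \<Rightarrow> 'a::field poly poly \<Rightarrow> bool" where
  "is_form d p \<longleftrightarrow> (\<forall>i j. Polynomial.coeff (Polynomial.coeff p j) i \<noteq> 0 \<longrightarrow> i + j = d)"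

definition poly_map :: "'a::field poly poly \<Rightarrow> 'a poly poly \<Rightarrow> 'a^2 \<Rightarrow> 'a^2" where
  "poly_map p q v = vector [eval2 p v, eval2 q v]"

definition zariski_A2 :: "('a::field^2) topology" where
  "zariski_A2 = topology_generated_by {{v. eval2 p v \<noteq> 0} | p. True}"

definition A2 :: "('a::field^2) variety" where
  "A2 = \<lparr>zariski = zariski_A2,
         regular_on = (\<lambda>U f. \<forall>v\<in>U. \<exists>W p q r. openin zariski_A2 W \<and> v \<in> W \<and> W \<subseteq> U \<and>
           (\<forall>w\<in>W. eval2 r w \<noteq> 0 \<and> f w = vector [eval2 p w / eval2 r w, eval2 q w / eval2 r w]))\<rparr>"


section \<open>The projective line\<close>

typedef (overloaded) ('a::field) P1_point = "{L :: ('a^2) set. \<exists>v. v \<noteq> 0 \<and> L = range (\<lambda>c. c *s v)}"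
proof -
  have "(axis 1 1 :: 'a^2) \<noteq> 0"
    by (simp add: axis_eq_0_iff)
  then show ?thesis by blast
qed

definition proj :: "'a::field^2 \<Rightarrow> 'a P1_point" where
  "proj v = Abs_P1_point (range (\<lambda>c. c *s v))"

definition zariski_P1 :: "('a::field P1_point) topology" where
  "zariski_P1 = topology_generated_by {proj ` {v. v \<noteq> 0 \<and> eval2 p v \<noteq> 0} | p. \<exists>d. is_form d p}"

definition P1 :: "('a::field P1_point) variety" where
  "P1 = \<lparr>zariski = zariski_P1,
         regular_on = (\<lambda>U f. \<forall>x\<in>U. \<exists>W d p q. openin zariski_P1 W \<and> x \<in> W \<and> W \<subseteq> U \<and>
           is_form d p \<and> is_form d q \<and>
           (\<forall>v. v \<noteq> 0 \<and> proj v \<in> W \<longrightarrow> poly_map p q v \<noteq> 0 \<and> f (proj v) = proj (poly_map p q v)))\<rparr>"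

text \<open>
  \<open>\<phi>\<close> is a morphism and \<open>\<phi> \<circ> \<pi> = \<pi> \<circ> f\<close> as rational maps on the punctured plane, i.e. wherever
  \<open>\<pi> \<circ> f\<close> is defined.  This determines \<open>\<phi>\<close> when \<open>f\<close> is a dominant polynomial map.
\<close>

definition is_descent :: "('a::field^2 \<Rightarrow> 'a^2) \<Rightarrow> ('a P1_point \<Rightarrow> 'a P1_point) \<Rightarrow> bool" where
  "is_descent f \<phi> \<longleftrightarrow> regular_on P1 UNIV \<phi> \<and>
     (\<forall>v. v \<noteq> 0 \<and> f v \<noteq> 0 \<longrightarrow> \<phi> (proj v) = proj (f v))"


section \<open>The groups\<close>

definition SL2 :: "('a::field^2^2) monoid" where
  "SL2 = \<lparr>carrier = {A. det A = 1}, mult = (**), one = mat 1\<rparr>"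

definition PSL2 :: "('a::field^2^2) set monoid" where
  "PSL2 = SL2 Mod {mat 1, - mat 1}"

definition nu :: "'a::field^2^2 \<Rightarrow> ('a^2^2) set" where
  "nu A = {mat 1, - mat 1} #>\<^bsub>SL2\<^esub> A"

definition binary_group :: "('a::field^2^2) set set \<Rightarrow> ('a^2^2) set" where
  "binary_group G = {A \<in> carrier SL2. nu A \<in> G}"

text \<open>All representatives \<open>A\<close> of \<open>g\<close> send a line \<open>x\<close> to the same line, so the union is that line.\<close>

definition psl_act :: "('a::field^2^2) set \<Rightarrow> 'a P1_point \<Rightarrow> 'a P1_point" where
  "psl_act g x = Abs_P1_point (\<Union>A\<in>g. (\<lambda>v. A *v v) ` Rep_P1_point x)"

definition rotation_group :: "(real^3) set \<Rightarrow> (real^3^3) monoid" where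
  "rotation_group P =
     \<lparr>carrier = {A. rotation_matrix A \<and> (\<lambda>v. A *v v) ` P = P}, mult = (**), one = mat 1\<rparr>"

definition tetrahedron :: "(real^3) set" where
  "tetrahedron = convex hull
     {vector [1, 1, 1], vector [1, -1, -1], vector [-1, 1, -1], vector [-1, -1, 1]}"

definition octahedron :: "(real^3) set" where
  "octahedron = convex hull
     {vector [1, 0, 0], vector [-1, 0, 0], vector [0, 1, 0], vector [0, -1, 0],
      vector [0, 0, 1], vector [0, 0, -1]}"

definition icosahedron :: "(real^3) set" where
  "icosahedron = (let g = (1 + sqrt 5) / 2 in convex hull
     (\<Union>s\<in>{1, -1}. \<Union>t\<in>{1, -1}.
        {vector [0, s, t * g], vector [s, t * g, 0], vector [t * g, 0, s]}))"

text \<open>For \<open>l = 2\<close> this is the Klein four-group.\<close>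

definition dihedral_group :: "nat \<Rightarrow> ('g, 'm) monoid_scheme \<Rightarrow> bool" where
  "dihedral_group l H \<longleftrightarrow> group H \<and> Coset.order H = 2 * l \<and>
     (\<exists>r\<in>carrier H. \<exists>s\<in>carrier H. generate H {r, s} = carrier H \<and>
        r [^]\<^bsub>H\<^esub> l = \<one>\<^bsub>H\<^esub> \<and> s [^]\<^bsub>H\<^esub> (2::nat) = \<one>\<^bsub>H\<^esub> \<and>
        s \<otimes>\<^bsub>H\<^esub> r \<otimes>\<^bsub>H\<^esub> s = inv\<^bsub>H\<^esub> r)"


section \<open>The power series\<close>

text \<open>The infinite sums are taken in the standard topology of the ring of formal power series.\<close>

definition polyhedral_series :: "nat \<Rightarrow> int fps" where
  "polyhedral_series a =
     fps_X ^ (2*a - 1) * (1 + fps_X ^ (4*a - 6)) *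
       (\<Sum>n. fps_X ^ (2*n*a)) * (\<Sum>n. fps_X ^ ((4*a - 4)*n)) +
     fps_X ^ (4*a - 5) * (\<Sum>n. fps_X ^ ((4*a - 4)*n))"

definition dihedral_cyclic_series :: "nat \<Rightarrow> int fps" where
  "dihedral_cyclic_series l = (\<Sum>n. fps_X ^ (2*l*(n + 1) - 1))"

text \<open>
  The five cases are mutually exclusive.  For nontrivial finite subgroups of \<open>PSL\<^sub>2\<close> over an
  algebraically closed field of characteristic zero they are exhaustive by Klein's classification,
  so that the final default value is then never attained.
\<close>

definition S_series :: "('a::field^2^2) set set \<Rightarrow> int fps" where
  "S_series G = (let H = PSL2\<lparr>carrier := G\<rparr> in
     if H \<cong> rotation_group tetrahedron then polyhedral_series 3
     else if H \<cong> rotation_group octahedron then polyhedral_series 4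
     else if H \<cong> rotation_group icosahedron then polyhedral_series 6
     else if \<exists>l\<ge>2. dihedral_group l H then dihedral_cyclic_series (THE l. dihedral_group l H)
     else if cyclic_group H then dihedral_cyclic_series (Coset.order H)
     else 0)"

end

theory Submission
  imports Defs
begin

text \<open>
  A finite set \<open>S\<close> of points of the projective line defines the form \<open>F = \<Prod>\<^sub>a det (a, v)\<close> and the
  homogeneous map \<open>\<Phi>(v) = \<Sum>\<^sub>a (\<Prod>\<^sub>b\<^sub>\<noteq>\<^sub>a det (b, v)) a\<close>, where \<open>a\<close> and \<open>b\<close> run through representatives
  of the points; up to sign \<open>\<Phi>\<close> is the rotated gradient of \<open>F\<close>.  It satisfies
  \<open>det (\<Phi>(v), v) = card S \<cdot> F(v)\<close> and fixes the points of \<open>S\<close>, so that it vanishes only at the origin;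
  it descends to a surjection of the projective line, which is not birational if \<open>card S \<ge> 3\<close>.
  If \<open>S\<close> is invariant under the binary group, both \<open>F\<close> and \<open>\<Phi>\<close> are semi-invariant with the same
  character, whose value at \<open>A\<close> is read off at a fixed point \<open>[v]\<close> of \<open>A\<close> from the eigenvalue of \<open>v\<close>, from
  \<open>card S\<close> and from whether \<open>[v] \<in> S\<close>.  Products of \<open>\<Phi>\<close> with invariant forms are then the required
  self-compressions.

  The suitable invariant sets are unions of orbits.  The orbits with nontrivial stabilizer are
  controlled by the class equation \<open>2 (N - 1) = \<Sum> (N - card \<omega>)\<close>, as in Klein's classification.  Two
  noncommuting rotations of order 3 and a rotation of order 4 or 5 are enough to tell which of its
  solutions belongs to a given polyhedral group, so no explicit matrix representation is needed.
\<close>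

(* Otherwise $ also denotes fps_nth, and matrix expressions have exponentially many parses. *)
unbundle no Formal_Power_Series.fps_syntax

section \<open>Plane vectors and the projective line\<close>

text \<open>A product of \<open>\<Phi>\<close> with an invariant form of degree m has degree m +
  card S - 1, and the obstacle is the character, which the choice of S or of the form must cancel.
  This explains the exponents of the series. The special orbits have 6, 4, 4 points for the
  tetrahedron: the 6 serve alone, the 4 and 4 only together. They have 12, 8, 6 points for the
  octahedron: the 8 serve alone, the 6 and the 12 carry a sign and serve together, and the form of
  the 6 becomes invariant when squared. For the icosahedron 30, 20 and 12 points all serve. So 2a is
  6, 8, 12, and 4a - 4 is 4 + 4, 2 * 6, 20, which are degrees of invariant forms; 2a - 1 comes from
  the orbit of 2a points; (4a - 6) + (2a - 1) is 6 + 5, 18 - 1, 30 - 1; and 4a - 5 is 8 - 1, 6 + 5,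
  20 - 1, where the octahedral 6 + 5 is the covariant of the 6 points times their own form. The
  exponents 2l(n + 1) - 1 come from sets of 2l points.\<close>

definition cross2 :: "'a::field^2 \<Rightarrow> 'a^2 \<Rightarrow> 'a" where
  "cross2 u v = u $ 1 * v $ 2 - u $ 2 * v $ 1"

lemma vec2_eq_iff: "v = w \<longleftrightarrow> v $ 1 = w $ 1 \<and> v $ 2 = w $ 2" for v w :: "'a^2"
  by (simp add: vec_eq_iff forall_2)

lemma cross2_self [simp]: "cross2 v v = 0"
  by (simp add: cross2_def)

lemma cross2_zero [simp]: "cross2 0 v = 0" "cross2 v 0 = 0"
  by (simp_all add: cross2_def)

lemma cross2_add: "cross2 (u + v) w = cross2 u w + cross2 v w" "cross2 w (u + v) = cross2 w u + cross2 w v"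
  by (simp_all add: cross2_def algebra_simps)

lemma cross2_scale [simp]: "cross2 (c *s u) w = c * cross2 u w" "cross2 w (c *s u) = c * cross2 w u"
  by (simp_all add: cross2_def algebra_simps)

lemma cross2_sum: "cross2 (sum f A) w = (\<Sum>a\<in>A. cross2 (f a) w)" "cross2 w (sum f A) = (\<Sum>a\<in>A. cross2 w (f a))"
  by (induction A rule: infinite_finite_induct) (simp_all add: cross2_add)

lemma cross2_swap: "cross2 u v = - cross2 v u"
  by (simp add: cross2_def)

lemma cross2_matrix: "cross2 (A *v u) (A *v v) = det A * cross2 u v"
  by (simp add: cross2_def det_2 matrix_vector_mult_def sum_2) (simp add: algebra_simps)

lemma cross2_eq_0_iff:
  assumes "v \<noteq> 0"
  shows "cross2 v w = 0 \<longleftrightarrow> (\<exists>c. w = c *s v)"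
proof
  assume *: "cross2 v w = 0"
  show "\<exists>c. w = c *s v"
  proof (cases "v $ 1 = 0")
    case True
    with assms have "v $ 2 \<noteq> 0" by (simp add: vec2_eq_iff)
    with * True have "w = (w $ 2 / v $ 2) *s v"
      by (auto simp: vec2_eq_iff cross2_def)
    then show ?thesis by blast
  next
    case False
    with * have "w = (w $ 1 / v $ 1) *s v"
      by (auto simp: vec2_eq_iff cross2_def field_simps)
    then show ?thesis by blast
  qed
qed auto

lemma cross2_eq_0_iff':
  assumes "v \<noteq> 0" "w \<noteq> 0"
  shows "cross2 v w = 0 \<longleftrightarrow> (\<exists>c. c \<noteq> 0 \<and> w = c *s v)"
  using assms(2) by (auto simp: cross2_eq_0_iff[OF assms(1)])

lemma Rep_P1_proj: "v \<noteq> 0 \<Longrightarrow> Rep_P1_point (proj v) = range (\<lambda>c. c *s v)"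
  unfolding proj_def by (rule Abs_P1_point_inverse) blast

lemma proj_eq_iff:
  assumes "v \<noteq> 0" "w \<noteq> 0"
  shows "proj v = proj w \<longleftrightarrow> cross2 v w = 0"
proof
  assume "proj v = proj w"
  then have "range (\<lambda>c. c *s v) = range (\<lambda>c. c *s w)"
    using Rep_P1_proj assms by metis
  moreover have "w \<in> range (\<lambda>c. c *s w)"
    by (metis rangeI vector_smult_lid)
  ultimately show "cross2 v w = 0"
    using cross2_eq_0_iff[OF assms(1)] by auto
next
  assume "cross2 v w = 0"
  then obtain c where c: "c \<noteq> 0" "w = c *s v"
    using cross2_eq_0_iff'[OF assms] by auto
  have "range (\<lambda>c. c *s v) = range (\<lambda>b. b *s w)"
  proof (intro equalityI subsetI)
    fix u assume "u \<in> range (\<lambda>c. c *s v)"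
    then obtain a where "u = a *s v" by auto
    then have "u = (a / c) *s w" using c by (simp add: vector_smult_assoc)
    then show "u \<in> range (\<lambda>b. b *s w)" by blast
  qed (use c in \<open>auto simp: vector_smult_assoc\<close>)
  then show "proj v = proj w" by (simp add: proj_def)
qed

lemma proj_scale [simp]: "c \<noteq> 0 \<Longrightarrow> proj (c *s v) = proj v" if "v \<noteq> 0"
  using that by (simp add: proj_eq_iff)

lemma proj_cases:
  obtains v where "v \<noteq> 0" "x = proj v"
  using Rep_P1_point[of x] by (auto simp: proj_def) (metis Rep_P1_point_inverse)

text \<open>Any representatives will do: rescaling them multiplies the form and the covariant of a
  finite point set by one common scalar.\<close>

definition rep :: "'a::field P1_point \<Rightarrow> 'a^2" where
  "rep x = (SOME v. v \<noteq> 0 \<and> proj v = x)"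

lemma rep: "rep x \<noteq> 0" "proj (rep x) = x"
proof -
  have "\<exists>v. v \<noteq> 0 \<and> proj v = x" using proj_cases by metis
  from someI_ex[OF this] show "rep x \<noteq> 0" "proj (rep x) = x" by (auto simp: rep_def)
qed

lemma cross2_rep_eq_0_iff': "v \<noteq> 0 \<Longrightarrow> cross2 (rep x) v = 0 \<longleftrightarrow> x = proj v"
  using rep proj_eq_iff by metis

lemma proj_eq_scale:
  assumes "v \<noteq> 0" "w \<noteq> 0" "proj v = proj w"
  obtains c where "c \<noteq> 0" "w = c *s v"
  using assms cross2_eq_0_iff' proj_eq_iff by metis

lemma infinite_P1: "infinite (UNIV :: 'a::field_char_0 P1_point set)"
proof -
  have "inj (\<lambda>z::'a. proj (vector [1, z]))"
  proof (rule injI)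
    fix y z :: 'a
    assume "proj (vector [1, y] :: 'a^2) = proj (vector [1, z])"
    then show "y = z"
      by (subst (asm) proj_eq_iff) (auto simp: vec2_eq_iff cross2_def)
  qed
  then show ?thesis
    using infinite_UNIV_char_0 finite_imageD finite_subset top_greatest by metis
qed


section \<open>Binary forms\<close>

lemma eval2_simps [simp]:
  "eval2 0 v = 0" "eval2 1 v = 1" "eval2 (p + q) v = eval2 p v + eval2 q v"
  "eval2 (p - q) v = eval2 p v - eval2 q v"
  "eval2 (p * q) v = eval2 p v * eval2 q v" "eval2 (p ^ n) v = eval2 p v ^ n"
  "eval2 [:[:c:]:] v = c" "eval2 (smult r p) v = poly r (v $ 1) * eval2 p v"
  by (simp_all add: eval2_def)

lemma eval2_sum: "eval2 (sum f A) v = (\<Sum>a\<in>A. eval2 (f a) v)"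
  by (induction A rule: infinite_finite_induct) auto

lemma eval2_prod: "eval2 (prod f A) v = (\<Prod>a\<in>A. eval2 (f a) v)"
  by (induction A rule: infinite_finite_induct) auto

lemma is_form_0 [simp]: "is_form n 0"
  by (simp add: is_form_def)

lemma is_form_const: "is_form 0 [:[:c:]:]"
  by (auto simp: is_form_def coeff_pCons split: nat.splits)

lemma is_form_1: "is_form 0 1"
  using is_form_const[of 1] by (simp add: one_pCons)

lemma is_form_add: "is_form n p \<Longrightarrow> is_form n q \<Longrightarrow> is_form n (p + q)"
  unfolding is_form_def by (metis add.right_neutral coeff_add)

lemma is_form_sum: "(\<And>a. a \<in> A \<Longrightarrow> is_form n (f a)) \<Longrightarrow> is_form n (sum f A)"
  by (induction A rule: infinite_finite_induct) (auto intro: is_form_add)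

lemma is_form_mult:
  assumes "is_form m p" "is_form n q"
  shows "is_form (m + n) (p * q)"
  unfolding is_form_def
proof (intro allI impI)
  fix i j
  assume "coeff (coeff (p * q) j) i \<noteq> 0"
  then have "(\<Sum>k\<le>j. \<Sum>l\<le>i. coeff (coeff p k) l * coeff (coeff q (j - k)) (i - l)) \<noteq> 0"
    by (simp add: coeff_mult coeff_sum)
  then obtain k where k: "k \<le> j" "(\<Sum>l\<le>i. coeff (coeff p k) l * coeff (coeff q (j - k)) (i - l)) \<noteq> 0"
    by (metis (no_types, lifting) atMost_iff sum.neutral)
  then obtain l where l: "l \<le> i" "coeff (coeff p k) l * coeff (coeff q (j - k)) (i - l) \<noteq> 0"
    by (metis (no_types, lifting) atMost_iff sum.neutral)
  then have "l + k = m" "i - l + (j - k) = n"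
    using assms by (auto simp: is_form_def)
  with k l show "i + j = m + n" by linarith
qed

lemma is_form_prod: "(\<And>a. a \<in> A \<Longrightarrow> is_form (n a) (f a)) \<Longrightarrow> is_form (sum n A) (prod f A)"
  by (induction A rule: infinite_finite_induct) (auto intro: is_form_mult is_form_1)

lemma is_form_power: "is_form m p \<Longrightarrow> is_form (n * m) (p ^ n)"
  by (induction n) (auto intro: is_form_mult is_form_1)

definition linear_form :: "'a::field^2 \<Rightarrow> 'a poly poly" where
  "linear_form a = [:[:0, - (a $ 2):], [:a $ 1:]:]"

lemma is_form_linear: "is_form 1 (linear_form a)"
  by (auto simp: is_form_def linear_form_def coeff_pCons split: nat.splits)

lemma eval2_linear [simp]: "eval2 (linear_form a) v = cross2 a v"
  by (simp add: eval2_def linear_form_def cross2_def algebra_simps)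

text \<open>The coefficient of \<open>p\<close> at x2^j is a monomial in x1 of degree
  \<open>n - j\<close>, so the scalars assemble to the one-variable polynomial p(1, z), from which
  all values of \<open>p\<close> are recovered.\<close>

lemma form_dehomogenize:
  fixes p :: "'a::field poly poly"
  assumes "is_form n p"
  obtains r where "degree r \<le> n" "\<And>v. eval2 p v = (\<Sum>j\<le>n. coeff r j * v $ 1 ^ (n - j) * v $ 2 ^ j)"
proof
  define r where "r = (\<Sum>j\<le>n. monom (coeff (coeff p j) (n - j)) j)"
  show "degree r \<le> n" unfolding r_def
    by (intro degree_sum_le) (auto intro: order_trans[OF degree_monom_le])
  have r: "coeff r j = coeff (coeff p j) (n - j)" if "j \<le> n" for j
    using that by (simp add: r_def coeff_sum sum.delta)
  have mon: "coeff p j = monom (coeff (coeff p j) (n - j)) (n - j)" if "j \<le> n" for j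
  proof (rule poly_eqI)
    fix i show "coeff (coeff p j) i = coeff (monom (coeff (coeff p j) (n - j)) (n - j)) i"
    proof (cases "i = n - j")
      case False
      then have "i + j \<noteq> n" by auto
      with assms have "coeff (coeff p j) i = 0" by (auto simp: is_form_def)
      with False show ?thesis by simp
    qed simp
  qed
  have deg: "degree p \<le> n"
  proof (rule degree_le, intro allI impI)
    fix j assume "n < j"
    then have "coeff (coeff p j) i = 0" for i using assms by (auto simp: is_form_def)
    then show "coeff p j = 0" by (simp add: poly_eq_iff)
  qed
  fix v :: "'a^2"
  have "poly p [:v $ 2:] = (\<Sum>j\<le>n. coeff p j * [:v $ 2:] ^ j)"
    by (subst poly_as_sum_of_monoms'[OF deg, symmetric]) (simp add: poly_sum poly_monom)
  then have "eval2 p v = (\<Sum>j\<le>n. poly (coeff p j) (v $ 1) * v $ 2 ^ j)"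
    by (simp add: eval2_def poly_sum)
  also have "\<dots> = (\<Sum>j\<le>n. coeff r j * v $ 1 ^ (n - j) * v $ 2 ^ j)"
  proof (rule sum.cong)
    fix j assume "j \<in> {..n}"
    then have "j \<le> n" by simp
    then show "poly (coeff p j) (v $ 1) * v $ 2 ^ j = coeff r j * v $ 1 ^ (n - j) * v $ 2 ^ j"
      by (subst mon) (simp_all add: poly_monom r)
  qed simp
  finally show "eval2 p v = (\<Sum>j\<le>n. coeff r j * v $ 1 ^ (n - j) * v $ 2 ^ j)" .
qed

text \<open>\<open>r\<close> is \<open>p\<close> in the chart x1 = 1. Its coefficient at
  \<open>n\<close> is recorded because it is the value of \<open>p\<close> at infinity, the one
  point that the chart misses.\<close>

lemma form_affine:
  fixes p :: "'a::field poly poly"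
  assumes "is_form n p"
  obtains r where "degree r \<le> n" "\<And>z. poly r z = eval2 p (vector [1, z])"
    "coeff r n = eval2 p (vector [0, 1])"
    "\<And>v. v $ 1 \<noteq> 0 \<Longrightarrow> eval2 p v = v $ 1 ^ n * poly r (v $ 2 / v $ 1)"
proof -
  from form_dehomogenize[OF assms] obtain r where
    r: "degree r \<le> n" "\<And>v. eval2 p v = (\<Sum>j\<le>n. coeff r j * v $ 1 ^ (n - j) * v $ 2 ^ j)" by blast
  have pr: "poly r z = (\<Sum>j\<le>n. coeff r j * z ^ j)" for z
    by (subst poly_as_sum_of_monoms'[OF r(1), symmetric]) (simp add: poly_sum poly_monom)
  show thesis
  proof
    show "degree r \<le> n" by fact
    show "poly r z = eval2 p (vector [1, z])" for z
      by (simp add: r(2) pr)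
    have "eval2 p (vector [0, 1]) = (\<Sum>j\<le>n. if j = n then coeff r j else 0)"
      unfolding r(2) by (rule sum.cong) auto
    then show "coeff r n = eval2 p (vector [0, 1])" by simp
    fix v :: "'a^2" assume v: "v $ 1 \<noteq> 0"
    show "eval2 p v = v $ 1 ^ n * poly r (v $ 2 / v $ 1)"
      unfolding r(2) pr sum_distrib_left
    proof (rule sum.cong)
      fix j assume "j \<in> {..n}"
      then have "v $ 1 ^ n = v $ 1 ^ (n - j) * v $ 1 ^ j" by (simp flip: power_add)
      with v show "coeff r j * v $ 1 ^ (n - j) * v $ 2 ^ j = v $ 1 ^ n * (coeff r j * (v $ 2 / v $ 1) ^ j)"
        by (simp add: power_divide)
    qed simp
  qed
qed

lemma eval2_scale:
  assumes "is_form n p"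
  shows "eval2 p (c *s v) = c ^ n * eval2 p v"
proof -
  from form_dehomogenize[OF assms] obtain r where
    r: "\<And>v. eval2 p v = (\<Sum>j\<le>n. coeff r j * v $ 1 ^ (n - j) * v $ 2 ^ j)" by blast
  show ?thesis unfolding r sum_distrib_left
  proof (rule sum.cong)
    fix j assume "j \<in> {..n}"
    then have "c ^ n = c ^ (n - j) * c ^ j" by (simp flip: power_add)
    then show "coeff r j * (c *s v) $ 1 ^ (n - j) * (c *s v) $ 2 ^ j = c ^ n * (coeff r j * v $ 1 ^ (n - j) * v $ 2 ^ j)"
      by (simp add: power_mult_distrib)
  qed simp
qed

lemma eval2_eq_0_proj:
  assumes "is_form n p" "v \<noteq> 0" "w \<noteq> 0" "proj v = proj w"
  shows "eval2 p v = 0 \<longleftrightarrow> eval2 p w = 0"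
  using proj_eq_scale[OF assms(2-4)] eval2_scale[OF assms(1)] by (metis mult_eq_0_iff power_eq_0_iff)

text \<open>If the coefficient of \<open>r\<close> at \<open>n\<close> vanishes, the form has a zero
  at infinity; otherwise \<open>r\<close> is nonconstant and has a root.\<close>

lemma form_has_zero:
  fixes p :: "'a::alg_closed_field poly poly"
  assumes "is_form n p" "n > 0"
  obtains v where "v \<noteq> 0" "eval2 p v = 0"
proof -
  from form_affine[OF assms(1)] obtain r where r: "degree r \<le> n" "\<And>z. poly r z = eval2 p (vector [1, z])"
    "coeff r n = eval2 p (vector [0, 1])" by metis
  show thesis
  proof (cases "coeff r n = 0")
    case True
    then show ?thesis using that[of "vector [0, 1]"] r by (auto simp: vec2_eq_iff)
  next
    case False
    then have "degree r > 0" using assms(2) le_degree by (metis gr_zeroI leD)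
    then obtain z where "poly r z = 0" using alg_closed_imp_poly_has_root by blast
    then show ?thesis using that[of "vector [1, z]"] r by (auto simp: vec2_eq_iff)
  qed
qed

text \<open>Apart from the point at infinity, the zeros are the roots of the dehomogenized
  polynomial.\<close>

lemma finite_form_zeros:
  fixes p :: "'a::field poly poly"
  assumes "is_form n p" "eval2 p w \<noteq> 0"
  shows "finite {x. \<exists>v. v \<noteq> 0 \<and> x = proj v \<and> eval2 p v = 0}"
proof -
  from form_affine[OF assms(1)] obtain r where r: "degree r \<le> n" "\<And>z. poly r z = eval2 p (vector [1, z])"
    "coeff r n = eval2 p (vector [0, 1])"
    "\<And>v. v $ 1 \<noteq> 0 \<Longrightarrow> eval2 p v = v $ 1 ^ n * poly r (v $ 2 / v $ 1)" by metis
  \<comment> \<open>If \<open>r\<close> were zero, \<open>p\<close> would vanish on the chart, and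
    also at infinity, since its value there is a coefficient of \<open>r\<close>.\<close>
  have "r \<noteq> 0"
  proof
    assume [simp]: "r = 0"
    show False
    proof (cases "w $ 1 = 0")
      case True
      then have "w = w $ 2 *s vector [0, 1]" by (simp add: vec2_eq_iff)
      then have "eval2 p w = 0" using eval2_scale[OF assms(1)] r(3) by (metis \<open>r = 0\<close> coeff_0 mult_zero_right)
      with assms show False by simp
    qed (use r(4)[of w] assms in auto)
  qed
  have "{x. \<exists>v. v \<noteq> 0 \<and> x = proj v \<and> eval2 p v = 0} \<subseteq>
      insert (proj (vector [0, 1])) ((\<lambda>z. proj (vector [1, z])) ` {z. poly r z = 0})"
  proof clarify
    fix v :: "'a^2" assume v: "v \<noteq> 0" "eval2 p v = 0"
      and "proj v \<notin> (\<lambda>z. proj (vector [1, z])) ` {z. poly r z = 0}"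
    show "proj v = proj (vector [0, 1])"
    proof (cases "v $ 1 = 0")
      case True
      with v show ?thesis by (subst proj_eq_iff) (auto simp: vec2_eq_iff cross2_def)
    next
      case False
      then have "poly r (v $ 2 / v $ 1) = 0" using r(4)[OF False] v by simp
      moreover have "proj v = proj (vector [1, v $ 2 / v $ 1])"
        using v False by (subst proj_eq_iff) (auto simp: vec2_eq_iff cross2_def)
      ultimately show ?thesis using \<open>proj v \<notin> _\<close> by blast
    qed
  qed
  then show ?thesis
    using poly_roots_finite[OF \<open>r \<noteq> 0\<close>] by (rule finite_subset[OF _ finite.insertI[OF finite_imageI]])
qed

text \<open>That the field is infinite is used twice: some constant in place of x2 leaves a nonzero
  polynomial in x1, which then has a nonzero value.\<close>

lemma eval2_nonzero:
  fixes p :: "'a::field_char_0 poly poly"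
  assumes "p \<noteq> 0"
  obtains v where "eval2 p v \<noteq> 0"
proof -
  have "inj (\<lambda>y::'a. [:y:])" by (rule injI) simp
  then have "infinite (range (\<lambda>y::'a. [:y:]))"
    using infinite_UNIV_char_0 finite_imageD by blast
  then have "\<not> range (\<lambda>y. [:y:]) \<subseteq> {q. poly p q = 0}"
    using poly_roots_finite[OF assms] finite_subset by blast
  then obtain y where "poly p [:y:] \<noteq> 0" by auto
  from poly_roots_finite[OF this] obtain x where "poly (poly p [:y:]) x \<noteq> 0"
    using infinite_UNIV_char_0[where 'a='a] by (metis (mono_tags, lifting) Collect_cong UNIV_def)
  then show thesis using that[of "vector [x, y]"] by (simp add: eval2_def)
qed


section \<open>The Zariski topologies\<close>

text \<open>The generating sets are closed under intersection, as \<open>p\<close> and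
  \<open>q\<close> are both nonzero exactly where \<open>p * q\<close> is; hence they form a
  basis.\<close>

lemma zariski_A2_basis:
  assumes "openin zariski_A2 U" "v \<in> U"
  obtains p where "eval2 p v \<noteq> 0" "{w. eval2 p w \<noteq> 0} \<subseteq> U"
proof -
  have "generate_topology_on {{v. eval2 p v \<noteq> 0} | p. True} U"
    using assms(1) by (simp add: zariski_A2_def openin_topology_generated_by_iff)
  then have "\<forall>v\<in>U. \<exists>p. eval2 p v \<noteq> 0 \<and> {w. eval2 p w \<noteq> 0} \<subseteq> U"
  proof induction
    case (Int a b)
    show ?case
    proof
      fix v assume "v \<in> a \<inter> b"
      then obtain p q where "eval2 p v \<noteq> 0" "{w. eval2 p w \<noteq> 0} \<subseteq> a"
        "eval2 q v \<noteq> 0" "{w. eval2 q w \<noteq> 0} \<subseteq> b"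
        using Int by blast
      then show "\<exists>p. eval2 p v \<noteq> 0 \<and> {w. eval2 p w \<noteq> 0} \<subseteq> a \<inter> b"
        by (intro exI[of _ "p * q"]) auto
    qed
  next
    case (UN K)
    then show ?case by (meson UnionE Union_upper order_trans)
  qed auto
  with assms that show thesis by blast
qed

lemma openin_zariski_A2_UNIV [simp]: "openin zariski_A2 UNIV"
proof -
  have "{v. eval2 1 v \<noteq> 0} = (UNIV :: ('a^2) set)" by simp
  then have "(UNIV :: ('a^2) set) \<in> {{v. eval2 p v \<noteq> 0} | p. True}" by blast
  then show ?thesis unfolding zariski_A2_def by (rule topology_generated_by_Basis)
qed

lemma zariski_P1_basis:
  assumes "openin zariski_P1 U" "x \<in> U"
  obtains n p where "is_form n p" "eval2 p (rep x) \<noteq> 0" "proj ` {v. v \<noteq> 0 \<and> eval2 p v \<noteq> 0} \<subseteq> U"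
proof -
  have "generate_topology_on {proj ` {v. v \<noteq> 0 \<and> eval2 p v \<noteq> 0} | p. \<exists>d. is_form d p} U"
    using assms(1) by (simp add: zariski_P1_def openin_topology_generated_by_iff)
  then have "\<forall>x\<in>U. \<exists>n p. is_form n p \<and> eval2 p (rep x) \<noteq> 0 \<and> proj ` {v. v \<noteq> 0 \<and> eval2 p v \<noteq> 0} \<subseteq> U"
  proof induction
    case (Int a b)
    show ?case
    proof
      fix x assume "x \<in> a \<inter> b"
      then have x: "x \<in> a" "x \<in> b" by auto
      obtain n p where "is_form n p" "eval2 p (rep x) \<noteq> 0" "proj ` {v. v \<noteq> 0 \<and> eval2 p v \<noteq> 0} \<subseteq> a"
        using bspec[OF Int.IH(1) x(1)] by (elim exE conjE)
      moreover obtain m q where "is_form m q" "eval2 q (rep x) \<noteq> 0" "proj ` {v. v \<noteq> 0 \<and> eval2 q v \<noteq> 0} \<subseteq> b"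
        using bspec[OF Int.IH(2) x(2)] by (elim exE conjE)
      ultimately show "\<exists>n p. is_form n p \<and> eval2 p (rep x) \<noteq> 0 \<and> proj ` {v. v \<noteq> 0 \<and> eval2 p v \<noteq> 0} \<subseteq> a \<inter> b"
        by (intro exI[of _ "n + m"] exI[of _ "p * q"]) (auto intro: is_form_mult)
    qed
  next
    case (UN K)
    then show ?case by (meson UnionE Union_upper order_trans)
  next
    case (Basis s)
    then obtain n p where s: "s = proj ` {v. v \<noteq> 0 \<and> eval2 p v \<noteq> 0}" "is_form n p" by blast
    show ?case
    proof
      fix x assume "x \<in> s"
      with s have "eval2 p (rep x) \<noteq> 0" using rep eval2_eq_0_proj by blast
      with s show "\<exists>n p. is_form n p \<and> eval2 p (rep x) \<noteq> 0 \<and> proj ` {v. v \<noteq> 0 \<and> eval2 p v \<noteq> 0} \<subseteq> s"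
        by blast
    qed
  qed auto
  then have "\<exists>n p. is_form n p \<and> eval2 p (rep x) \<noteq> 0 \<and> proj ` {v. v \<noteq> 0 \<and> eval2 p v \<noteq> 0} \<subseteq> U"
    using assms(2) by (rule bspec)
  then show thesis using that by (elim exE conjE)
qed

lemma openin_zariski_P1_UNIV [simp]: "openin zariski_P1 UNIV"
proof -
  have "proj ` {v. v \<noteq> 0 \<and> eval2 1 v \<noteq> 0} = (UNIV :: 'a P1_point set)"
  proof (intro equalityI subsetI)
    fix x :: "'a P1_point"
    show "x \<in> proj ` {v. v \<noteq> 0 \<and> eval2 1 v \<noteq> 0}"
      using rep[of x] by (intro image_eqI[of _ _ "rep x"]) auto
  qed simp
  then have "(UNIV :: 'a P1_point set) \<in> {proj ` {v. v \<noteq> 0 \<and> eval2 p v \<noteq> 0} | p. \<exists>d. is_form d p}"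
    by (intro CollectI exI[of _ 1] conjI exI[of _ 0]) (simp_all add: is_form_1)
  then show ?thesis unfolding zariski_P1_def by (rule topology_generated_by_Basis)
qed

text \<open>Used to refute birationality: a rational inverse makes the map injective on a nonempty
  open set, hence off a finite set.\<close>

lemma finite_compl_zariski_P1:
  assumes "openin zariski_P1 U" "U \<noteq> {}"
  shows "finite (- U)"
proof -
  from assms obtain x where "x \<in> U" by blast
  from zariski_P1_basis[OF assms(1) this] obtain n p where
    p: "is_form n p" "eval2 p (rep x) \<noteq> 0" "proj ` {v. v \<noteq> 0 \<and> eval2 p v \<noteq> 0} \<subseteq> U" .
  have "- U \<subseteq> {x. \<exists>v. v \<noteq> 0 \<and> x = proj v \<and> eval2 p v = 0}"
  proof
    fix y assume "y \<in> - U"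
    then have "y \<notin> proj ` {v. v \<noteq> 0 \<and> eval2 p v \<noteq> 0}" using p(3) by blast
    then have "eval2 p (rep y) = 0" using imageI[of "rep y" "{v. v \<noteq> 0 \<and> eval2 p v \<noteq> 0}" proj] rep(1)[of y]
      by (auto simp: rep(2))
    then show "y \<in> {x. \<exists>v. v \<noteq> 0 \<and> x = proj v \<and> eval2 p v = 0}"
      using rep(1)[of y] rep(2)[of y, symmetric] by blast
  qed
  then show ?thesis using finite_form_zeros[OF p(1,2)] finite_subset by blast
qed

section \<open>The covariant of a finite set of points\<close>

definition points_form :: "'a::field P1_point set \<Rightarrow> 'a poly poly" where
  "points_form S = (\<Prod>x\<in>S. linear_form (rep x))"

text \<open>
  Up to the sign, this is the gradient of \<open>points_form S\<close> rotated by a right angle, hence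
  \<open>SL\<^sub>2\<close>-covariant.
\<close>

definition points_cov :: "'a::field P1_point set \<Rightarrow> 'a^2 \<Rightarrow> 'a^2" where
  "points_cov S v = (\<Sum>x\<in>S. eval2 (points_form (S - {x})) v *s rep x)"

definition points_cov_poly :: "'a::field P1_point set \<Rightarrow> 2 \<Rightarrow> 'a poly poly" where
  "points_cov_poly S i = (\<Sum>x\<in>S. [:[:rep x $ i:]:] * points_form (S - {x}))"

lemma eval2_points_form: "eval2 (points_form S) v = (\<Prod>x\<in>S. cross2 (rep x) v)"
  by (simp add: points_form_def eval2_prod)

lemma is_form_points_form: "is_form (card S) (points_form S)"
  using is_form_prod[of S "\<lambda>_. 1" "\<lambda>x. linear_form (rep x)", OF is_form_linear]
  by (simp add: points_form_def)

lemma eval2_points_cov_poly: "eval2 (points_cov_poly S i) v = points_cov S v $ i"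
  by (simp add: points_cov_poly_def points_cov_def eval2_sum mult.commute)

lemma is_form_points_cov_poly:
  assumes "finite S"
  shows "is_form (card S - 1) (points_cov_poly S i)"
  unfolding points_cov_poly_def
proof (rule is_form_sum)
  fix x assume "x \<in> S"
  then show "is_form (card S - 1) ([:[:rep x $ i:]:] * points_form (S - {x}))"
    using is_form_mult[OF is_form_const is_form_points_form] assms by (metis add_0 card_Diff_singleton)
qed

lemma points_form_eq_0_iff:
  assumes "finite S" "v \<noteq> 0"
  shows "eval2 (points_form S) v = 0 \<longleftrightarrow> proj v \<in> S"
  using assms by (auto simp: eval2_points_form cross2_rep_eq_0_iff')

lemma points_form_remove:
  assumes "finite S" "x \<in> S"
  shows "eval2 (points_form S) v = cross2 (rep x) v * eval2 (points_form (S - {x})) v"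
  using assms by (simp add: eval2_points_form prod.remove)

text \<open>This is Euler's identity for the form of \<open>S\<close>: the determinant of the
  rotated gradient with \<open>v\<close> is the derivative of the form along
  \<open>v\<close>.\<close>

lemma cross2_points_cov:
  assumes "finite S"
  shows "cross2 (points_cov S v) v = of_nat (card S) * eval2 (points_form S) v"
proof -
  have "cross2 (points_cov S v) v = (\<Sum>x\<in>S. eval2 (points_form S) v)"
    unfolding points_cov_def cross2_sum
    by (rule sum.cong) (simp_all add: points_form_remove[OF assms] mult.commute)
  then show ?thesis by simp
qed

text \<open>At a point of \<open>S\<close> every summand but that of the point itself contains a
  vanishing factor, and the remaining product is nonzero because the points are distinct.\<close>

lemma points_cov_at:
  assumes "finite S" "v \<noteq> 0" "proj v \<in> S"
  obtains c where "c \<noteq> 0" "points_cov S v = c *s v"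
proof -
  define x where "x = proj v"
  have z: "eval2 (points_form (S - {y})) v = 0" if "y \<in> S - {x}" for y
    using that assms by (subst points_form_eq_0_iff) (auto simp: x_def)
  have "points_cov S v = eval2 (points_form (S - {x})) v *s rep x"
    unfolding points_cov_def using assms z
    by (subst sum.remove[of S x]) (auto simp: x_def intro!: sum.neutral)
  moreover have "eval2 (points_form (S - {x})) v \<noteq> 0"
    using assms by (subst points_form_eq_0_iff) (auto simp: x_def)
  moreover obtain b where "b \<noteq> 0" "rep x = b *s v"
    using proj_eq_scale[of v "rep x"] rep[of x] assms by (metis x_def)
  ultimately show thesis
    by (intro that[of "eval2 (points_form (S - {x})) v * b"]) (simp_all add: vector_smult_assoc)
qed

text \<open>Characteristic zero enters here, through the factor \<open>card S\<close> in Euler's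
  identity off \<open>S\<close>.\<close>

lemma points_cov_nonzero:
  fixes v :: "'a::field_char_0^2"
  assumes "finite S" "S \<noteq> {}" "v \<noteq> 0"
  shows "points_cov S v \<noteq> 0"
proof (cases "proj v \<in> S")
  case True
  obtain c where "c \<noteq> 0" "points_cov S v = c *s v"
    using points_cov_at[OF assms(1,3) True] .
  then show ?thesis using assms(3) by (simp add: vec2_eq_iff)
next
  case False
  then have "eval2 (points_form S) v \<noteq> 0" using points_form_eq_0_iff assms by blast
  moreover have "card S \<noteq> 0" using assms by simp
  ultimately have "cross2 (points_cov S v) v \<noteq> 0" by (simp add: cross2_points_cov[OF assms(1)])
  then show ?thesis by auto
qed

lemma points_cov_scale:
  assumes "finite S"
  shows "points_cov S (c *s v) = c ^ (card S - 1) *s points_cov S v"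
  by (simp add: vec2_eq_iff eval2_scale[OF is_form_points_cov_poly[OF assms]] flip: eval2_points_cov_poly)

text \<open>The product rule for the form of \<open>S\<close>, split into det(rep x, v) and the form
  of the other points. It isolates the factor that vanishes at \<open>x\<close>, which makes the
  derivative of the map at this fixed point computable.\<close>

lemma points_cov_remove:
  assumes "finite S" "x \<in> S"
  shows "points_cov S v = eval2 (points_form (S - {x})) v *s rep x + cross2 (rep x) v *s points_cov (S - {x}) v"
proof -
  have "eval2 (points_form (S - {y})) v = cross2 (rep x) v * eval2 (points_form (S - {x} - {y})) v"
    if "y \<in> S - {x}" for y
  proof -
    have "S - {x} - {y} = S - {y} - {x}" by blast
    then show ?thesis using points_form_remove[of "S - {y}" x v] that assms by auto
  qed
  then show ?thesis
    unfolding points_cov_def using assms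
    by (subst sum.remove[of S x]) (auto simp: vec2_eq_iff sum_distrib_left intro!: sum.cong)
qed

text \<open>The zeros of this form are the fibre of the induced map over the point of
  \<open>c\<close>.\<close>

definition cross_cov_poly :: "'a::field^2 \<Rightarrow> 'a P1_point set \<Rightarrow> 'a poly poly" where
  "cross_cov_poly c S = [:[:c $ 1:]:] * points_cov_poly S 2 + [:[:- c $ 2:]:] * points_cov_poly S 1"

lemma eval2_cross_cov_poly: "eval2 (cross_cov_poly c S) v = cross2 c (points_cov S v)"
  by (simp add: cross_cov_poly_def cross2_def eval2_points_cov_poly)

lemma is_form_cross_cov_poly: "finite S \<Longrightarrow> is_form (card S - 1) (cross_cov_poly c S)"
  unfolding cross_cov_poly_def
  by (intro is_form_add is_form_mult[of 0, simplified] is_form_const is_form_points_cov_poly)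

section \<open>The induced map of the projective line and its fibres\<close>

definition points_map :: "'a::field P1_point set \<Rightarrow> 'a P1_point \<Rightarrow> 'a P1_point" where
  "points_map S x = proj (points_cov S (rep x))"

lemma points_map_proj:
  fixes v :: "'a::field_char_0^2"
  assumes "finite S" "S \<noteq> {}" "v \<noteq> 0"
  shows "points_map S (proj v) = proj (points_cov S v)"
proof -
  obtain c where "c \<noteq> 0" "rep (proj v) = c *s v"
    using proj_eq_scale[of v "rep (proj v)"] rep[of "proj v"] assms by metis
  then show ?thesis
    using points_cov_nonzero[OF assms] by (simp add: points_map_def points_cov_scale[OF assms(1)])
qed

lemma points_map_eq_iff:
  fixes v :: "'a::field_char_0^2"
  assumes "finite S" "S \<noteq> {}" "v \<noteq> 0" "c \<noteq> 0"
  shows "points_map S (proj v) = proj c \<longleftrightarrow> eval2 (cross_cov_poly c S) v = 0"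
  using points_cov_nonzero[OF assms(1-3)] proj_eq_iff[of c "points_cov S v"] assms
  by (auto simp: points_map_proj eval2_cross_cov_poly)

text \<open>A fibre is the zero set of a form of degree \<open>card S - 1\<close>, which is
  positive.\<close>

lemma surj_points_map:
  fixes S :: "'a::{alg_closed_field, field_char_0} P1_point set"
  assumes "finite S" "card S \<ge> 2"
  shows "surj (points_map S)"
  unfolding surj_def
proof
  fix y
  have "S \<noteq> {}" using assms by auto
  obtain v where "v \<noteq> 0" "eval2 (cross_cov_poly (rep y) S) v = 0"
    using form_has_zero[OF is_form_cross_cov_poly[OF assms(1)]] assms by (metis One_nat_def Suc_1 Suc_le_lessD zero_less_diff)
  then show "\<exists>x. y = points_map S x"
    using points_map_eq_iff[OF assms(1) \<open>S \<noteq> {}\<close>, of v "rep y"] rep[of y] by metis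
qed

text \<open>By surjectivity some point lies outside the fibre; there the form that cuts out the
  fibre does not vanish, so it has only finitely many zeros.\<close>

lemma finite_points_map_fiber:
  fixes S :: "'a::{alg_closed_field, field_char_0} P1_point set"
  assumes "finite S" "card S \<ge> 2"
  shows "finite {x. points_map S x = y}"
proof -
  have "S \<noteq> {}" using assms by auto
  obtain x where "points_map S x \<noteq> y"
  proof -
    obtain y' where "y' \<noteq> y" using infinite_P1 by (metis UNIV_eq_I finite.emptyI finite.insertI insertI1)
    then show thesis using that surj_points_map[OF assms] by (metis surj_def)
  qed
  then have "eval2 (cross_cov_poly (rep y) S) (rep x) \<noteq> 0"
    using points_map_eq_iff[OF assms(1) \<open>S \<noteq> {}\<close>, of "rep x" "rep y"] rep by metis
  from finite_form_zeros[OF is_form_cross_cov_poly[OF assms(1)] this]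
  show ?thesis
  proof (rule finite_subset[rotated], intro subsetI CollectI)
    fix x assume "x \<in> {x. points_map S x = y}"
    then have "eval2 (cross_cov_poly (rep y) S) (rep x) = 0"
      using points_map_eq_iff[OF assms(1) \<open>S \<noteq> {}\<close>, of "rep x" "rep y"] rep by (metis mem_Collect_eq)
    then show "\<exists>v. v \<noteq> 0 \<and> x = proj v \<and> eval2 (cross_cov_poly (rep y) S) v = 0"
      using rep by metis
  qed
qed

text \<open>Over an algebraically closed field the only root takes up the whole degree, so it is at
  least a double root.\<close>

lemma pderiv_eq_0_only_root:
  fixes p :: "'a::alg_closed_field poly"
  assumes "degree p \<ge> 2" "\<And>y. poly p y = 0 \<Longrightarrow> y = z"
  shows "poly (pderiv p) z = 0"
proof -
  obtain y where "poly p y = 0" using alg_closed_imp_poly_has_root[of p] assms(1) by auto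
  then have "poly p z = 0" using assms(2) by blast
  then obtain q where q: "p = [:- z, 1:] * q" unfolding poly_eq_0_iff_dvd by (rule dvdE)
  have "q \<noteq> 0" using q assms(1) by auto
  then have "degree q > 0" using assms(1) unfolding q by (subst (asm) degree_mult_eq) auto
  then obtain y where "poly q y = 0" using alg_closed_imp_poly_has_root by blast
  then have "poly q z = 0" using assms(2)[of y] by (simp add: q)
  then show ?thesis unfolding q pderiv_mult by simp
qed

text \<open>
  If the map were injective off a finite set, all its general fibres would be totally ramified, so
  that its Wronskian would vanish.  But at a point of \<open>S\<close>, which is a fixed point of the map, the
  Wronskian is nonzero.
\<close>

lemma points_map_not_inj_cofinite:
  fixes S :: "'a::{alg_closed_field, field_char_0} P1_point set"
  assumes S: "finite S" "card S \<ge> 3" and B: "finite B"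
  shows "\<not> inj_on (points_map S) (- B)"
proof
  assume inj: "inj_on (points_map S) (- B)"
  have ne: "S \<noteq> {}" using S by auto
  define n where "n = card S - 1"
  have n: "n \<ge> 2" using S by (simp add: n_def)
  note form = is_form_points_cov_poly[OF S(1), folded n_def]
  obtain r1 where r1: "degree r1 \<le> n" "\<And>z. poly r1 z = points_cov S (vector [1, z]) $ 1"
    "coeff r1 n = points_cov S (vector [0, 1]) $ 1"
    using form_affine[OF form[of 1]] unfolding eval2_points_cov_poly by metis
  obtain r2 where r2: "degree r2 \<le> n" "\<And>z. poly r2 z = points_cov S (vector [1, z]) $ 2"
    "coeff r2 n = points_cov S (vector [0, 1]) $ 2"
    using form_affine[OF form[of 2]] unfolding eval2_points_cov_poly by metis
  \<comment> \<open>The Wronskian of the map in the affine chart, whose zeros are the ramification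
    points there.\<close>
  define W where "W = r1 * pderiv r2 - r2 * pderiv r1"
  \<comment> \<open>For a point outside \<open>B'\<close> the whole fibre through it avoids
    \<open>B\<close>, so injectivity reduces this fibre to a single point, which lies in the
    chart.\<close>
  define B' where "B' = {x. points_map S x \<in> points_map S ` B} \<union> {proj (vector [0, 1])}"
  have "{x. points_map S x \<in> points_map S ` B} = (\<Union>y\<in>points_map S ` B. {x. points_map S x = y})" by auto
  then have "finite B'" using B finite_points_map_fiber[of S] S by (simp add: B'_def)
  define pt where "pt z = (vector [1, z] :: 'a^2)" for z
  have pt: "pt z \<noteq> 0" for z by (simp add: pt_def vec2_eq_iff)
  have inj_pt: "y = z" if "proj (pt y) = proj (pt z)" for y z
    using that unfolding proj_eq_iff[OF pt pt] by (simp add: cross2_def pt_def)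
  have W0: "poly W z = 0" if z: "proj (pt z) \<notin> B'" for z
  proof -
    define c where "c = points_cov S (pt z)"
    have c: "c \<noteq> 0" unfolding c_def using points_cov_nonzero[OF S(1) ne pt] .
    have cz: "points_map S (proj (pt z)) = proj c"
      by (simp add: points_map_proj[OF S(1) ne pt] c_def)
    have zero: "proj v = proj (pt z)" if v: "v \<noteq> 0" "cross2 c (points_cov S v) = 0" for v
    proof -
      have eq: "points_map S (proj v) = points_map S (proj (pt z))"
        using points_map_eq_iff[OF S(1) ne v(1) c] v(2) cz by (simp add: eval2_cross_cov_poly)
      have "points_map S (proj (pt z)) \<notin> points_map S ` B" using z by (simp add: B'_def)
      with eq have "proj v \<notin> B" "proj (pt z) \<notin> B" by (metis imageI)+
      with inj eq show ?thesis by (auto dest: inj_onD)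
    qed
    \<comment> \<open>The roots of \<open>g\<close> are the fibre through \<open>z\<close> in the
      chart. Infinity is not in this fibre, so the coefficient at \<open>n\<close> survives and
      \<open>g\<close> has degree at least 2, with \<open>z\<close> as its only root.\<close>
    define g where "g = smult (c $ 1) r2 - smult (c $ 2) r1"
    have "coeff g n = cross2 c (points_cov S (vector [0, 1]))"
      by (simp add: g_def r1 r2 cross2_def)
    also have "\<dots> \<noteq> 0"
    proof
      assume "cross2 c (points_cov S (vector [0, 1])) = 0"
      moreover have "(vector [0, 1] :: 'a^2) \<noteq> 0" by (simp add: vec2_eq_iff)
      ultimately have "proj (vector [0, 1]) = proj (pt z)" using zero by blast
      with z show False by (simp add: B'_def)
    qed
    finally have "degree g \<ge> 2" using n le_degree order_trans by blast
    moreover have "y = z" if "poly g y = 0" for y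
    proof -
      have "cross2 c (points_cov S (pt y)) = 0"
        using that by (simp add: g_def r1 r2 cross2_def pt_def)
      with zero pt inj_pt show ?thesis by blast
    qed
    ultimately have "poly (pderiv g) z = 0" by (rule pderiv_eq_0_only_root)
    \<comment> \<open>The entries of \<open>c\<close> are the values of \<open>r1\<close> and
      \<open>r2\<close> at \<open>z\<close>, so the derivative of \<open>g\<close> at
      \<open>z\<close> is the value of \<open>W\<close>.\<close>
    then show ?thesis
      by (simp add: g_def W_def pderiv_diff pderiv_smult c_def r1 r2 pt_def)
  qed
  have "W = 0"
  proof (rule ccontr)
    assume "W \<noteq> 0"
    have "finite ((\<lambda>z. proj (pt z)) -` B')"
      using \<open>finite B'\<close> by (rule finite_vimageI) (auto intro: injI inj_pt)
    moreover have "UNIV \<subseteq> {z. poly W z = 0} \<union> (\<lambda>z. proj (pt z)) -` B'" using W0 by auto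
    ultimately show False
      using poly_roots_finite[OF \<open>W \<noteq> 0\<close>] infinite_UNIV_char_0[where 'a='a] by (metis finite_UnI finite_subset)
  qed
  obtain x where x: "x \<in> S" "x \<noteq> proj (vector [0, 1])"
  proof -
    have "\<not> S \<subseteq> {proj (vector [0, 1])}" using S(2) card_mono[of "{proj (vector [0, 1])}" S] by auto
    then show thesis using that by blast
  qed
  define a where "a = rep x"
  have a1: "a $ 1 \<noteq> 0"
  proof
    assume *: "a $ 1 = 0"
    have "(vector [0, 1] :: 'a^2) \<noteq> 0" by (simp add: vec2_eq_iff)
    then have "proj a = proj (vector [0, 1])" using rep[of x] *
      by (subst proj_eq_iff) (auto simp: cross2_def a_def)
    with x show False by (simp add: a_def rep)
  qed
  define z where "z = a $ 2 / a $ 1"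
  have az: "a = a $ 1 *s pt z" using a1 by (simp add: vec2_eq_iff pt_def z_def)
  have xz: "x = proj (pt z)"
    using pt a1 proj_scale[of "pt z" "a $ 1"] az rep(2)[of x] by (metis a_def)
  let ?S' = "S - {x}"
  have "finite ?S'" using S by simp
  obtain K where K: "\<And>z. poly K z = cross2 a (points_cov ?S' (pt z))"
    using form_affine[OF is_form_cross_cov_poly[OF \<open>finite ?S'\<close>, of a]] unfolding eval2_cross_cov_poly pt_def by metis
  \<comment> \<open>Pairing with \<open>a\<close> kills the summand of \<open>x\<close> and leaves
    the factor det(a, .); the derivative at its zero \<open>z\<close> then only needs the value of
    \<open>K\<close>.\<close>
  have "poly (smult (a $ 1) r2 - smult (a $ 2) r1) y = poly ([:- (a $ 2), a $ 1:] * K) y" for y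
  proof -
    have "poly (smult (a $ 1) r2 - smult (a $ 2) r1) y = cross2 a (points_cov S (pt y))"
      by (simp add: r1 r2 cross2_def pt_def)
    also have "\<dots> = cross2 a (pt y) * poly K y"
      using points_cov_remove[OF S(1) x(1), of "pt y"] by (simp add: K cross2_add flip: a_def)
    finally show ?thesis by (simp add: cross2_def pt_def algebra_simps)
  qed
  then have "smult (a $ 1) r2 - smult (a $ 2) r1 = [:- (a $ 2), a $ 1:] * K"
    by (simp add: poly_eq_poly_eq_iff[symmetric] fun_eq_iff)
  then have "poly (pderiv (smult (a $ 1) r2 - smult (a $ 2) r1)) z = poly (pderiv ([:- (a $ 2), a $ 1:] * K)) z"
    by simp
  then have d: "a $ 1 * poly (pderiv r2) z - a $ 2 * poly (pderiv r1) z = a $ 1 * poly K z"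
    using a1 by (simp add: pderiv_diff pderiv_smult pderiv_mult pderiv_pCons z_def)
  have "poly K z = - a $ 1 * (of_nat (card ?S') * eval2 (points_form ?S') (pt z))"
  proof -
    have "poly K z = cross2 (a $ 1 *s pt z) (points_cov ?S' (pt z))" using K az by simp
    also have "\<dots> = - a $ 1 * cross2 (points_cov ?S' (pt z)) (pt z)"
      using cross2_swap[of "pt z"] by simp
    finally show ?thesis using cross2_points_cov[OF \<open>finite ?S'\<close>] by simp
  qed
  moreover have "card ?S' \<noteq> 0" using S x(1) by simp
  moreover have "eval2 (points_form ?S') (pt z) \<noteq> 0"
    using points_form_eq_0_iff[OF \<open>finite ?S'\<close> pt] xz by blast
  ultimately have "poly K z \<noteq> 0" using a1 by simp
  obtain k where k: "k \<noteq> 0" "points_cov S (pt z) = k *s pt z"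
    using points_cov_at[OF S(1) pt] x(1) xz by metis
  \<comment> \<open>At the fixed point the value of the map is proportional to (1, z), as is
    \<open>a\<close>; up to the factor \<open>k\<close> the Wronskian is therefore the derivative
    just computed.\<close>
  then have "poly r1 z = k" "poly r2 z = k * z" by (simp_all add: r1 r2 pt_def)
  then have "a $ 1 * poly W z = k * (a $ 1 * poly (pderiv r2) z - a $ 2 * poly (pderiv r1) z)"
    using a1 by (simp add: W_def z_def algebra_simps)
  also have "\<dots> \<noteq> 0" using d a1 k \<open>poly K z \<noteq> 0\<close> by simp
  finally show False using \<open>W = 0\<close> by simp
qed

section \<open>The action of matrices\<close>

definition pact :: "'a::field^2^2 \<Rightarrow> 'a P1_point \<Rightarrow> 'a P1_point" where
  "pact A x = proj (A *v rep x)"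

lemma mult_eq_0_vec:
  fixes A :: "'a::field^2^2"
  assumes "det A \<noteq> 0" "A *v v = 0"
  shows "v = 0"
proof -
  have "cross2 v u = 0" for u
    using assms cross2_matrix[of A v u] by simp
  from this[of "vector [1, 0]"] this[of "vector [0, 1]"] show ?thesis
    by (simp add: vec2_eq_iff cross2_def)
qed

lemma pact_proj:
  assumes "det A = 1" "v \<noteq> 0"
  shows "pact A (proj v) = proj (A *v v)"
proof -
  obtain c where c: "c \<noteq> 0" "rep (proj v) = c *s v"
    using proj_eq_scale[of v "rep (proj v)"] rep[of "proj v"] assms by metis
  have "A *v v \<noteq> 0" using mult_eq_0_vec[of A v] assms by auto
  then show ?thesis using c by (simp add: pact_def vector_scalar_commute)
qed

lemma pact_mat_1 [simp]: "pact (mat 1) x = x"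
  by (simp add: pact_def rep)

lemma pact_mult:
  assumes "det A = 1" "det B = 1"
  shows "pact (A ** B) x = pact A (pact B x)"
proof -
  have "B *v rep x \<noteq> 0" using mult_eq_0_vec[of B "rep x"] assms rep(1) by auto
  then show ?thesis
    using assms by (simp add: pact_def[of "A ** B"] pact_def[of B] pact_proj matrix_vector_mul_assoc)
qed

lemma matrix_vector_mult_sum: "A *v (sum f S) = (\<Sum>x\<in>S. A *v f x)" for A :: "'a::field^'n^'m"
  by (induction S rule: infinite_finite_induct) (simp_all add: matrix_vector_right_distrib)

definition cov_factor :: "'a::field^2^2 \<Rightarrow> 'a P1_point set \<Rightarrow> 'a \<Rightarrow> bool" where
  "cov_factor A S c \<longleftrightarrow>
     (\<forall>v. A *v points_cov S v = c *s points_cov S (A *v v)) \<and>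
     (\<forall>v. eval2 (points_form S) v = c * eval2 (points_form S) (A *v v))"

text \<open>Write A a_x = c_x a_(Ax) for the representatives. As \<open>A\<close> preserves
  determinants, reindexing the product over \<open>S\<close> gives the form the factor
  \<open>\<Prod>x\<in>S. c x\<close>. The covariant gets the same factor: the product in the summand
  of \<open>x\<close> lacks c_x, but A a_x supplies it.\<close>

lemma cov_factor_exists:
  assumes A: "det A = 1" and S: "finite S" "pact A ` S = S"
  obtains c where "cov_factor A S c"
proof -
  define c where "c x = (SOME c. A *v rep x = c *s rep (pact A x))" for x
  have c: "A *v rep x = c x *s rep (pact A x)" for x
  proof -
    have "A *v rep x \<noteq> 0" using mult_eq_0_vec[of A "rep x"] A rep(1) by auto
    then have "\<exists>c. A *v rep x = c *s rep (pact A x)"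
      using proj_eq_scale[of "rep (pact A x)" "A *v rep x"] rep pact_def by metis
    then show ?thesis unfolding c_def by (rule someI_ex)
  qed
  have inj: "inj_on (pact A) S" using S by (intro eq_card_imp_inj_on) auto
  have F: "eval2 (points_form T) v = (\<Prod>x\<in>T. c x) * eval2 (points_form (pact A ` T)) (A *v v)"
    if "T \<subseteq> S" for T v
  proof -
    have "eval2 (points_form T) v = (\<Prod>x\<in>T. c x * cross2 (rep (pact A x)) (A *v v))"
      unfolding eval2_points_form
      by (rule prod.cong) (simp_all flip: cross2_scale(1) c add: cross2_matrix A)
    then show ?thesis
      using inj_on_subset[OF inj that] by (simp add: prod.distrib eval2_points_form prod.reindex)
  qed
  let ?C = "\<Prod>x\<in>S. c x"
  have "A *v points_cov S v = ?C *s points_cov S (A *v v)" for v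
  proof -
    have "A *v points_cov S v = (\<Sum>x\<in>S. eval2 (points_form (S - {x})) v *s (A *v rep x))"
      by (simp add: points_cov_def matrix_vector_mult_sum vector_scalar_commute)
    also have "\<dots> = (\<Sum>x\<in>S. ?C *s (eval2 (points_form (S - {pact A x})) (A *v v) *s rep (pact A x)))"
    proof (rule sum.cong)
      fix x assume x: "x \<in> S"
      have "pact A ` (S - {x}) = S - {pact A x}"
        using inj_on_image_set_diff[OF inj, of S "{x}"] x S by simp
      moreover have "?C = c x * (\<Prod>y\<in>S - {x}. c y)" using prod.remove[OF S(1) x] .
      ultimately show "eval2 (points_form (S - {x})) v *s (A *v rep x) =
          ?C *s (eval2 (points_form (S - {pact A x})) (A *v v) *s rep (pact A x))"
        using F[of "S - {x}" v] by (simp add: c vector_smult_assoc mult_ac)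
    qed simp
    also have "\<dots> = (\<Sum>x\<in>pact A ` S. ?C *s (eval2 (points_form (S - {x})) (A *v v) *s rep x))"
      using inj by (simp add: sum.reindex)
    also have "\<dots> = ?C *s points_cov S (A *v v)"
      using S by (simp add: points_cov_def vec2_eq_iff sum_distrib_left mult.assoc)
    finally show ?thesis .
  qed
  moreover have "eval2 (points_form S) v = ?C * eval2 (points_form S) (A *v v)" for v
    using F[OF subset_refl, of v] unfolding S(2) .
  ultimately show thesis using that unfolding cov_factor_def by blast
qed

text \<open>Off \<open>S\<close> the values of the form at \<open>v\<close> and
  \<open>z *s v\<close> are compared. On \<open>S\<close> the form vanishes, and the covariant, a
  multiple of \<open>v\<close> of degree \<open>card S - 1\<close>, is compared instead; one more
  factor \<open>z\<close> cancels because \<open>A\<close> also acts on the value. Hence the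
  exponents \<open>card S\<close> and \<open>card S - 2\<close>.\<close>

lemma cov_factor_eigenvector:
  assumes "cov_factor A S c" "finite S" "A *v v = z *s v" "v \<noteq> 0" "z \<noteq> 0"
  shows "proj v \<notin> S \<Longrightarrow> c * z ^ card S = 1" "proj v \<in> S \<Longrightarrow> card S \<ge> 2 \<Longrightarrow> c * z ^ (card S - 2) = 1"
proof -
  assume "proj v \<notin> S"
  then have "eval2 (points_form S) v \<noteq> 0" using points_form_eq_0_iff[OF assms(2,4)] by simp
  have "(c * z ^ card S) * eval2 (points_form S) v = c * eval2 (points_form S) (z *s v)"
    by (simp add: eval2_scale[OF is_form_points_form] del: vector_smult_component)
  also have "\<dots> = eval2 (points_form S) v"
    using assms by (metis cov_factor_def)
  finally have "(c * z ^ card S) * eval2 (points_form S) v = 1 * eval2 (points_form S) v" by simp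
  with \<open>eval2 (points_form S) v \<noteq> 0\<close> show "c * z ^ card S = 1"
    using mult_right_cancel by blast
next
  assume x: "proj v \<in> S" and S: "card S \<ge> 2"
  obtain k where k: "k \<noteq> 0" "points_cov S v = k *s v"
    using points_cov_at[OF assms(2,4) x] .
  have "A *v points_cov S v = c *s points_cov S (z *s v)"
    using assms by (metis cov_factor_def)
  then have "(k * z) *s v = (c * z ^ (card S - 1) * k) *s v"
    by (simp add: points_cov_scale[OF assms(2)] k vector_scalar_commute assms(3) vector_smult_assoc mult_ac)
  then have "z = c * z ^ (card S - 1)" using k assms(4) by (simp add: mult.commute)
  moreover have "z ^ (card S - 1) = z * z ^ (card S - 2)"
    using S by (metis Suc_1 Suc_diff_le diff_Suc_Suc power_Suc)
  ultimately show "c * z ^ (card S - 2) = 1" using assms(5) by (simp add: mult_ac)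
qed

lemma nu_eq:
  fixes A :: "'a::field^2^2"
  shows "nu A = {A, - A}"
proof -
  have "- (mat 1) ** A = - A" by (simp add: vec_eq_iff matrix_matrix_mult_def mat_def forall_2 sum_2)
  then show ?thesis by (auto simp: nu_def r_coset_def SL2_def)
qed

lemma psl_act_nu:
  fixes A :: "'a::field^2^2"
  assumes "det A = 1"
  shows "psl_act (nu A) x = pact A x"
proof -
  have ne: "A *v rep x \<noteq> 0" using mult_eq_0_vec[of A "rep x"] assms rep(1) by auto
  have R: "Rep_P1_point x = range (\<lambda>c. c *s rep x)"
    using Rep_P1_proj[OF rep(1)[of x]] by (simp add: rep)
  have neg: "- A *v v = - (A *v v)" for v :: "'a^2"
    by (simp add: vec_eq_iff matrix_vector_mult_def sum_negf)
  have "(\<lambda>v. A *v v) ` Rep_P1_point x = range (\<lambda>c. c *s (A *v rep x))"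
    unfolding R by (simp add: image_image vector_scalar_commute)
  moreover have "(\<lambda>v. - A *v v) ` Rep_P1_point x = range (\<lambda>c. c *s (A *v rep x))"
  proof -
    have "- A *v (c *s rep x) = (- c) *s (A *v rep x)" for c
      by (simp add: neg vector_scalar_commute vec2_eq_iff)
    then have "(\<lambda>v. - A *v v) ` Rep_P1_point x = (\<lambda>c. c *s (A *v rep x)) ` range uminus"
      unfolding R image_image by simp
    then show ?thesis by simp
  qed
  ultimately have "(\<Union>A\<in>nu A. (\<lambda>v. A *v v) ` Rep_P1_point x) = range (\<lambda>c. c *s (A *v rep x))"
    by (simp add: nu_eq)
  then show ?thesis by (simp add: psl_act_def pact_def proj_def)
qed


section \<open>Homogeneous self-compressions from point sets\<close>

lemma poly_map_points_cov:
  "poly_map (h * points_cov_poly S 1) (h * points_cov_poly S 2) v = eval2 h v *s points_cov S v"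
  by (simp add: poly_map_def vec2_eq_iff eval2_points_cov_poly)

text \<open>Surjectivity on the projective line provides a vector mapped into the line of
  \<open>c\<close>, with \<open>h\<close> nonzero there; homogeneity and a root of degree
  \<open>m + (card S - 1)\<close> then correct the length.\<close>

lemma points_cov_image:
  fixes S :: "'a::{alg_closed_field, field_char_0} P1_point set"
  assumes S: "finite S" "card S \<ge> 2" and h: "is_form m h"
    and c: "c \<noteq> 0" "proj c \<notin> points_map S ` {x. \<exists>v. v \<noteq> 0 \<and> x = proj v \<and> eval2 h v = 0}"
  shows "c \<in> range (\<lambda>v. eval2 h v *s points_cov S v)"
proof -
  have ne: "S \<noteq> {}" using S by auto
  obtain x where x: "points_map S x = proj c" using surj_points_map[OF S] by (metis surjD)
  define v where "v = rep x"
  have v: "v \<noteq> 0" "x = proj v" by (simp_all add: v_def rep)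
  have hv: "eval2 h v \<noteq> 0" using c(2) v x by (metis (mono_tags, lifting) image_eqI mem_Collect_eq)
  have "proj (points_cov S v) = proj c" using x v points_map_proj[OF S(1) ne v(1)] by simp
  then obtain k where k: "k \<noteq> 0" "c = k *s points_cov S v"
    using proj_eq_scale[OF points_cov_nonzero[OF S(1) ne v(1)] c(1)] by metis
  have "m + (card S - 1) > 0" using S by simp
  then obtain t where t: "t ^ (m + (card S - 1)) = k / eval2 h v"
    using nth_root_exists by metis
  have "eval2 h (t *s v) *s points_cov S (t *s v) = (t ^ (m + (card S - 1)) * eval2 h v) *s points_cov S v"
    by (simp add: eval2_scale[OF h] points_cov_scale[OF S(1)] vector_smult_assoc power_add mult_ac)
  also have "\<dots> = c" using t hv k by simp
  finally show ?thesis by (rule range_eqI[OF sym])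
qed

text \<open>Nonzero vectors are missed on finitely many lines only. A single nonzero form vanishes
  on these lines, and the nonvanishing sets of two nonzero polynomials always meet.\<close>

lemma dominant_points_cov:
  fixes S :: "'a::{alg_closed_field, field_char_0} P1_point set"
  assumes S: "finite S" "card S \<ge> 2" and h: "is_form m h" "h \<noteq> 0"
  shows "dominant A2 (total_rmap (\<lambda>v. eval2 h v *s points_cov S v))"
proof -
  define Z where "Z = {x. \<exists>v. v \<noteq> 0 \<and> x = proj v \<and> eval2 h v = 0}"
  obtain w where "eval2 h w \<noteq> 0" using eval2_nonzero[OF h(2)] .
  then have "finite Z" unfolding Z_def using finite_form_zeros[OF h(1)] by blast
  \<comment> \<open>The arbitrary extra point keeps \<open>T\<close> nonempty, so that
    \<open>q\<close> vanishes at the origin and \<open>c = 0\<close> is excluded below.\<close>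
  define T where "T = insert undefined (points_map S ` Z)"
  have T: "finite T" "T \<noteq> {}" using \<open>finite Z\<close> by (auto simp: T_def)
  define q where "q = points_form T"
  obtain y where "y \<notin> T" using T infinite_P1 ex_new_if_finite by metis
  then have "eval2 q (rep y) \<noteq> 0" using points_form_eq_0_iff[OF T(1) rep(1)] by (simp add: q_def rep)
  then have "q \<noteq> 0" by auto
  have "zariski_A2 closure_of (range (\<lambda>v. eval2 h v *s points_cov S v)) = topspace zariski_A2"
    unfolding dense_intersects_open
  proof (intro allI impI)
    fix U :: "('a^2) set" assume U: "openin zariski_A2 U \<and> U \<noteq> {}"
    then obtain u where "u \<in> U" by blast
    with U obtain p where p: "eval2 p u \<noteq> 0" "{w. eval2 p w \<noteq> 0} \<subseteq> U"
      using zariski_A2_basis by blast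
    then have "p * q \<noteq> 0" using \<open>q \<noteq> 0\<close> by auto
    then obtain c where c: "eval2 (p * q) c \<noteq> 0" using eval2_nonzero by blast
    then have "c \<in> U" "eval2 q c \<noteq> 0" using p by auto
    have "c \<noteq> 0"
    proof
      assume "c = 0"
      then have "eval2 q c = 0" using T by (auto simp: q_def eval2_points_form)
      with \<open>eval2 q c \<noteq> 0\<close> show False by simp
    qed
    moreover from this have "proj c \<notin> T" using points_form_eq_0_iff[OF T(1)] \<open>eval2 q c \<noteq> 0\<close> by (simp add: q_def)
    ultimately have "c \<in> range (\<lambda>v. eval2 h v *s points_cov S v)"
      by (intro points_cov_image[OF S h(1)]) (simp_all add: T_def Z_def)
    with \<open>c \<in> U\<close> show "range (\<lambda>v. eval2 h v *s points_cov S v) \<inter> U \<noteq> {}" by blast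
  qed
  then show ?thesis by (simp add: dominant_def A2_def)
qed

lemma is_rmap_A2_poly_map: "is_rmap A2 (total_rmap (poly_map p q))"
proof -
  have "\<forall>v. \<exists>W p' q' r. openin zariski_A2 W \<and> v \<in> W \<and> W \<subseteq> UNIV \<and>
      (\<forall>w\<in>W. eval2 r w \<noteq> 0 \<and> poly_map p q w = vector [eval2 p' w / eval2 r w, eval2 q' w / eval2 r w])"
  proof
    fix v
    show "\<exists>W p' q' r. openin zariski_A2 W \<and> v \<in> W \<and> W \<subseteq> UNIV \<and>
      (\<forall>w\<in>W. eval2 r w \<noteq> 0 \<and> poly_map p q w = vector [eval2 p' w / eval2 r w, eval2 q' w / eval2 r w])"
      by (rule exI[of _ UNIV], rule exI[of _ p], rule exI[of _ q], rule exI[of _ 1]) (simp add: poly_map_def)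
  qed
  then show ?thesis by (simp add: is_rmap_def A2_def)
qed

lemma rmap_eq_comp_total:
  assumes "openin (zariski X) UNIV" "\<And>x. f (g x) = g' (f' x)"
  shows "rmap_eq X (rmap_comp (total_rmap f) (total_rmap g)) (rmap_comp (total_rmap g') (total_rmap f'))"
  unfolding rmap_eq_def rmap_comp_def using assms by (auto intro!: exI[of _ UNIV])

text \<open>Equivariance on the plane must hold exactly, so the character is to be cancelled by
  \<open>h\<close>; on the line a scalar factor is harmless. The factor \<open>h\<close> disappears
  in the descent, which is the map of \<open>S\<close> alone.\<close>

theorem points_cov_self_compression:
  fixes S :: "'a::{alg_closed_field, field_char_0} P1_point set" and \<Gamma> :: "('a^2^2) set"
  assumes S: "finite S" "card S \<ge> 3" and h: "is_form m h" "h \<noteq> 0"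
    and det: "\<And>A. A \<in> \<Gamma> \<Longrightarrow> det A = 1"
    and cov: "\<And>A. A \<in> \<Gamma> \<Longrightarrow> \<exists>c. cov_factor A S c"
    and equiv: "\<And>A v. A \<in> \<Gamma> \<Longrightarrow> A *v (eval2 h v *s points_cov S v) = eval2 h (A *v v) *s points_cov S (A *v v)"
    and G: "G \<subseteq> nu ` \<Gamma>"
  shows "\<exists>f1 f2 :: 'a poly poly.
     is_form (m + (card S - 1)) f1 \<and> is_form (m + (card S - 1)) f2 \<and>
     self_compression A2 ((\<lambda>A. total_rmap (\<lambda>v. A *v v)) ` \<Gamma>) (total_rmap (poly_map f1 f2)) \<and>
     (\<exists>\<phi>. is_descent (poly_map f1 f2) \<phi> \<and>
       nontrivial_self_compression P1 ((\<lambda>g. total_rmap (psl_act g)) ` G) (total_rmap \<phi>))"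
proof -
  define f where "f i = h * points_cov_poly S i" for i
  have ne: "S \<noteq> {}" and S2: "card S \<ge> 2" using S by auto
  have form: "is_form (m + (card S - 1)) (f i)" for i
    unfolding f_def by (intro is_form_mult h is_form_points_cov_poly S)
  have map: "poly_map (f 1) (f 2) = (\<lambda>v. eval2 h v *s points_cov S v)"
    by (simp add: f_def poly_map_points_cov fun_eq_iff)
  have "self_compression A2 ((\<lambda>A. total_rmap (\<lambda>v. A *v v)) ` \<Gamma>) (total_rmap (poly_map (f 1) (f 2)))"
    unfolding self_compression_def
  proof (intro conjI ballI)
    show "is_rmap A2 (total_rmap (poly_map (f 1) (f 2)))" by (rule is_rmap_A2_poly_map)
    show "dominant A2 (total_rmap (poly_map (f 1) (f 2)))"
      unfolding map using dominant_points_cov[OF S(1) S2 h] .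
    fix H assume "H \<in> (\<lambda>A. total_rmap (\<lambda>v. A *v v)) ` \<Gamma>"
    then obtain A where "A \<in> \<Gamma>" "H = total_rmap (\<lambda>v. A *v v)" by blast
    then show "rmap_eq A2 (rmap_comp (total_rmap (poly_map (f 1) (f 2))) H) (rmap_comp H (total_rmap (poly_map (f 1) (f 2))))"
      using equiv by (auto simp: map A2_def intro!: rmap_eq_comp_total)
  qed
  moreover have regular: "regular_on P1 UNIV (points_map S)"
  proof -
    have *: "poly_map (points_cov_poly S 1) (points_cov_poly S 2) v = points_cov S v" for v
      by (simp add: poly_map_def vec2_eq_iff eval2_points_cov_poly)
    have "is_form (card S - 1) (points_cov_poly S i)" for i by (intro is_form_points_cov_poly S)
    then have "\<exists>W d p q. openin zariski_P1 W \<and> x \<in> W \<and> W \<subseteq> UNIV \<and> is_form d p \<and> is_form d q \<and>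
        (\<forall>v. v \<noteq> 0 \<and> proj v \<in> W \<longrightarrow> poly_map p q v \<noteq> 0 \<and> points_map S (proj v) = proj (poly_map p q v))" for x
      using points_cov_nonzero[OF S(1) ne] points_map_proj[OF S(1) ne]
      by (intro exI[of _ UNIV] exI[of _ "card S - 1"] exI[of _ "points_cov_poly S 1"] exI[of _ "points_cov_poly S 2"])
        (simp add: *)
    then show ?thesis by (simp add: P1_def)
  qed
  then have "is_descent (poly_map (f 1) (f 2)) (points_map S)"
    unfolding is_descent_def map
  proof (intro conjI allI impI)
    fix v :: "'a^2" assume v: "v \<noteq> 0 \<and> eval2 h v *s points_cov S v \<noteq> 0"
    then have "eval2 h v \<noteq> 0" by auto
    then show "points_map S (proj v) = proj (eval2 h v *s points_cov S v)"
      using v points_cov_nonzero[OF S(1) ne] by (simp add: points_map_proj[OF S(1) ne])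
  qed
  moreover have "self_compression P1 ((\<lambda>g. total_rmap (psl_act g)) ` G) (total_rmap (points_map S))"
    unfolding self_compression_def
  proof (intro conjI ballI)
    show "is_rmap P1 (total_rmap (points_map S))"
      using regular by (simp add: is_rmap_def P1_def)
    show "dominant P1 (total_rmap (points_map S))"
      using surj_points_map[OF S(1) S2] by (simp add: dominant_def P1_def)
    fix H assume "H \<in> (\<lambda>g. total_rmap (psl_act g)) ` G"
    then obtain A where A: "A \<in> \<Gamma>" and H: "H = total_rmap (psl_act (nu A))" using G by blast
    have "points_map S (pact A x) = pact A (points_map S x)" for x
    proof -
      obtain c where c: "cov_factor A S c" using cov[OF A] by blast
      have nz: "A *v v \<noteq> 0" if "v \<noteq> 0" for v using mult_eq_0_vec[of A v] det[OF A] that by auto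
      have r: "points_cov S (rep x) \<noteq> 0" "points_cov S (A *v rep x) \<noteq> 0" "A *v rep x \<noteq> 0"
        using points_cov_nonzero[OF S(1) ne] nz rep(1) by auto
      have eq: "A *v points_cov S (rep x) = c *s points_cov S (A *v rep x)"
        using c by (simp add: cov_factor_def)
      then have "c \<noteq> 0" using nz[OF r(1)] by auto
      have "points_map S (pact A x) = proj (points_cov S (A *v rep x))"
        using r(3) by (simp add: pact_def points_map_proj[OF S(1) ne])
      also have "\<dots> = proj (A *v points_cov S (rep x))" using eq r \<open>c \<noteq> 0\<close> by simp
      also have "\<dots> = pact A (points_map S x)"
        using r det[OF A] by (simp add: points_map_def pact_proj)
      finally show ?thesis .
    qed
    then show "rmap_eq P1 (rmap_comp (total_rmap (points_map S)) H) (rmap_comp H (total_rmap (points_map S)))"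
      unfolding H using det[OF A] by (intro rmap_eq_comp_total) (simp_all add: P1_def psl_act_nu)
  qed
  moreover have "\<not> birational_iso P1 (total_rmap (points_map S))"
  proof
    assume "birational_iso P1 (total_rmap (points_map S))"
    then obtain F' where "rmap_eq P1 (rmap_comp F' (total_rmap (points_map S))) (total_rmap id)"
      by (auto simp: birational_iso_def)
    then obtain W where W: "openin zariski_P1 W" "W \<noteq> {}" "\<And>x. x \<in> W \<Longrightarrow> snd F' (points_map S x) = x"
      by (auto simp: rmap_eq_def rmap_comp_def P1_def)
    have "inj_on (points_map S) W" using W(3) by (metis inj_on_def)
    then show False
      using points_map_not_inj_cofinite[OF S finite_compl_zariski_P1[OF W(1,2)]] by simp
  qed
  ultimately show ?thesis
    using form unfolding nontrivial_self_compression_def by blast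
qed

section \<open>Finite subgroups of \<open>SL\<^sub>2\<close>\<close>

lemma matrix2_eq_iff: "A = B \<longleftrightarrow> A $ 1 $ 1 = B $ 1 $ 1 \<and> A $ 1 $ 2 = B $ 1 $ 2 \<and> A $ 2 $ 1 = B $ 2 $ 1 \<and> A $ 2 $ 2 = B $ 2 $ 2"
  for A B :: "'a^2^2"
  by (auto simp: vec2_eq_iff)

lemma mat2_entries [simp]: "mat c $ (1::2) $ (1::2) = c" "mat c $ (1::2) $ (2::2) = 0"
    "mat c $ (2::2) $ (1::2) = 0" "mat c $ (2::2) $ (2::2) = c"
  by (simp_all add: mat_def)

lemma matrix2_mult_entry: "(A ** B) $ i $ j = A $ i $ 1 * B $ 1 $ j + A $ i $ 2 * B $ 2 $ j"
  for A B :: "'a::semiring_1^2^2"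
  by (simp add: matrix_matrix_mult_def sum_2)

lemma matrix2_vector_entry: "(A *v v) $ i = A $ i $ 1 * v $ 1 + A $ i $ 2 * v $ 2"
  for A :: "'a::semiring_1^2^2"
  by (simp add: matrix_vector_mult_def sum_2)

lemma minus_matrix_vector: "(- A) *v v = - (A *v v)" for A :: "'a::field^2^2"
  by (simp add: vec2_eq_iff matrix2_vector_entry)

lemma minus_mat_mult: "(- A) ** B = - (A ** B)" "A ** (- B) = - (A ** B)" for A B :: "'a::field^2^2"
  by (simp_all add: matrix2_eq_iff matrix2_mult_entry)

lemma minus_mat_1_neq: "(- mat 1 :: 'a::field_char_0^2^2) \<noteq> mat 1"
  by (simp add: matrix2_eq_iff)

lemma det_uminus_2: "det (- A) = det A" for A :: "'a::field^2^2"
  by (simp add: det_2)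

lemma eigenvector_exists:
  fixes A :: "'a::field^2^2"
  assumes "z * z - (A $ 1 $ 1 + A $ 2 $ 2) * z + det A = 0"
  obtains v where "v \<noteq> 0" "A *v v = z *s v"
proof -
  have eq: "(A $ 1 $ 1 - z) * (A $ 2 $ 2 - z) = A $ 1 $ 2 * A $ 2 $ 1"
    using assms by (simp add: det_2 algebra_simps)
  \<comment> \<open>By the characteristic equation every nonzero column of the adjugate of A - z is
    an eigenvector; up to sign the columns are the witnesses of the first two cases. If both vanish,
    \<open>A\<close> is scalar.\<close>
  consider "A $ 1 $ 2 \<noteq> 0 \<or> z \<noteq> A $ 1 $ 1" | "A $ 1 $ 2 = 0" "z = A $ 1 $ 1" "A $ 2 $ 1 \<noteq> 0 \<or> z \<noteq> A $ 2 $ 2"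
    | "A $ 1 $ 2 = 0" "z = A $ 1 $ 1" "A $ 2 $ 1 = 0" "z = A $ 2 $ 2" by blast
  then show thesis
  proof cases
    case 1
    then show ?thesis using eq
      by (intro that[of "vector [A $ 1 $ 2, z - A $ 1 $ 1]"])
        (auto simp: vec2_eq_iff matrix2_vector_entry algebra_simps)
  next
    case 2
    then show ?thesis
      by (intro that[of "vector [z - A $ 2 $ 2, A $ 2 $ 1]"])
        (auto simp: vec2_eq_iff matrix2_vector_entry algebra_simps)
  next
    case 3
    then show ?thesis
      by (intro that[of "vector [1, 0]"]) (auto simp: vec2_eq_iff matrix2_vector_entry)
  qed
qed

text \<open>Closure under negation makes the group the full preimage of its image in PSL2.\<close>

locale finite_SL2 =
  fixes \<Gamma> :: "('a::{alg_closed_field, field_char_0}^2^2) set"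
  assumes finite [simp]: "finite \<Gamma>"
    and det: "A \<in> \<Gamma> \<Longrightarrow> det A = 1"
    and one_mem [simp]: "mat 1 \<in> \<Gamma>"
    and uminus_mem: "A \<in> \<Gamma> \<Longrightarrow> - A \<in> \<Gamma>"
    and mult_mem: "A \<in> \<Gamma> \<Longrightarrow> B \<in> \<Gamma> \<Longrightarrow> A ** B \<in> \<Gamma>"
    and inv_mem: "A \<in> \<Gamma> \<Longrightarrow> \<exists>B\<in>\<Gamma>. B ** A = mat 1"
begin

lemma mult_nonzero: "A \<in> \<Gamma> \<Longrightarrow> v \<noteq> 0 \<Longrightarrow> A *v v \<noteq> 0"
  using mult_eq_0_vec[of A v] det by auto

lemma pact_mult_mem: "A \<in> \<Gamma> \<Longrightarrow> B \<in> \<Gamma> \<Longrightarrow> pact (A ** B) x = pact A (pact B x)"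
  using pact_mult det by blast

lemma pact_uminus: "A \<in> \<Gamma> \<Longrightarrow> pact (- A) x = pact A x"
  using mult_nonzero[of A "rep x"] rep(1)[of x]
  by (simp add: pact_def minus_matrix_vector) (simp add: proj_eq_iff cross2_def)

lemma inv_memE:
  assumes "A \<in> \<Gamma>"
  obtains B where "B \<in> \<Gamma>" "B ** A = mat 1" "A ** B = mat 1"
  using inv_mem[OF assms] matrix_left_right_inverse by metis

text \<open>In characteristic zero a unipotent matrix other than the identity has infinite order.\<close>

lemma unipotent_trivial:
  assumes A: "A \<in> \<Gamma>" and v: "v \<noteq> 0" "A *v v = v"
  shows "A = mat 1"
proof -
  define a b c d where abcd: "a = A $ 1 $ 1" "b = A $ 1 $ 2" "c = A $ 2 $ 1" "d = A $ 2 $ 2"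
  have det1: "a * d - b * c = 1" using det[OF A] by (simp add: det_2 abcd)
  have 1: "(a - 1) * v $ 1 + b * v $ 2 = 0" and 2: "c * v $ 1 + (d - 1) * v $ 2 = 0"
    using v(2) by (simp_all add: vec2_eq_iff matrix2_vector_entry abcd algebra_simps)
  \<comment> \<open>Cramer's rule: the fixed vector forces det(A - 1) = 0, which together with det A
    = 1 gives trace 2.\<close>
  have "((a - 1) * (d - 1) - b * c) * v $ 1 = (d - 1) * ((a - 1) * v $ 1 + b * v $ 2) - b * (c * v $ 1 + (d - 1) * v $ 2)"
    by (simp add: algebra_simps)
  moreover have "((a - 1) * (d - 1) - b * c) * v $ 2 = (a - 1) * (c * v $ 1 + (d - 1) * v $ 2) - c * ((a - 1) * v $ 1 + b * v $ 2)"
    by (simp add: algebra_simps)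
  ultimately have "(a - 1) * (d - 1) - b * c = 0"
    using v(1) unfolding 1 2 by (auto simp: vec2_eq_iff)
  then have tr: "a + d = 2" using det1 by (simp add: algebra_simps)
  then have d: "d = 2 - a" by (simp add: algebra_simps)
  have bc: "b * c = - ((a - 1) * (a - 1))" using det1 d by (simp add: algebra_simps)
  \<comment> \<open>By Cayley-Hamilton (A - 1)^2 = 0, so \<open>U n\<close> is the n-th power of
    \<open>A\<close>; the powers are distinct unless A = 1.\<close>
  define U where "U n = (\<chi> i j. mat 1 $ i $ j + of_nat n * (A $ i $ j - mat 1 $ i $ j))" for n :: nat
  have U_entries: "U n $ 1 $ 1 = 1 + of_nat n * (a - 1)" "U n $ 1 $ 2 = of_nat n * b"
    "U n $ 2 $ 1 = of_nat n * c" "U n $ 2 $ 2 = 1 + of_nat n * (d - 1)" for n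
    by (simp_all add: U_def abcd)
  have "A ** U n = U (Suc n)" for n
  proof -
    have "a * (of_nat n * b) + b * (1 + of_nat n * (d - 1)) = (1 + of_nat n) * b"
      "c * (1 + of_nat n * (a - 1)) + d * (of_nat n * c) = (1 + of_nat n) * c"
      by (simp_all add: d algebra_simps)
    moreover have "a * (1 + of_nat n * (a - 1)) + b * (of_nat n * c) = a + of_nat n * (a * (a - 1) + b * c)"
      "c * (of_nat n * b) + d * (1 + of_nat n * (d - 1)) = d + of_nat n * (d * (d - 1) + b * c)"
      by (simp_all add: algebra_simps)
    moreover have "a * (a - 1) + b * c = a - 1" "d * (d - 1) + b * c = d - 1"
      unfolding bc d by (simp_all add: algebra_simps)
    ultimately show ?thesis
      by (simp add: matrix2_eq_iff matrix2_mult_entry U_entries flip: abcd) (simp add: algebra_simps)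
  qed
  then have "U n \<in> \<Gamma>" for n
  proof (induction n)
    case 0
    have "U 0 = mat 1" by (simp add: U_def vec_eq_iff)
    then show ?case by simp
  next
    case (Suc n)
    then show ?case using mult_mem[OF A] by metis
  qed
  then have "finite (range U)" using finite_subset[OF _ local.finite] by blast
  then have "\<not> inj U" using finite_imageD by blast
  then obtain m n where mn: "m \<noteq> n" "U m = U n" by (auto simp: inj_def)
  then have "of_nat m * (a - 1) = of_nat n * (a - 1)" "of_nat m * b = of_nat n * b"
    "of_nat m * c = of_nat n * c" "of_nat m * (d - 1) = of_nat n * (d - 1)"
    using U_entries[of m] U_entries[of n] by auto
  then have "a = 1" "b = 0" "c = 0" "d = 1" using mn(1) by auto
  then show ?thesis by (simp add: matrix2_eq_iff flip: abcd)
qed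

text \<open>The eigenvalues are \<open>z\<close> and its inverse. If they coincided,
  \<open>z\<close> would be 1 or -1 and \<open>A\<close> or \<open>- A\<close> unipotent, hence
  trivial; so the fixed points are exactly two eigenlines.\<close>

lemma fixed_points:
  assumes A: "A \<in> \<Gamma>" "A \<noteq> mat 1" "A \<noteq> - mat 1"
  shows "card {x. pact A x = x} = 2"
proof -
  let ?t = "A $ 1 $ 1 + A $ 2 $ 2"
  have "degree [:1, - ?t, 1:] > 0" by simp
  then obtain z where "poly [:1, - ?t, 1:] z = 0" using alg_closed_imp_poly_has_root by blast
  then have z: "z * z - ?t * z + 1 = 0" by (simp add: algebra_simps)
  then have "z \<noteq> 0" by auto
  have z': "inverse z * inverse z - ?t * inverse z + 1 = 0"
  proof -
    have "inverse z * inverse z - ?t * inverse z + 1 = inverse z * inverse z * (z * z - ?t * z + 1)"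
      using \<open>z \<noteq> 0\<close> by (simp add: field_simps)
    then show ?thesis by (simp add: z)
  qed
  obtain v where v: "v \<noteq> 0" "A *v v = z *s v"
    using eigenvector_exists[of z A] z det[OF A(1)] by metis
  obtain w where w: "w \<noteq> 0" "A *v w = inverse z *s w"
    using eigenvector_exists[of "inverse z" A] z' det[OF A(1)] by metis
  have zz: "z \<noteq> inverse z"
  proof
    assume "z = inverse z"
    then have "z * z = 1" using \<open>z \<noteq> 0\<close> by (metis right_inverse)
    then consider "z = 1" | "z = - 1" by (metis square_eq_1_iff)
    then show False
    proof cases
      case 1
      then show ?thesis using unipotent_trivial[OF A(1) v(1)] v(2) A(2) by simp
    next
      case 2
      then have "(- A) *v v = v" using v(2) by (simp add: minus_matrix_vector vec2_eq_iff)
      then have "- A = mat 1" using unipotent_trivial[OF uminus_mem[OF A(1)] v(1)] by simp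
      then have "A = - mat 1" by (metis add.inverse_inverse)
      with A(3) show ?thesis by simp
    qed
  qed
  have vw: "cross2 v w \<noteq> 0"
  proof
    assume "cross2 v w = 0"
    then obtain c where c: "c \<noteq> 0" "w = c *s v" using cross2_eq_0_iff'[OF v(1) w(1)] by auto
    then have "(c * z) *s v = (inverse z * c) *s v"
      using v w by (simp add: vector_scalar_commute vector_smult_assoc)
    then show False using c v(1) zz by (auto simp: mult.commute)
  qed
  have "{x. pact A x = x} = {proj v, proj w}"
  proof (intro equalityI subsetI)
    fix x assume "x \<in> {proj v, proj w}"
    then show "x \<in> {x. pact A x = x}" using v w \<open>z \<noteq> 0\<close>
      by (auto simp: pact_proj det[OF A(1)])
  next
    fix x assume "x \<in> {x. pact A x = x}"
    then have "proj (A *v rep x) = proj (rep x)" by (simp add: pact_def rep)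
    then obtain g where g: "A *v rep x = g *s rep x"
      using proj_eq_scale[of "rep x" "A *v rep x"] rep(1)[of x] mult_nonzero[OF A(1)] by metis
    \<comment> \<open>A third eigenline would have an eigenvalue \<open>g\<close> with
      \<open>g * z = 1\<close> and \<open>g * inverse z = 1\<close>, since \<open>A\<close>
      preserves determinants.\<close>
    have "cross2 (A *v rep x) (A *v v) = cross2 (rep x) v" "cross2 (A *v rep x) (A *v w) = cross2 (rep x) w"
      by (simp_all add: cross2_matrix det[OF A(1)])
    then have "(g * z - 1) * cross2 (rep x) v = 0" "(g * inverse z - 1) * cross2 (rep x) w = 0"
      unfolding g v w by (simp_all add: algebra_simps)
    moreover have "\<not> (g * z = 1 \<and> g * inverse z = 1)"
    proof
      assume *: "g * z = 1 \<and> g * inverse z = 1"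
      then have "g \<noteq> 0" by auto
      with * have "z = inverse z" by (metis mult_left_cancel)
      with zz show False by simp
    qed
    ultimately have "cross2 (rep x) v = 0 \<or> cross2 (rep x) w = 0" by auto
    then show "x \<in> {proj v, proj w}"
      using cross2_rep_eq_0_iff' v(1) w(1) by blast
  qed
  moreover have "proj v \<noteq> proj w" using vw proj_eq_iff v w by blast
  ultimately show ?thesis by simp
qed

section \<open>Stabilizers, their eigenvalue characters, and orbits\<close>

definition stab :: "'a P1_point \<Rightarrow> ('a^2^2) set" where
  "stab x = {A \<in> \<Gamma>. pact A x = x}"

definition orb :: "'a P1_point \<Rightarrow> 'a P1_point set" where
  "orb x = (\<lambda>A. pact A x) ` \<Gamma>"

text \<open>On \<open>stab x\<close> this is the character through which the stabilizer acts on the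
  line \<open>x\<close>.\<close>

definition eigenvalue :: "'a^2^2 \<Rightarrow> 'a P1_point \<Rightarrow> 'a" where
  "eigenvalue A x = (SOME c. A *v rep x = c *s rep x)"

lemma finite_stab [simp]: "finite (stab x)"
  by (simp add: stab_def)

lemma stab_mem: "A \<in> stab x \<Longrightarrow> A \<in> \<Gamma>"
  by (simp add: stab_def)

lemma finite_orb [simp]: "finite (orb x)"
  by (simp add: orb_def)

lemma self_mem_orb [simp]: "x \<in> orb x"
  using pact_mat_1[of x] one_mem unfolding orb_def by (metis image_eqI)

lemma eigenvalue:
  assumes "A \<in> stab x"
  shows "A *v rep x = eigenvalue A x *s rep x" "eigenvalue A x \<noteq> 0"
proof -
  have "proj (A *v rep x) = proj (rep x)" using assms by (simp add: stab_def pact_def rep)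
  then have "\<exists>c. A *v rep x = c *s rep x"
    using proj_eq_scale[of "rep x" "A *v rep x"] rep(1)[of x] mult_nonzero stab_mem[OF assms] by metis
  then show *: "A *v rep x = eigenvalue A x *s rep x"
    unfolding eigenvalue_def by (rule someI_ex)
  show "eigenvalue A x \<noteq> 0"
    using * mult_nonzero[OF stab_mem[OF assms] rep(1)[of x]] by auto
qed

lemma eigenvalueI: "A *v rep x = c *s rep x \<Longrightarrow> eigenvalue A x = c"
  unfolding eigenvalue_def using rep(1)[of x] by (intro some_equality) auto

lemma stab_mult: "A \<in> stab x \<Longrightarrow> B \<in> stab x \<Longrightarrow> A ** B \<in> stab x"
  by (simp add: stab_def mult_mem pact_mult_mem)

lemma one_mem_stab [simp]: "mat 1 \<in> stab x"
  by (simp add: stab_def)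

lemma uminus_mem_stab: "A \<in> stab x \<Longrightarrow> - A \<in> stab x"
  by (simp add: stab_def uminus_mem pact_uminus)

lemma stab_inv:
  assumes "A \<in> stab x"
  obtains B where "B \<in> stab x" "B ** A = mat 1" "A ** B = mat 1"
proof -
  obtain B where B: "B \<in> \<Gamma>" "B ** A = mat 1" "A ** B = mat 1"
    using inv_memE[OF stab_mem[OF assms]] .
  have "pact (B ** A) x = pact B x"
    using assms B(1) by (simp add: stab_def pact_mult_mem)
  then have "B \<in> stab x" using B by (simp add: stab_def)
  with B that show thesis by blast
qed

lemma eigenvalue_mult:
  assumes "A \<in> stab x" "B \<in> stab x"
  shows "eigenvalue (A ** B) x = eigenvalue A x * eigenvalue B x"
  by (rule eigenvalueI)
    (simp add: matrix_vector_mul_assoc[symmetric] eigenvalue(1)[OF assms(1)] eigenvalue(1)[OF assms(2)]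
      vector_scalar_commute vector_smult_assoc mult.commute)

lemma eigenvalue_one: "eigenvalue (mat 1) x = 1"
  by (rule eigenvalueI) simp

lemma eigenvalue_uminus_one: "eigenvalue (- mat 1) x = - 1"
  by (rule eigenvalueI) (simp add: minus_matrix_vector vec2_eq_iff)

text \<open>Eigenvalue 1 means unipotent, hence trivial. The stabilizer thus embeds into the
  multiplicative group of the field; in particular it is abelian.\<close>

lemma inj_on_eigenvalue: "inj_on (\<lambda>A. eigenvalue A x) (stab x)"
proof (rule inj_onI)
  fix A B assume A: "A \<in> stab x" and B: "B \<in> stab x" and eq: "eigenvalue A x = eigenvalue B x"
  obtain C where C: "C \<in> stab x" "C ** A = mat 1" "A ** C = mat 1" using stab_inv[OF A] .
  have "eigenvalue (C ** B) x = eigenvalue (C ** A) x"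
    using eq by (simp only: eigenvalue_mult[OF C(1) A] eigenvalue_mult[OF C(1) B])
  then have "eigenvalue (C ** B) x = 1" using C eigenvalue_one by simp
  then have "(C ** B) *v rep x = rep x"
    using eigenvalue(1)[OF stab_mult[OF C(1) B]] by simp
  then have "C ** B = mat 1"
    using unipotent_trivial stab_mem[OF stab_mult[OF C(1) B]] rep(1) by blast
  then have "A ** (C ** B) = A" by simp
  then show "A = B" using C(3) by (simp add: matrix_mul_assoc)
qed

lemma stab_commute: "A \<in> stab x \<Longrightarrow> B \<in> stab x \<Longrightarrow> A ** B = B ** A"
  by (rule inj_onD[OF inj_on_eigenvalue[of x]]) (simp_all add: eigenvalue_mult stab_mult)

lemma inj_matrix_mult:
  assumes "A \<in> \<Gamma>"
  shows "inj ((**) A :: 'a^2^2 \<Rightarrow> 'a^2^2)"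
proof (rule injI)
  fix B C :: "'a^2^2"
  assume "A ** B = A ** C"
  moreover obtain D where "D ** A = mat 1" using inv_mem[OF assms] by blast
  ultimately show "B = C" by (metis matrix_mul_assoc matrix_mul_lid)
qed

text \<open>Multiplication by \<open>A\<close> permutes the stabilizer, so the product of all
  eigenvalues is unchanged when each is multiplied by that of \<open>A\<close>.\<close>

lemma eigenvalue_power_card:
  assumes A: "A \<in> stab x"
  shows "eigenvalue A x ^ card (stab x) = 1"
proof -
  have "(**) A ` stab x = stab x"
    using stab_mult[OF A] inj_on_subset[OF inj_matrix_mult[OF stab_mem[OF A]] subset_UNIV]
    by (intro endo_inj_surj[OF finite_stab]) auto
  then have "(\<Prod>B\<in>stab x. eigenvalue B x) = (\<Prod>B\<in>(**) A ` stab x. eigenvalue B x)" by simp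
  also have "\<dots> = (\<Prod>B\<in>stab x. eigenvalue (A ** B) x)"
    using inj_on_subset[OF inj_matrix_mult[OF stab_mem[OF A]]] by (subst prod.reindex) auto
  also have "\<dots> = eigenvalue A x ^ card (stab x) * (\<Prod>B\<in>stab x. eigenvalue B x)"
    using A by (simp add: eigenvalue_mult prod.distrib)
  finally show ?thesis using eigenvalue(2) by simp
qed

text \<open>The stabilizer contains \<open>- mat 1\<close>, whose eigenvalue is -1.\<close>

lemma even_card_stab: "even (card (stab x))"
  using eigenvalue_power_card[OF uminus_mem_stab[OF one_mem_stab], of x] minus_one_power_iff[of "card (stab x)", where 'a='a]
  by (auto simp: eigenvalue_uminus_one split: if_splits)

lemma orbit_stabilizer: "card \<Gamma> = card (orb x) * card (stab x)"
proof -
  have "card {A \<in> \<Gamma>. pact A x = y} = card (stab x)" if y: "y \<in> orb x" for y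
  proof -
    obtain A where A: "A \<in> \<Gamma>" "pact A x = y" using y by (auto simp: orb_def)
    obtain C where C: "C \<in> \<Gamma>" "C ** A = mat 1" "A ** C = mat 1" using inv_memE[OF A(1)] .
    have "{B \<in> \<Gamma>. pact B x = y} = (**) A ` stab x"
    proof (intro equalityI subsetI)
      fix B assume B: "B \<in> {B \<in> \<Gamma>. pact B x = y}"
      have "pact (C ** B) x = pact (C ** A) x" using A B C(1) by (simp add: pact_mult_mem)
      then have "C ** B \<in> stab x" using B C by (simp add: stab_def mult_mem)
      moreover have "B = A ** (C ** B)" using C(3) by (simp add: matrix_mul_assoc)
      ultimately show "B \<in> (**) A ` stab x" by blast
    qed (use A in \<open>auto simp: stab_def mult_mem pact_mult_mem\<close>)
    then show ?thesis
      by (simp only: card_image[OF inj_on_subset[OF inj_matrix_mult[OF A(1)] subset_UNIV]])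
  qed
  then have "(\<Sum>y\<in>orb x. card {A \<in> \<Gamma>. pact A x = y}) = card (orb x) * card (stab x)" by simp
  moreover have "\<Gamma> = (\<Union>y\<in>orb x. {A \<in> \<Gamma>. pact A x = y})" by (auto simp: orb_def)
  moreover have "card (\<Union>y\<in>orb x. {A \<in> \<Gamma>. pact A x = y}) = (\<Sum>y\<in>orb x. card {A \<in> \<Gamma>. pact A x = y})"
    by (intro card_UN_disjoint) auto
  ultimately show ?thesis by simp
qed

lemma orb_eq:
  assumes "y \<in> orb x"
  shows "orb y = orb x"
proof -
  have sub: "orb y \<subseteq> orb x" if "y \<in> orb x" for x y
    using that by (auto simp: orb_def pact_mult_mem[symmetric] mult_mem)
  have "x \<in> orb y"
  proof -
    obtain A where A: "A \<in> \<Gamma>" "pact A x = y" using assms by (auto simp: orb_def)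
    obtain C where C: "C \<in> \<Gamma>" "C ** A = mat 1" using inv_memE[OF A(1)] .
    have "pact C y = pact (C ** A) x" using A C(1) by (simp add: pact_mult_mem)
    then have "pact C y = x" using C by simp
    then show ?thesis using C(1) by (auto simp: orb_def)
  qed
  with sub assms show ?thesis by blast
qed

lemma orb_disjoint: "orb x = orb y \<or> orb x \<inter> orb y = {}"
  using orb_eq by blast

lemma card_orb_pos: "card (orb x) > 0"
  using self_mem_orb[of x] by (metis card_gt_0_iff empty_iff finite_orb)

lemma card_stab_orb: "y \<in> orb x \<Longrightarrow> card (stab y) = card (stab x)"
  using orbit_stabilizer[of x] orbit_stabilizer[of y] orb_eq[of y x] card_orb_pos[of x]
  by (metis mult_left_cancel less_irrefl)

lemma pact_image_orb:
  assumes "A \<in> \<Gamma>"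
  shows "pact A ` orb x = orb x"
proof -
  have "pact A ` orb x = orb (pact A x)"
  proof -
    obtain C where C: "C \<in> \<Gamma>" "C ** A = mat 1" "A ** C = mat 1" using inv_memE[OF assms] .
    have "pact A (pact B x) = pact (A ** B ** C) (pact A x)" if "B \<in> \<Gamma>" for B
    proof -
      have "pact (A ** B ** C) (pact A x) = pact (A ** B ** (C ** A)) x"
        using that assms C(1) by (simp add: pact_mult_mem mult_mem)
      then show ?thesis using C that assms by (simp add: pact_mult_mem)
    qed
    moreover have "pact B (pact A x) = pact A (pact (C ** B ** A) x)" if "B \<in> \<Gamma>" for B
    proof -
      have "pact A (pact (C ** B ** A) x) = pact ((A ** C) ** (B ** A)) x"
        using that assms C(1) by (simp add: pact_mult_mem mult_mem)
      then show ?thesis using C that assms by (simp add: pact_mult_mem)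
    qed
    ultimately show ?thesis using assms C(1) unfolding orb_def
      by (fastforce simp: image_image intro: mult_mem)
  qed
  also have "\<dots> = orb x" using assms by (intro orb_eq) (auto simp: orb_def)
  finally show ?thesis .
qed

end

text \<open>Divided by \<open>N\<close>, the equation reads 1/a + 1/b + 1/c = 1 + 2/N. Here
  \<open>i\<close>, \<open>j\<close>, \<open>k\<close> are orbit sizes and \<open>a\<close>,
  \<open>b\<close>, \<open>c\<close> the stabilizer orders in PSL2; sorting the orbits by size
  bounds \<open>a\<close>, \<open>b\<close> and \<open>c\<close> in turn.\<close>

lemma klein_arith:
  fixes N a b c i j k :: nat
  assumes "i * a = N" "j * b = N" "k * c = N" "a \<ge> 2" "b \<ge> 2" "c \<ge> 2"
    and sum: "i + j + k = N + 2" and ord: "j \<le> i" "k \<le> j" and pos: "k \<ge> 1"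
  shows "a = 2 \<and> (b = 2 \<and> N = 2 * c \<or> b = 3 \<and> (c = 3 \<and> N = 12 \<or> c = 4 \<and> N = 24 \<or> c = 5 \<and> N = 60))"
proof -
  have "a < 3"
  proof (rule ccontr)
    assume "\<not> a < 3"
    then have "i * 3 \<le> N" using assms(1) by (metis mult_le_mono2 not_less)
    with sum ord show False by linarith
  qed
  then have a: "a = 2" using assms by simp
  then have N: "N = 2 * i" using assms by simp
  have "b < 4"
  proof (rule ccontr)
    assume "\<not> b < 4"
    then have "j * 4 \<le> N" using assms(2) by (metis mult_le_mono2 not_less)
    with sum ord N show False by linarith
  qed
  then consider "b = 2" | "b = 3" using assms by linarith
  then show ?thesis
  proof cases
    case 1
    then have "k = 2" using assms N by simp
    with 1 a assms show ?thesis by simp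
  next
    case 2
    then have j: "j * 3 = 2 * i" using assms N by simp
    have "c < 6"
    proof (rule ccontr)
      assume "\<not> c < 6"
      then have "k * 6 \<le> N" using assms(3) by (metis mult_le_mono2 not_less)
      with sum N j show False by linarith
    qed
    then consider "c = 2" | "c = 3" | "c = 4" | "c = 5" using assms by linarith
    then show ?thesis
    proof cases
      case 1
      then have "k * 2 = N" using assms by simp
      with N j sum ord show ?thesis by linarith
    next
      case 2
      then have "k * 3 = N" using assms by simp
      with N j sum 2 \<open>b = 3\<close> a show ?thesis by auto
    next
      case 3
      then have "k * 4 = N" using assms by simp
      with N j sum 3 \<open>b = 3\<close> a show ?thesis by auto
    next
      case 4
      then have "k * 5 = N" using assms by simp
      with N j sum 4 \<open>b = 3\<close> a show ?thesis by auto
    qed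
  qed
qed

section \<open>Points with nontrivial stabilizer and the class equation\<close>

context finite_SL2
begin

text \<open>The bound is 2 because every stabilizer contains the two scalar matrices.\<close>

definition special :: "'a P1_point set" where
  "special = {x. card (stab x) > 2}"

lemma scalars_subset_stab: "{mat 1, - mat 1} \<subseteq> stab x"
  using uminus_mem_stab[OF one_mem_stab] by auto

lemma card_scalars: "card {mat 1, - mat 1 :: 'a^2^2} = 2"
  using minus_mat_1_neq[where 'a='a] by (metis card_2_iff)

lemma card_stab_diff: "card (stab x - {mat 1, - mat 1}) = card (stab x) - 2"
  using scalars_subset_stab card_scalars by (simp add: card_Diff_subset)

lemma card_stab_ge: "card (stab x) \<ge> 2"
  using card_mono[OF finite_stab scalars_subset_stab] card_scalars by simp

lemma special_iff: "x \<in> special \<longleftrightarrow> (\<exists>A\<in>\<Gamma> - {mat 1, - mat 1}. pact A x = x)"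
proof -
  have "x \<in> special \<longleftrightarrow> card (stab x - {mat 1, - mat 1}) > 0"
    unfolding special_def card_stab_diff by auto
  also have "\<dots> \<longleftrightarrow> stab x - {mat 1, - mat 1} \<noteq> {}" by (simp only: card_gt_0_iff) simp
  also have "\<dots> \<longleftrightarrow> (\<exists>A\<in>\<Gamma> - {mat 1, - mat 1}. pact A x = x)" by (auto simp: stab_def)
  finally show ?thesis .
qed

lemma finite_fixed_points: "A \<in> \<Gamma> - {mat 1, - mat 1} \<Longrightarrow> finite {x. pact A x = x}"
  using fixed_points[of A] by (intro card_ge_0_finite) auto

lemma finite_special: "finite special"
proof -
  have "special = (\<Union>A\<in>\<Gamma> - {mat 1, - mat 1}. {x. pact A x = x})" using special_iff by auto
  then show ?thesis using finite_fixed_points by auto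
qed

text \<open>The pairs of a nonscalar \<open>A\<close> and a point fixed by it are counted in both
  ways; each \<open>A\<close> fixes two points.\<close>

lemma double_counting: "2 * (card \<Gamma> - 2) = (\<Sum>x\<in>special. card (stab x) - 2)"
proof -
  let ?G = "\<Gamma> - {mat 1, - mat 1}"
  have cardG: "card ?G = card \<Gamma> - 2"
    using card_scalars scalars_subset_stab[of undefined] by (subst card_Diff_subset) (auto simp: stab_def)
  have "(\<Sum>A\<in>?G. \<Sum>x\<in>special. if pact A x = x then 1 else 0 :: nat) = (\<Sum>A\<in>?G. 2)"
  proof (rule sum.cong)
    fix A assume A: "A \<in> ?G"
    then have "{x \<in> special. pact A x = x} = {x. pact A x = x}" using special_iff by auto
    then show "(\<Sum>x\<in>special. if pact A x = x then 1 else 0) = (2 :: nat)"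
      using fixed_points[of A] A finite_special by (simp add: sum.If_cases Int_def)
  qed simp
  moreover have "(\<Sum>A\<in>?G. if pact A x = x then 1 else 0) = card (stab x) - 2" for x
  proof -
    have "{A \<in> ?G. pact A x = x} = stab x - {mat 1, - mat 1}" by (auto simp: stab_def)
    then show ?thesis using card_stab_diff by (simp add: sum.If_cases Int_def)
  qed
  ultimately show ?thesis
    using sum.swap[of "\<lambda>A x. if pact A x = x then 1 else 0 :: nat" special ?G] cardG by simp
qed

lemma orb_subset_special: "x \<in> special \<Longrightarrow> orb x \<subseteq> special"
  by (auto simp: special_def card_stab_orb)

text \<open>This is the Riemann--Hurwitz formula for the quotient of the projective line.\<close>

lemma class_equation:
  assumes N: "card \<Gamma> = 2 * N"
  shows "2 * (N - 1) = (\<Sum>\<omega>\<in>orb ` special. N - card \<omega>)"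
proof -
  have "special = \<Union>(orb ` special)" using orb_subset_special by auto
  then have "(\<Sum>x\<in>special. card (stab x) - 2) = (\<Sum>x\<in>\<Union>(orb ` special). card (stab x) - 2)" by simp
  also have "\<dots> = (\<Sum>\<omega>\<in>orb ` special. \<Sum>x\<in>\<omega>. card (stab x) - 2)"
    using orb_disjoint by (subst sum.Union_disjoint) auto
  also have "\<dots> = (\<Sum>\<omega>\<in>orb ` special. 2 * (N - card \<omega>))"
  proof (rule sum.cong)
    fix \<omega> assume "\<omega> \<in> orb ` special"
    then obtain x where x: "\<omega> = orb x" by blast
    then have "(\<Sum>x\<in>\<omega>. card (stab x) - 2) = card (orb x) * (card (stab x) - 2)"
      by (simp add: card_stab_orb)
    also have "\<dots> = 2 * N - 2 * card (orb x)"
      using orbit_stabilizer[of x] N by (simp add: diff_mult_distrib2)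
    finally show "(\<Sum>x\<in>\<omega>. card (stab x) - 2) = 2 * (N - card \<omega>)" by (simp add: x)
  qed simp
  finally show ?thesis
    using double_counting N by (simp flip: sum_distrib_left)
qed

text \<open>The numbers \<open>a\<close>, \<open>b\<close>, \<open>c\<close> are the orders of the
  stabilizers in PSL2; the factor 2 accounts for the scalars.\<close>

definition klein_type :: "nat \<Rightarrow> nat \<Rightarrow> nat \<Rightarrow> 'a P1_point \<Rightarrow> 'a P1_point \<Rightarrow> 'a P1_point \<Rightarrow> bool" where
  "klein_type a b c x y z \<longleftrightarrow> special = orb x \<union> orb y \<union> orb z \<and>
     orb x \<inter> orb y = {} \<and> orb x \<inter> orb z = {} \<and> orb y \<inter> orb z = {} \<and>
     card (stab x) = 2 * a \<and> card (stab y) = 2 * b \<and> card (stab z) = 2 * c"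

text \<open>Each summand of the class equation lies between N/2 and N - 1, which leaves two or three
  special orbits. If there are two, they have two points in total, so each is a fixed point of the
  whole group; three are settled by \<open>klein_arith\<close>.\<close>

lemma klein_classification:
  assumes N: "card \<Gamma> = 2 * N" "N \<ge> 2"
  shows "(\<exists>x. stab x = \<Gamma>) \<or> (\<exists>a b c x y z. klein_type a b c x y z \<and>
    (a, b, c, N) \<in> {(2, 2, c, 2 * c), (2, 3, 3, 12), (2, 3, 4, 24), (2, 3, 5, 60)})"
proof -
  let ?\<Omega> = "orb ` special"
  have fin: "finite ?\<Omega>" using finite_special by simp
  have half: "\<exists>e\<ge>2. card (stab x) = 2 * e \<and> card (orb x) * e = N" if x: "x \<in> special" for x
  proof -
    obtain e where e: "card (stab x) = 2 * e" using even_card_stab by (auto elim: evenE)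
    moreover have "e \<ge> 2" using x e by (simp add: special_def)
    moreover have "card (orb x) * e = N" using orbit_stabilizer[of x] N e by simp
    ultimately show ?thesis by blast
  qed
  have bound: "1 \<le> card \<omega>" "2 * card \<omega> \<le> N" if "\<omega> \<in> ?\<Omega>" for \<omega>
  proof -
    obtain x where x: "x \<in> special" "\<omega> = orb x" using \<open>\<omega> \<in> ?\<Omega>\<close> by blast
    obtain e where e: "e \<ge> 2" "card (orb x) * e = N" using half[OF x(1)] by blast
    show "1 \<le> card \<omega>" using card_orb_pos[of x] x by simp
    show "2 * card \<omega> \<le> N" using e mult_le_mono2[OF e(1), of "card (orb x)"] x by (simp add: mult.commute)
  qed
  note ce = class_equation[OF N(1)]
  have "(\<Sum>\<omega>\<in>?\<Omega>. N - card \<omega>) \<le> (\<Sum>\<omega>\<in>?\<Omega>. N - 1)"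
    using bound by (intro sum_mono) (simp add: diff_le_mono2)
  then have "2 * (N - 1) \<le> card ?\<Omega> * (N - 1)" using ce by simp
  then have ge: "2 \<le> card ?\<Omega>" using N by simp
  have "(\<Sum>\<omega>\<in>?\<Omega>. N) \<le> (\<Sum>\<omega>\<in>?\<Omega>. 2 * (N - card \<omega>))"
    using bound by (intro sum_mono) fastforce
  then have "card ?\<Omega> * N \<le> 4 * (N - 1)" using ce by (simp flip: sum_distrib_left)
  then have "card ?\<Omega> * N < 4 * N" using N(2) by linarith
  then have "card ?\<Omega> < 4" by simp
  with ge consider "card ?\<Omega> = 2" | "card ?\<Omega> = 3" by linarith
  then show ?thesis
  proof cases
    case 1
    then obtain \<omega>1 \<omega>2 where \<omega>: "?\<Omega> = {\<omega>1, \<omega>2}" "\<omega>1 \<noteq> \<omega>2" by (metis card_2_iff)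
    then have "2 * (N - 1) = (N - card \<omega>1) + (N - card \<omega>2)" using ce by simp
    moreover have "1 \<le> card \<omega>1" "2 * card \<omega>1 \<le> N" "1 \<le> card \<omega>2" "2 * card \<omega>2 \<le> N"
      using bound \<omega> by auto
    ultimately have "card \<omega>1 = 1" by linarith
    moreover have "\<omega>1 \<in> ?\<Omega>" using \<omega> by simp
    then obtain x where x: "\<omega>1 = orb x" by blast
    ultimately have "card (stab x) = card \<Gamma>" using orbit_stabilizer[of x] by simp
    moreover have "stab x \<subseteq> \<Gamma>" by (auto simp: stab_def)
    ultimately have "stab x = \<Gamma>" by (intro card_subset_eq) auto
    then show ?thesis by blast
  next
    case 2
    then obtain \<omega>1 \<omega>2 \<omega>3 where \<omega>: "?\<Omega> = {\<omega>1, \<omega>2, \<omega>3}" "\<omega>1 \<noteq> \<omega>2" "\<omega>1 \<noteq> \<omega>3" "\<omega>2 \<noteq> \<omega>3"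
      by (metis card_3_iff)
    have main: "\<exists>a b c x y z. klein_type a b c x y z \<and>
        (a, b, c, N) \<in> {(2, 2, c, 2 * c), (2, 3, 3, 12), (2, 3, 4, 24), (2, 3, 5, 60)}"
      if \<omega>: "?\<Omega> = {\<omega>1, \<omega>2, \<omega>3}" "\<omega>1 \<noteq> \<omega>2" "\<omega>1 \<noteq> \<omega>3" "\<omega>2 \<noteq> \<omega>3"
        and ord: "card \<omega>2 \<le> card \<omega>1" "card \<omega>3 \<le> card \<omega>2" for \<omega>1 \<omega>2 \<omega>3
    proof -
      have "\<omega>1 \<in> ?\<Omega>" "\<omega>2 \<in> ?\<Omega>" "\<omega>3 \<in> ?\<Omega>" using \<omega>(1) by auto
      then obtain x y z where xyz: "x \<in> special" "y \<in> special" "z \<in> special"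
        "\<omega>1 = orb x" "\<omega>2 = orb y" "\<omega>3 = orb z" by blast
      obtain a where a: "a \<ge> 2" "card (stab x) = 2 * a" "card (orb x) * a = N" using half[OF xyz(1)] by blast
      obtain b where b: "b \<ge> 2" "card (stab y) = 2 * b" "card (orb y) * b = N" using half[OF xyz(2)] by blast
      obtain c where c: "c \<ge> 2" "card (stab z) = 2 * c" "card (orb z) * c = N" using half[OF xyz(3)] by blast
      have "special = \<Union>?\<Omega>" using orb_subset_special by auto
      then have "special = orb x \<union> orb y \<union> orb z" using \<omega> xyz by auto
      then have "klein_type a b c x y z"
        using \<omega> xyz a b c orb_disjoint unfolding klein_type_def by metis
      moreover have "2 * (N - 1) = (N - card \<omega>1) + (N - card \<omega>2) + (N - card \<omega>3)" using ce \<omega> by simp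
      moreover have b': "1 \<le> card \<omega>1" "2 * card \<omega>1 \<le> N" "1 \<le> card \<omega>2" "2 * card \<omega>2 \<le> N" "1 \<le> card \<omega>3" "2 * card \<omega>3 \<le> N"
        using bound \<omega> by auto
      ultimately have "card \<omega>1 + card \<omega>2 + card \<omega>3 = N + 2" using N by linarith
      then have "a = 2 \<and> (b = 2 \<and> N = 2 * c \<or> b = 3 \<and> (c = 3 \<and> N = 12 \<or> c = 4 \<and> N = 24 \<or> c = 5 \<and> N = 60))"
        using klein_arith[of "card (orb x)" a N "card (orb y)" b "card (orb z)" c] a b c ord b' xyz by simp
      with \<open>klein_type a b c x y z\<close> show ?thesis by blast
    qed
    consider "card \<omega>2 \<le> card \<omega>1" "card \<omega>3 \<le> card \<omega>2" | "card \<omega>3 \<le> card \<omega>1" "card \<omega>2 \<le> card \<omega>3"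
      | "card \<omega>1 \<le> card \<omega>2" "card \<omega>3 \<le> card \<omega>1" | "card \<omega>3 \<le> card \<omega>2" "card \<omega>1 \<le> card \<omega>3"
      | "card \<omega>1 \<le> card \<omega>3" "card \<omega>2 \<le> card \<omega>1" | "card \<omega>2 \<le> card \<omega>3" "card \<omega>1 \<le> card \<omega>2"
      by linarith
    then show ?thesis
    proof cases
      case 1 then show ?thesis using main[of \<omega>1 \<omega>2 \<omega>3] \<omega> by simp
    next
      case 2 then show ?thesis using main[of \<omega>1 \<omega>3 \<omega>2] \<omega> by (simp add: insert_commute)
    next
      case 3 then show ?thesis using main[of \<omega>2 \<omega>1 \<omega>3] \<omega> by (simp add: insert_commute)
    next
      case 4 then show ?thesis using main[of \<omega>2 \<omega>3 \<omega>1] \<omega> by (simp add: insert_commute)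
    next
      case 5 then show ?thesis using main[of \<omega>3 \<omega>1 \<omega>2] \<omega> by (simp add: insert_commute)
    next
      case 6 then show ?thesis using main[of \<omega>3 \<omega>2 \<omega>1] \<omega> by (simp add: insert_commute)
    qed
  qed
qed

lemma special_nonempty:
  assumes "card \<Gamma> > 2"
  shows "special \<noteq> {}"
proof -
  have "\<not> \<Gamma> \<subseteq> {mat 1, - mat 1}" using assms card_mono[of "{mat 1, - mat 1}" \<Gamma>] card_scalars by auto
  then obtain A where A: "A \<in> \<Gamma> - {mat 1, - mat 1}" by blast
  then have "card {x. pact A x = x} = 2" using fixed_points[of A] by blast
  then have "{x. pact A x = x} \<noteq> {}" by (metis card.empty zero_neq_numeral)
  with A show ?thesis using special_iff by blast
qed

lemma fixes_special:
  assumes "card \<Gamma> > 2" "A \<in> \<Gamma>"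
  obtains x where "x \<in> special" "A \<in> stab x"
proof (cases "A \<in> {mat 1, - mat 1}")
  case True
  then show ?thesis using that special_nonempty[OF assms(1)] scalars_subset_stab by blast
next
  case False
  then have "card {x. pact A x = x} = 2" using fixed_points[of A] assms by blast
  then have "{x. pact A x = x} \<noteq> {}" by (metis card.empty zero_neq_numeral)
  then obtain x where x: "pact A x = x" by blast
  moreover from this have "x \<in> special" using special_iff assms(2) False by blast
  ultimately show ?thesis using that assms(2) unfolding stab_def by blast
qed

section \<open>Invariant point sets and their characters\<close>

definition invariant_set :: "'a P1_point set \<Rightarrow> bool" where
  "invariant_set S \<longleftrightarrow> finite S \<and> (\<forall>A\<in>\<Gamma>. pact A ` S = S)"

lemma invariant_set_orb: "invariant_set (orb x)"
  by (simp add: invariant_set_def pact_image_orb)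

lemma invariant_set_Un: "invariant_set S \<Longrightarrow> invariant_set T \<Longrightarrow> invariant_set (S \<union> T)"
  by (simp add: invariant_set_def image_Un)

text \<open>Every \<open>A\<close> fixes a special point, and at that point \<open>c\<close> is the
  inverse of a power of the eigenvalue, whose order divides \<open>card (stab x)\<close>. So a
  divisibility at each special point bounds the order of the character.\<close>

lemma cov_factor_root_of_unity:
  assumes \<Gamma>: "card \<Gamma> > 2" and S: "invariant_set S" "card S \<ge> 2"
    and special: "\<And>x. x \<in> special \<Longrightarrow> card (stab x) dvd j * (if x \<in> S then card S - 2 else card S)"
    and A: "A \<in> \<Gamma>"
  obtains c where "cov_factor A S c" "c ^ j = 1"
proof -
  have S': "finite S" "pact A ` S = S" using S A by (auto simp: invariant_set_def)
  obtain c where c: "cov_factor A S c" using cov_factor_exists[OF det[OF A] S'] .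
  obtain x where x: "x \<in> special" "A \<in> stab x" using fixes_special[OF \<Gamma> A] .
  define n where "n = (if x \<in> S then card S - 2 else card S)"
  let ?z = "eigenvalue A x"
  have "c * ?z ^ n = 1"
    using cov_factor_eigenvector[OF c S'(1) eigenvalue(1)[OF x(2)] rep(1) eigenvalue(2)[OF x(2)]] S(2)
    by (auto simp: n_def rep)
  then have "c ^ j * ?z ^ (j * n) = 1" by (metis power_mult_distrib power_mult power_one mult.commute)
  moreover have "?z ^ (j * n) = 1"
  proof -
    obtain k where k: "j * n = card (stab x) * k"
      using special[OF x(1)] unfolding n_def[symmetric] by (rule dvdE)
    show ?thesis unfolding k power_mult[of ?z "card (stab x)"] eigenvalue_power_card[OF x(2)] by simp
  qed
  ultimately show thesis using that c by simp
qed

text \<open>Stabilizer orders and membership in an invariant set are constant on orbits, so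
  conditions at all special points reduce to the three representatives.\<close>

lemma klein_type_cases:
  assumes "klein_type a b c x y z" "w \<in> special" "invariant_set S"
  obtains u where "u \<in> {x, y, z}" "card (stab w) = card (stab u)" "w \<in> S \<longleftrightarrow> u \<in> S"
proof -
  obtain u where u: "u \<in> {x, y, z}" "w \<in> orb u"
    using assms by (auto simp: klein_type_def)
  then obtain A where A: "A \<in> \<Gamma>" "w = pact A u" by (auto simp: orb_def)
  have "u \<in> orb w" using orb_eq[OF u(2)] by (metis self_mem_orb)
  then obtain B where B: "B \<in> \<Gamma>" "u = pact B w" by (auto simp: orb_def)
  have "w \<in> S \<longleftrightarrow> u \<in> S" using A B assms(3) by (auto simp: invariant_set_def)
  then show thesis using that u card_stab_orb by blast
qed

end

definition has_compression :: "('a::field^2^2) set \<Rightarrow> ('a^2^2) set set \<Rightarrow> nat \<Rightarrow> bool" where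
  "has_compression \<Gamma> G d \<longleftrightarrow> (\<exists>f1 f2 :: 'a poly poly.
     is_form d f1 \<and> is_form d f2 \<and>
     self_compression A2 ((\<lambda>A. total_rmap (\<lambda>v. A *v v)) ` \<Gamma>) (total_rmap (poly_map f1 f2)) \<and>
     (\<exists>\<phi>. is_descent (poly_map f1 f2) \<phi> \<and>
       nontrivial_self_compression P1 ((\<lambda>g. total_rmap (psl_act g)) ` G) (total_rmap \<phi>)))"

lemma points_form_nonzero: "finite S \<Longrightarrow> points_form S \<noteq> 0"
proof -
  have "linear_form (rep x) \<noteq> 0" for x :: "'a P1_point"
    using rep(1)[of x] by (auto simp: linear_form_def vec2_eq_iff)
  then show "finite S \<Longrightarrow> points_form S \<noteq> 0" by (simp add: points_form_def)
qed

section \<open>Invariant forms and self-compressions of given degree\<close>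

context finite_SL2
begin

definition inv_form :: "nat \<Rightarrow> 'a poly poly \<Rightarrow> bool" where
  "inv_form n h \<longleftrightarrow> is_form n h \<and> h \<noteq> 0 \<and> (\<forall>A\<in>\<Gamma>. \<forall>v. eval2 h (A *v v) = eval2 h v)"

definition inv_degree :: "nat \<Rightarrow> bool" where
  "inv_degree n \<longleftrightarrow> (\<exists>h. inv_form n h)"

lemma inv_degree_add: "inv_degree m \<Longrightarrow> inv_degree n \<Longrightarrow> inv_degree (m + n)"
  unfolding inv_degree_def inv_form_def
  by (metis eval2_simps(5) is_form_mult mult_eq_0_iff)

lemma inv_degree_0: "inv_degree 0"
  unfolding inv_degree_def inv_form_def using is_form_1 by (intro exI[of _ 1]) simp

lemma inv_degree_mult: "inv_degree m \<Longrightarrow> inv_degree (n * m)"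
  by (induction n) (simp_all add: inv_degree_0 inv_degree_add)

text \<open>Only \<open>j = 1\<close>, a trivial character, and \<open>j = 2\<close>, a sign, are
  used.\<close>

definition semi_invariant :: "nat \<Rightarrow> 'a P1_point set \<Rightarrow> bool" where
  "semi_invariant j S \<longleftrightarrow> finite S \<and> (\<forall>A\<in>\<Gamma>. \<exists>c. cov_factor A S c \<and> c ^ j = 1)"

lemma inv_degree_semi_invariant:
  assumes "semi_invariant j S"
  shows "inv_degree (j * card S)"
  unfolding inv_degree_def inv_form_def
proof (intro exI[of _ "points_form S ^ j"] conjI ballI allI)
  show "is_form (j * card S) (points_form S ^ j)" by (intro is_form_power is_form_points_form)
  show "points_form S ^ j \<noteq> 0" using assms points_form_nonzero by (auto simp: semi_invariant_def)
  fix A v assume "A \<in> \<Gamma>"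
  then obtain c where c: "cov_factor A S c" "c ^ j = 1" using assms by (auto simp: semi_invariant_def)
  then have "eval2 (points_form S) v ^ j = (c * eval2 (points_form S) (A *v v)) ^ j"
    by (metis cov_factor_def)
  then show "eval2 (points_form S ^ j) (A *v v) = eval2 (points_form S ^ j) v"
    using c(2) by (simp add: power_mult_distrib)
qed

lemma compression_invariant:
  assumes S: "semi_invariant 1 S" "card S \<ge> 3" and m: "inv_degree m" and G: "G \<subseteq> nu ` \<Gamma>"
  shows "has_compression \<Gamma> G (m + (card S - 1))"
proof -
  obtain h where h: "inv_form m h" using m by (auto simp: inv_degree_def)
  show ?thesis
    unfolding has_compression_def
  proof (rule points_cov_self_compression)
    show "finite S" "card S \<ge> 3" "is_form m h" "h \<noteq> 0" "G \<subseteq> nu ` \<Gamma>"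
      using assms h by (auto simp: semi_invariant_def inv_form_def)
    fix A assume A: "A \<in> \<Gamma>"
    then show "det A = 1" by (rule det)
    have c: "cov_factor A S 1" using S A by (auto simp: semi_invariant_def)
    then show "\<exists>c. cov_factor A S c" ..
    fix v
    have "A *v points_cov S v = points_cov S (A *v v)" using c by (simp add: cov_factor_def)
    then show "A *v (eval2 h v *s points_cov S v) = eval2 h (A *v v) *s points_cov S (A *v v)"
      using h A by (simp add: vector_scalar_commute inv_form_def)
  qed
qed

text \<open>The form of \<open>S\<close> has the same sign character as the covariant, so
  multiplying the covariant by it cancels the sign at the cost of \<open>card S\<close>
  degrees.\<close>

lemma compression_semi_invariant:
  assumes S: "semi_invariant 2 S" "card S \<ge> 3" and m: "inv_degree m" and G: "G \<subseteq> nu ` \<Gamma>"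
  shows "has_compression \<Gamma> G (m + card S + (card S - 1))"
proof -
  obtain h where h: "inv_form m h" using m by (auto simp: inv_degree_def)
  show ?thesis
    unfolding has_compression_def
  proof (rule points_cov_self_compression)
    show "finite S" "card S \<ge> 3" "is_form (m + card S) (h * points_form S)" "h * points_form S \<noteq> 0" "G \<subseteq> nu ` \<Gamma>"
      using assms h points_form_nonzero by (auto simp: semi_invariant_def inv_form_def intro!: is_form_mult is_form_points_form)
    fix A assume A: "A \<in> \<Gamma>"
    then show "det A = 1" by (rule det)
    obtain c where c: "cov_factor A S c" "c ^ 2 = 1" using S A by (auto simp: semi_invariant_def)
    from c(1) show "\<exists>c. cov_factor A S c" ..
    fix v
    have 1: "A *v points_cov S v = c *s points_cov S (A *v v)"
      and 2: "eval2 (points_form S) v = c * eval2 (points_form S) (A *v v)"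
      using c(1) unfolding cov_factor_def by blast+
    have "A *v (eval2 (h * points_form S) v *s points_cov S v) =
        (eval2 h (A *v v) * (c * eval2 (points_form S) (A *v v))) *s (c *s points_cov S (A *v v))"
      using h A by (simp add: vector_scalar_commute inv_form_def 1 flip: 2)
    also have "\<dots> = (c ^ 2 * (eval2 h (A *v v) * eval2 (points_form S) (A *v v))) *s points_cov S (A *v v)"
      by (simp add: vector_smult_assoc power2_eq_square mult_ac)
    finally show "A *v (eval2 (h * points_form S) v *s points_cov S v) =
        eval2 (h * points_form S) (A *v v) *s points_cov S (A *v v)"
      using c(2) by simp
  qed
qed

lemma semi_invariantI:
  assumes "card \<Gamma> > 2" "invariant_set S" "card S \<ge> 2"
    and "\<And>x. x \<in> special \<Longrightarrow> card (stab x) dvd j * (if x \<in> S then card S - 2 else card S)"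
  shows "semi_invariant j S"
  unfolding semi_invariant_def
proof (intro conjI ballI)
  show "finite S" using assms(2) by (simp add: invariant_set_def)
  fix A assume "A \<in> \<Gamma>"
  then show "\<exists>c. cov_factor A S c \<and> c ^ j = 1" using cov_factor_root_of_unity[OF assms] by metis
qed

lemma semi_invariant_klein:
  assumes "card \<Gamma> > 2" "klein_type a b c x y z" "invariant_set S" "card S \<ge> 2"
    and "2 * a dvd j * (if x \<in> S then card S - 2 else card S)"
    and "2 * b dvd j * (if y \<in> S then card S - 2 else card S)"
    and "2 * c dvd j * (if z \<in> S then card S - 2 else card S)"
  shows "semi_invariant j S"
proof (rule semi_invariantI[OF assms(1,3,4)])
  fix w assume "w \<in> special"
  then obtain u where u: "u \<in> {x, y, z}" "card (stab w) = card (stab u)" "w \<in> S \<longleftrightarrow> u \<in> S"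
    using klein_type_cases[OF assms(2) _ assms(3)] by metis
  then show "card (stab w) dvd j * (if w \<in> S then card S - 2 else card S)"
    using assms by (auto simp: klein_type_def)
qed

lemma free_orbit:
  assumes "finite B"
  obtains w where "orb w \<inter> B = {}" "orb w \<inter> special = {}" "2 * card (orb w) = card \<Gamma>"
proof -
  \<comment> \<open>Whole orbits of the points of \<open>B\<close> are avoided, so that the orbit of
    \<open>w\<close>, and not merely \<open>w\<close>, misses \<open>B\<close>.\<close>
  have "finite (special \<union> (\<Union>x\<in>B. orb x))" using assms finite_special by auto
  then obtain w where w: "w \<notin> special" "w \<notin> (\<Union>x\<in>B. orb x)"
    using ex_new_if_finite[OF infinite_P1] by blast
  then have "card (stab w) = 2" using card_stab_ge[of w] by (simp add: special_def)
  then have "2 * card (orb w) = card \<Gamma>" using orbit_stabilizer[of w] by simp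
  moreover have "orb w \<inter> B = {}" using w(2) orb_eq self_mem_orb by blast
  moreover have "orb w \<inter> special = {}" using w(1) orb_eq self_mem_orb orb_subset_special by blast
  ultimately show thesis using that by blast
qed

lemma compression_multiple:
  assumes "semi_invariant 1 S" "card S \<ge> 3" "G \<subseteq> nu ` \<Gamma>"
  shows "has_compression \<Gamma> G (card S * (n + 1) - 1)"
proof -
  have "has_compression \<Gamma> G (n * (1 * card S) + (card S - 1))"
    by (intro compression_invariant assms inv_degree_mult inv_degree_semi_invariant)
  moreover have "n * (1 * card S) + (card S - 1) = card S * (n + 1) - 1"
    using assms by (simp add: algebra_simps)
  ultimately show ?thesis by simp
qed

text \<open>Two free orbits together have \<open>card \<Gamma>\<close> points, which every
  stabilizer order divides. One free orbit has only half as many, too few when the whole group fixes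
  a point, as a cyclic group does.\<close>

lemma compression_cyclic:
  assumes "card \<Gamma> \<ge> 4" "G \<subseteq> nu ` \<Gamma>"
  shows "has_compression \<Gamma> G (card \<Gamma> * (n + 1) - 1)"
proof -
  obtain w where w: "orb w \<inter> special = {}" "2 * card (orb w) = card \<Gamma>"
    using free_orbit[of "{}"] by auto
  obtain u where u: "orb u \<inter> orb w = {}" "orb u \<inter> special = {}" "2 * card (orb u) = card \<Gamma>"
    using free_orbit[of "orb w"] by auto
  let ?S = "orb u \<union> orb w"
  have card: "card ?S = card \<Gamma>" using u w by (simp add: card_Un_disjoint)
  have "semi_invariant 1 ?S"
  proof (rule semi_invariantI)
    show "card (stab x) dvd 1 * (if x \<in> ?S then card ?S - 2 else card ?S)" if "x \<in> special" for x
    proof -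
      have "x \<notin> ?S" using that u w by blast
      then show ?thesis using card orbit_stabilizer[of x] by simp
    qed
  qed (use assms card in \<open>auto intro: invariant_set_Un invariant_set_orb\<close>)
  then show ?thesis using compression_multiple[of ?S] assms card by simp
qed

section \<open>Degrees attained for each solution of the class equation\<close>

lemma klein_type_card:
  assumes "klein_type a b c x y z" "card \<Gamma> = 2 * N"
  shows "card (orb x) * a = N" "card (orb y) * b = N" "card (orb z) * c = N"
  using assms orbit_stabilizer[of x] orbit_stabilizer[of y] orbit_stabilizer[of z]
  by (simp_all add: klein_type_def)

lemma klein_type_notin:
  assumes "klein_type a b c x y z"
  shows "x \<notin> orb y" "x \<notin> orb z" "y \<notin> orb x" "y \<notin> orb z" "z \<notin> orb x" "z \<notin> orb y"
  using assms self_mem_orb[of x] self_mem_orb[of y] self_mem_orb[of z] unfolding klein_type_def by blast+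

lemma klein_type_card_Un:
  assumes "klein_type a b c x y z"
  shows "card (orb x \<union> orb y) = card (orb x) + card (orb y)" "card (orb x \<union> orb z) = card (orb x) + card (orb z)"
    "card (orb y \<union> orb z) = card (orb y) + card (orb z)"
  using assms by (simp_all add: klein_type_def card_Un_disjoint)

text \<open>A free orbit contains no special point, so its character is trivial as soon as every
  special stabilizer order divides its size \<open>N\<close>.\<close>

lemma semi_invariant_free_orbit:
  assumes "klein_type a b c x y z" "card \<Gamma> = 2 * N" "N \<ge> 2" "2 * a dvd N" "2 * b dvd N" "2 * c dvd N"
  obtains S where "semi_invariant 1 S" "card S = N"
proof -
  obtain w where w: "orb w \<inter> special = {}" "2 * card (orb w) = card \<Gamma>"
    using free_orbit[of "{}"] by auto
  have "x \<notin> orb w" "y \<notin> orb w" "z \<notin> orb w"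
    using w(1) assms(1) self_mem_orb[of x] self_mem_orb[of y] self_mem_orb[of z]
    unfolding klein_type_def by blast+
  then have "semi_invariant 1 (orb w)"
    using assms w by (intro semi_invariant_klein[OF _ assms(1)] invariant_set_orb) auto
  then show thesis using that w assms by simp
qed

text \<open>A free orbit of \<open>N\<close> points works except for type (2, 2, c) with
  \<open>c\<close> odd, where 4 does not divide 2c. Then the two orbits of \<open>c\<close> points
  are joined: at their points the exponent is 2c - 2, which is divisible by 4. The three polyhedral
  types meet the divisibilities, so they are treated uniformly with the dihedral one.\<close>

lemma compression_dihedral:
  assumes t: "klein_type a b c x y z" "(a, b, c, N) \<in> {(2, 2, c, 2 * c), (2, 3, 3, 12), (2, 3, 4, 24), (2, 3, 5, 60)}"
    and N: "card \<Gamma> = 2 * N" "N \<ge> 3" and G: "G \<subseteq> nu ` \<Gamma>"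
  shows "has_compression \<Gamma> G (N * (n + 1) - 1)"
proof -
  have "\<exists>S. semi_invariant 1 S \<and> card S = N"
  proof (cases "2 * a dvd N \<and> 2 * b dvd N \<and> 2 * c dvd N")
    case True
    then show ?thesis using semi_invariant_free_orbit[OF t(1) N(1)] N(2) by (metis Suc_leD eval_nat_numeral(3))
  next
    case False
    then have d: "a = 2" "b = 2" "N = 2 * c" "odd c" using t(2) by auto
    then have k: "card (orb x) = c" "card (orb y) = c" using klein_type_card[OF t(1) N(1)] by auto
    have "4 dvd 2 * c - 2"
      using d(4) by (elim oddE) (simp add: algebra_simps)
    have card: "card (orb x \<union> orb y) = 2 * c" using klein_type_card_Un(1)[OF t(1)] k by simp
    have "semi_invariant 1 (orb x \<union> orb y)"
    proof (rule semi_invariant_klein[OF _ t(1)])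
      show "invariant_set (orb x \<union> orb y)" by (intro invariant_set_Un invariant_set_orb)
    qed (use N d \<open>4 dvd 2 * c - 2\<close> klein_type_notin[OF t(1)] in \<open>simp_all add: card\<close>)
    then show ?thesis using card d by blast
  qed
  then show ?thesis using compression_multiple G N(2) by blast
qed

text \<open>A single orbit of 4 points has a character of order three, as 6 does not divide 4 - 2
  but divides three times it. For the union of both such orbits 4 divides 8 and 6 divides 8 - 2; for
  the orbit of 6 points 4 divides 6 - 2 and 6 divides 6.\<close>

lemma compression_tetrahedral:
  assumes t: "klein_type 2 3 3 x y z" and N: "card \<Gamma> = 24" and G: "G \<subseteq> nu ` \<Gamma>"
  shows "has_compression \<Gamma> G (6 * n + 8 * m + 5)" "has_compression \<Gamma> G (8 * n + 7)"
proof -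
  have k: "card (orb x) = 6" "card (orb y) = 4" "card (orb z) = 4"
    using klein_type_card[OF t, of 12] N by simp_all
  note facts = N k klein_type_notin[OF t] klein_type_card_Un[OF t]
  have 6: "semi_invariant 1 (orb x)"
    by (intro semi_invariant_klein[OF _ t] invariant_set_orb) (simp_all add: facts)
  have 8: "semi_invariant 1 (orb y \<union> orb z)"
    by (intro semi_invariant_klein[OF _ t] invariant_set_Un invariant_set_orb) (simp_all add: facts)
  have "has_compression \<Gamma> G (n * (1 * card (orb x)) + m * (1 * card (orb y \<union> orb z)) + (card (orb x) - 1))"
    using 6 8 G by (intro compression_invariant inv_degree_add inv_degree_mult inv_degree_semi_invariant) (simp_all add: facts)
  then show "has_compression \<Gamma> G (6 * n + 8 * m + 5)" by (simp add: facts mult.commute)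
  have "has_compression \<Gamma> G (n * (1 * card (orb y \<union> orb z)) + (card (orb y \<union> orb z) - 1))"
    using 8 G by (intro compression_invariant inv_degree_mult inv_degree_semi_invariant) (simp_all add: facts)
  then show "has_compression \<Gamma> G (8 * n + 7)" by (simp add: facts mult.commute)
qed

text \<open>The orbits of 6 and 12 points both carry the sign character. It disappears in their
  union of 18 points, in the square of the form of degree 6, and in the product of this form with
  its own covariant, of degree 6 + 5.\<close>

lemma compression_octahedral:
  assumes t: "klein_type 2 3 4 x y z" and N: "card \<Gamma> = 48" and G: "G \<subseteq> nu ` \<Gamma>"
  shows "has_compression \<Gamma> G (8 * n + 12 * m + 7)" "has_compression \<Gamma> G (8 * n + 12 * m + 17)"
    "has_compression \<Gamma> G (12 * n + 11)"
proof -
  have k: "card (orb x) = 12" "card (orb y) = 8" "card (orb z) = 6"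
    using klein_type_card[OF t, of 24] N by simp_all
  note facts = N k klein_type_notin[OF t] klein_type_card_Un[OF t]
  have 8: "semi_invariant 1 (orb y)"
    by (intro semi_invariant_klein[OF _ t] invariant_set_orb) (simp_all add: facts)
  have 6: "semi_invariant 2 (orb z)"
    by (intro semi_invariant_klein[OF _ t] invariant_set_orb) (simp_all add: facts)
  have 18: "semi_invariant 1 (orb x \<union> orb z)"
    by (intro semi_invariant_klein[OF _ t] invariant_set_Un invariant_set_orb) (simp_all add: facts)
  have "has_compression \<Gamma> G (n * (1 * card (orb y)) + m * (2 * card (orb z)) + (card (orb y) - 1))"
    using 8 6 G by (intro compression_invariant inv_degree_add inv_degree_mult inv_degree_semi_invariant) (simp_all add: facts)
  then show "has_compression \<Gamma> G (8 * n + 12 * m + 7)" by (simp add: facts mult.commute)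
  have "has_compression \<Gamma> G (n * (1 * card (orb y)) + m * (2 * card (orb z)) + (card (orb x \<union> orb z) - 1))"
    using 8 6 18 G by (intro compression_invariant inv_degree_add inv_degree_mult inv_degree_semi_invariant) (simp_all add: facts)
  then show "has_compression \<Gamma> G (8 * n + 12 * m + 17)" by (simp add: facts mult.commute)
  have "has_compression \<Gamma> G (n * (2 * card (orb z)) + card (orb z) + (card (orb z) - 1))"
    using 6 G by (intro compression_semi_invariant inv_degree_mult inv_degree_semi_invariant) (simp_all add: facts)
  then show "has_compression \<Gamma> G (12 * n + 11)" by (simp add: facts ac_simps)
qed

text \<open>The binary icosahedral group is perfect, so no character obstructs; in the proof this
  shows as divisibilities by 4, 6 and 10 that hold for each orbit by itself.\<close>

lemma compression_icosahedral:
  assumes t: "klein_type 2 3 5 x y z" and N: "card \<Gamma> = 120" and G: "G \<subseteq> nu ` \<Gamma>"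
  shows "has_compression \<Gamma> G (12 * n + 20 * m + 11)" "has_compression \<Gamma> G (12 * n + 20 * m + 29)"
    "has_compression \<Gamma> G (20 * n + 19)"
proof -
  have k: "card (orb x) = 30" "card (orb y) = 20" "card (orb z) = 12"
    using klein_type_card[OF t, of 60] N by simp_all
  note facts = N k klein_type_notin[OF t]
  have 12: "semi_invariant 1 (orb z)" and 20: "semi_invariant 1 (orb y)" and 30: "semi_invariant 1 (orb x)"
    by (intro semi_invariant_klein[OF _ t] invariant_set_orb; simp add: facts)+
  have "has_compression \<Gamma> G (n * (1 * card (orb z)) + m * (1 * card (orb y)) + (card (orb z) - 1))"
    using 12 20 G by (intro compression_invariant inv_degree_add inv_degree_mult inv_degree_semi_invariant) (simp_all add: facts)
  then show "has_compression \<Gamma> G (12 * n + 20 * m + 11)" by (simp add: facts mult.commute)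
  have "has_compression \<Gamma> G (n * (1 * card (orb z)) + m * (1 * card (orb y)) + (card (orb x) - 1))"
    using 12 20 30 G by (intro compression_invariant inv_degree_add inv_degree_mult inv_degree_semi_invariant) (simp_all add: facts)
  then show "has_compression \<Gamma> G (12 * n + 20 * m + 29)" by (simp add: facts mult.commute)
  have "has_compression \<Gamma> G (n * (1 * card (orb y)) + (card (orb y) - 1))"
    using 20 G by (intro compression_invariant inv_degree_mult inv_degree_semi_invariant) (simp_all add: facts)
  then show "has_compression \<Gamma> G (20 * n + 19)" by (simp add: facts mult.commute)
qed

end

section \<open>The coefficients of the power series\<close>

text \<open>The bound on \<open>f\<close> makes the sum converge: only indices up to
  \<open>d\<close> can contribute to the coefficient at \<open>d\<close>, which counts the solutions
  of \<open>d = f n\<close>.\<close>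

lemma suminf_fps_X_power_nth:
  assumes f: "\<And>n. n \<le> f n" and nz: "fps_nth (\<Sum>n. fps_X ^ f n :: int fps) d \<noteq> 0"
  obtains n where "d = f n"
proof -
  define g :: "int fps" where "g = Abs_fps (\<lambda>d. \<Sum>n\<le>d. if d = f n then 1 else 0)"
  have "(\<lambda>n. fps_X ^ f n) sums g"
    unfolding sums_def
  proof (rule tendsto_fpsI)
    fix d
    show "\<forall>\<^sub>F m in sequentially. fps_nth (\<Sum>n<m. fps_X ^ f n) d = fps_nth g d"
      using eventually_gt_at_top[of d]
    proof eventually_elim
      case (elim m)
      have "fps_nth (\<Sum>n<m. fps_X ^ f n :: int fps) d = (\<Sum>n<m. if d = f n then 1 else 0)"
        by (simp add: fps_sum_nth fps_X_power_nth)
      also have "\<dots> = (\<Sum>n\<le>d. if d = f n then 1 else 0)"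
        using elim f by (intro sum.mono_neutral_right) (auto simp: not_le dest: leD)
      finally show ?case by (simp add: g_def)
    qed
  qed
  then have "(\<Sum>n. fps_X ^ f n) = g" by (rule sums_unique[symmetric])
  with nz have "(\<Sum>n\<le>d. if d = f n then 1 else 0 :: int) \<noteq> 0" by (simp add: g_def)
  then obtain n where "(if d = f n then 1 else 0 :: int) \<noteq> 0" by (rule sum.not_neutral_contains_not_neutral)
  then show thesis using that by (auto split: if_splits)
qed

lemma fps_mult_nth_nonzero:
  fixes f g :: "int fps"
  assumes "fps_nth (f * g) d \<noteq> 0"
  obtains i j where "d = i + j" "fps_nth f i \<noteq> 0" "fps_nth g j \<noteq> 0"
proof -
  from assms obtain i where "i \<in> {0..d}" "fps_nth f i * fps_nth g (d - i) \<noteq> 0"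
    unfolding fps_mult_nth by (rule sum.not_neutral_contains_not_neutral)
  then show thesis using that[of i "d - i"] by auto
qed

lemma polyhedral_series_nth:
  assumes "a \<ge> 2" and nz: "fps_nth (polyhedral_series a) d \<noteq> 0"
  obtains n m where "d = 2 * n * a + (4 * a - 4) * m + (2 * a - 1)"
  | n m where "d = 2 * n * a + (4 * a - 4) * m + (4 * a - 6) + (2 * a - 1)"
  | n where "d = (4 * a - 4) * n + (4 * a - 5)"
proof -
  let ?A = "\<Sum>n. fps_X ^ (2 * n * a) :: int fps" and ?B = "\<Sum>n. fps_X ^ ((4 * a - 4) * n) :: int fps"
  have A: "n \<le> 2 * n * a" and B: "n \<le> (4 * a - 4) * n" for n
    using assms(1) by auto
  have nz': "fps_nth (fps_X ^ (2 * a - 1) * (1 + fps_X ^ (4 * a - 6)) * ?A * ?B) d \<noteq> 0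
      \<or> fps_nth (fps_X ^ (4 * a - 5) * ?B) d \<noteq> 0"
    using nz by (auto simp: polyhedral_series_def)
  then show thesis
  proof
    assume "fps_nth (fps_X ^ (2 * a - 1) * (1 + fps_X ^ (4 * a - 6)) * ?A * ?B) d \<noteq> 0"
    then obtain i1 j where 1: "d = i1 + j" "fps_nth (fps_X ^ (2 * a - 1) * (1 + fps_X ^ (4 * a - 6)) * ?A) i1 \<noteq> 0"
      "fps_nth ?B j \<noteq> 0" by (rule fps_mult_nth_nonzero)
    from 1(2) obtain i2 k where 2: "i1 = i2 + k" "fps_nth (fps_X ^ (2 * a - 1) * (1 + fps_X ^ (4 * a - 6)) :: int fps) i2 \<noteq> 0"
      "fps_nth ?A k \<noteq> 0" by (rule fps_mult_nth_nonzero)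
    from 2(2) obtain i3 l where 3: "i2 = i3 + l" "fps_nth (fps_X ^ (2 * a - 1) :: int fps) i3 \<noteq> 0"
      "fps_nth (1 + fps_X ^ (4 * a - 6) :: int fps) l \<noteq> 0" by (rule fps_mult_nth_nonzero)
    have i3: "i3 = 2 * a - 1" using 3(2) by (simp add: fps_X_power_nth split: if_splits)
    have l: "l = 0 \<or> l = 4 * a - 6" using 3(3) by (auto simp: fps_X_power_nth split: if_splits)
    obtain n where n: "k = 2 * n * a" using suminf_fps_X_power_nth[OF A 2(3)] .
    obtain m where m: "j = (4 * a - 4) * m" using suminf_fps_X_power_nth[OF B 1(3)] .
    from l show thesis
    proof
      assume "l = 0"
      with 1 2 3 i3 n m show thesis by (intro that(1)[of n m]) simp
    next
      assume "l = 4 * a - 6"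
      with 1 2 3 i3 n m show thesis by (intro that(2)[of n m]) simp
    qed
  next
    assume "fps_nth (fps_X ^ (4 * a - 5) * ?B) d \<noteq> 0"
    then obtain i j where 1: "d = i + j" "fps_nth (fps_X ^ (4 * a - 5) :: int fps) i \<noteq> 0" "fps_nth ?B j \<noteq> 0"
      by (rule fps_mult_nth_nonzero)
    have i: "i = 4 * a - 5" using 1(2) by (simp add: fps_X_power_nth split: if_splits)
    obtain n where n: "j = (4 * a - 4) * n" using suminf_fps_X_power_nth[OF B 1(3)] .
    then show thesis using 1 i by (intro that(3)[of n]) simp
  qed
qed

lemma dihedral_cyclic_series_nth:
  assumes "l \<ge> 1" "fps_nth (dihedral_cyclic_series l) d \<noteq> 0"
  obtains n where "d = 2 * l * (n + 1) - 1"
proof -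
  have "n \<le> 2 * l * (n + 1) - 1" for n
  proof -
    have "1 * (n + 1) \<le> 2 * l * (n + 1)" using assms(1) by (intro mult_le_mono1) simp
    then show ?thesis by (intro add_le_imp_le_diff) simp
  qed
  from suminf_fps_X_power_nth[OF this assms(2)[unfolded dihedral_cyclic_series_def]]
  show thesis using that .
qed


section \<open>The group \<open>PSL\<^sub>2\<close>\<close>

lemma group_SL2: "group (SL2 :: ('a::field^2^2) monoid)"
proof (rule groupI)
  fix A :: "'a^2^2" assume "A \<in> carrier SL2"
  then have A: "det A = 1" by (simp add: SL2_def)
  then obtain B where B: "A ** B = mat 1" "B ** A = mat 1"
    using invertible_det_nz[of A] by (auto simp: invertible_def)
  have "det B = 1" using det_mul[of A B] A B by simp
  with B show "\<exists>B\<in>carrier SL2. B \<otimes>\<^bsub>SL2\<^esub> A = \<one>\<^bsub>SL2\<^esub>" by (auto simp: SL2_def)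
qed (auto simp: SL2_def det_mul matrix_mul_assoc)

lemma uminus_carrier_SL2: "A \<in> carrier SL2 \<Longrightarrow> - A \<in> carrier SL2"
  by (simp add: SL2_def det_uminus_2)

lemma normal_scalars: "{mat 1, - mat 1} \<lhd> (SL2 :: ('a::field^2^2) monoid)"
proof -
  interpret group "SL2 :: ('a^2^2) monoid" by (rule group_SL2)
  have mem: "mat 1 \<in> carrier SL2" "- mat 1 \<in> carrier (SL2 :: ('a^2^2) monoid)"
    by (simp_all add: SL2_def det_uminus_2)
  have mult: "A \<otimes>\<^bsub>SL2\<^esub> B = A ** B" "\<one>\<^bsub>SL2\<^esub> = mat 1" for A B :: "'a^2^2"
    by (simp_all add: SL2_def)
  have "inv\<^bsub>SL2\<^esub> (- mat 1 :: 'a^2^2) = - mat 1"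
    by (rule inv_equality) (simp_all add: mem mult minus_mat_mult)
  moreover have "inv\<^bsub>SL2\<^esub> (mat 1 :: 'a^2^2) = mat 1"
    by (rule inv_equality) (simp_all add: mem mult)
  ultimately have "subgroup {mat 1, - mat 1} (SL2 :: ('a^2^2) monoid)"
    by (intro subgroupI) (auto simp: mem mult minus_mat_mult)
  moreover have "A \<otimes>\<^bsub>SL2\<^esub> B \<otimes>\<^bsub>SL2\<^esub> inv\<^bsub>SL2\<^esub> A \<in> {mat 1, - mat 1}"
    if A: "A \<in> carrier SL2" and B: "B \<in> {mat 1, - mat 1}" for A B :: "'a^2^2"
  proof -
    have "A ** inv\<^bsub>SL2\<^esub> A = mat 1" using r_inv[OF A] by (simp add: mult)
    with B show ?thesis by (auto simp: mult minus_mat_mult)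
  qed
  ultimately show ?thesis using normal_inv_iff by blast
qed

lemma group_PSL2: "group (PSL2 :: ('a::field^2^2) set monoid)"
  unfolding PSL2_def by (rule normal.factorgroup_is_group[OF normal_scalars])

lemma nu_mult: "nu A \<otimes>\<^bsub>PSL2\<^esub> nu B = nu (A ** B)" for A B :: "'a::field^2^2"
  by (auto simp: PSL2_def nu_eq set_mult_def SL2_def minus_mat_mult)

lemma one_PSL2: "\<one>\<^bsub>PSL2\<^esub> = nu (mat 1)"
  by (simp add: PSL2_def nu_eq)

lemma carrier_PSL2: "carrier PSL2 = nu ` carrier SL2"
  by (simp add: PSL2_def carrier_FactGroup nu_def[abs_def])

lemma nu_eq_iff: "nu A = nu B \<longleftrightarrow> A = B \<or> A = - B" for A B :: "'a::field^2^2"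
  by (auto simp: nu_eq doubleton_eq_iff)

lemma G_subset_nu:
  assumes "subgroup G PSL2"
  shows "G \<subseteq> nu ` binary_group G"
  using subgroup.subset[OF assms] by (auto simp: carrier_PSL2 binary_group_def)

lemma mem_nu: "A \<in> nu A" for A :: "'a::field^2^2"
  by (simp add: nu_eq)

section \<open>The binary group as a finite subgroup of SL2 of twice the order\<close>

lemma binary_group_eq_Union:
  fixes G :: "('a::field^2^2) set set"
  assumes "subgroup G PSL2"
  shows "binary_group G = \<Union>G"
proof
  show "binary_group G \<subseteq> \<Union>G" using mem_nu by (fastforce simp: binary_group_def)
  show "\<Union>G \<subseteq> binary_group G"
  proof
    fix A assume "A \<in> \<Union>G"
    then obtain g where g: "g \<in> G" "A \<in> g" by blast
    then obtain B where B: "B \<in> carrier SL2" "g = nu B" "nu B \<in> G"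
      using G_subset_nu[OF assms] by (auto simp: binary_group_def)
    then have "A = B \<or> A = - B" using g by (auto simp: nu_eq)
    then have "nu A = nu B" "A \<in> carrier SL2" using B uminus_carrier_SL2 by (auto simp: nu_eq_iff)
    with B show "A \<in> binary_group G" by (simp add: binary_group_def)
  qed
qed

lemma finite_binary_group:
  fixes G :: "('a::field^2^2) set set"
  assumes "subgroup G PSL2" "finite G"
  shows "finite (binary_group G)"
  unfolding binary_group_eq_Union[OF assms(1)] using assms G_subset_nu[OF assms(1)]
  by (auto intro!: finite_Union simp: nu_eq)

text \<open>Each element of PSL2 is a coset of exactly two matrices: in characteristic zero
  \<open>A = - A\<close> would force the zero matrix.\<close>

lemma card_binary_group:
  fixes G :: "('a::field_char_0^2^2) set set"
  assumes "subgroup G PSL2" "finite G"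
  shows "card (binary_group G) = 2 * card G"
proof -
  have G: "\<exists>A. g = nu A" if "g \<in> G" for g using that G_subset_nu[OF assms(1)] by auto
  have "A \<noteq> - A" if nuA: "nu A \<in> G" for A :: "'a^2^2"
  proof
    assume "A = - A"
    obtain B where B: "B \<in> carrier SL2" "nu A = nu B" using G_subset_nu[OF assms(1)] nuA unfolding binary_group_def by blast
    then have "A = B \<or> A = - B" by (simp add: nu_eq_iff)
    then have "A \<in> carrier SL2" using B uminus_carrier_SL2 by auto
    moreover have "A = 0" using \<open>A = - A\<close> by (simp add: matrix2_eq_iff)
    ultimately show False by (simp add: SL2_def det_2)
  qed
  then have two: "card g = 2" if "g \<in> G" for g
    using G[OF that] that by (auto simp: nu_eq)
  have "pairwise disjnt G"
  proof (rule pairwiseI)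
    fix g h assume gh: "g \<in> G" "h \<in> G" "g \<noteq> h"
    obtain A B where "g = nu A" "h = nu B" using G gh by blast
    with gh show "disjnt g h" by (auto simp: disjnt_def nu_eq)
  qed
  then have "card (\<Union>G) = sum card G"
    using two by (intro card_Union_disjoint) (auto intro: card_ge_0_finite)
  then show ?thesis using two by (simp add: binary_group_eq_Union[OF assms(1)])
qed

lemma finite_SL2_binary_group:
  fixes G :: "('a::{alg_closed_field, field_char_0}^2^2) set set"
  assumes G: "subgroup G PSL2" "finite G"
  shows "finite_SL2 (binary_group G)"
proof
  interpret PSL2: group "PSL2 :: ('a^2^2) set monoid" by (rule group_PSL2)
  interpret SL2: group "SL2 :: ('a^2^2) monoid" by (rule group_SL2)
  show "finite (binary_group G)" using finite_binary_group[OF G] .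
  show "det A = 1" if "A \<in> binary_group G" for A using that by (simp add: binary_group_def SL2_def)
  show "mat 1 \<in> binary_group G"
    using subgroup.one_closed[OF G(1)] by (simp add: binary_group_def SL2_def one_PSL2)
  show "- A \<in> binary_group G" if "A \<in> binary_group G" for A
  proof -
    have "nu (- A) = nu A" by (simp add: nu_eq_iff)
    then show ?thesis using that by (simp add: binary_group_def uminus_carrier_SL2)
  qed
  show "A ** B \<in> binary_group G" if "A \<in> binary_group G" "B \<in> binary_group G" for A B
    using that subgroup.m_closed[OF G(1), of "nu A" "nu B"]
    by (simp add: binary_group_def nu_mult) (simp add: SL2_def det_mul)
  show "\<exists>B\<in>binary_group G. B ** A = mat 1" if A: "A \<in> binary_group G" for A
  proof -
    have A': "A \<in> carrier SL2" "nu A \<in> G" using A by (auto simp: binary_group_def)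
    define B where "B = inv\<^bsub>SL2\<^esub> A"
    have B: "B \<in> carrier SL2" "B ** A = mat 1"
      using SL2.inv_closed[OF A'(1)] SL2.l_inv[OF A'(1)] by (simp_all add: B_def) (simp add: SL2_def)
    have "nu B \<otimes>\<^bsub>PSL2\<^esub> nu A = \<one>\<^bsub>PSL2\<^esub>" by (simp add: nu_mult B one_PSL2)
    then have "inv\<^bsub>PSL2\<^esub> (nu A) = nu B"
      using A' B(1) by (intro PSL2.inv_equality) (auto simp: carrier_PSL2)
    then have "nu B \<in> G" using subgroup.m_inv_closed[OF G(1) A'(2)] by simp
    with B show ?thesis by (auto simp: binary_group_def)
  qed
qed

section \<open>Rotation groups of the regular polyhedra\<close>

text \<open>An orthogonal matrix is injective, so it permutes a finite set of vertices once it maps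
  this set into itself; linear maps commute with convex hulls.\<close>

lemma rotation_groupI:
  assumes "rotation_matrix A" "finite V" "(\<lambda>v. A *v v) ` V \<subseteq> V"
  shows "A \<in> carrier (rotation_group (convex hull V))"
proof -
  have "inj (\<lambda>v. A *v v)"
  proof (rule injI)
    fix v w assume "A *v v = A *v w"
    then have "transpose A *v (A *v v) = transpose A *v (A *v w)" by simp
    then show "v = w"
      using assms(1) by (simp add: matrix_vector_mul_assoc rotation_matrix_def orthogonal_matrix_def)
  qed
  then have "(\<lambda>v. A *v v) ` V = V"
    using assms by (intro endo_inj_surj) (auto intro: inj_on_subset)
  then have "(\<lambda>v. A *v v) ` (convex hull V) = convex hull V"
    by (simp add: convex_hull_linear_image matrix_vector_mul_linear)
  with assms show ?thesis by (simp add: rotation_group_def)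
qed

lemma rotation_group_mult_closed:
  assumes "A \<in> carrier (rotation_group P)" "B \<in> carrier (rotation_group P)"
  shows "A ** B \<in> carrier (rotation_group P)"
proof -
  have "(\<lambda>v. (A ** B) *v v) ` P = (\<lambda>v. A *v v) ` (\<lambda>v. B *v v) ` P"
    by (simp only: image_image matrix_vector_mul_assoc)
  also have "\<dots> = P" using assms by (simp add: rotation_group_def)
  finally show ?thesis
    using assms by (simp add: rotation_group_def rotation_matrix_def orthogonal_matrix_mul det_mul)
qed

lemma rotation_group_one_closed: "mat 1 \<in> carrier (rotation_group P)"
  by (simp add: rotation_group_def rotation_matrix_def orthogonal_matrix_def transpose_mat)

text \<open>For \<open>s\<close> equal to 1 or -1 these are rotations of order three about two
  different diagonals of the cube. In the given coordinates they preserve all three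
  polyhedra.\<close>

definition cyclic_rotation :: "real \<Rightarrow> real^3^3" where
  "cyclic_rotation s = vector [vector [0, s, 0], vector [0, 0, s], vector [1, 0, 0]]"

text \<open>The quarter turn about the third axis.\<close>

definition octa_rotation :: "real^3^3" where
  "octa_rotation = vector [vector [0, -1, 0], vector [1, 0, 0], vector [0, 0, 1]]"

text \<open>For the golden ratio \<open>g\<close> this is the rotation by 2 pi / 5 about the vertex
  (0, 1, g): the trace is g = 1 + 2 cos(2 pi / 5).\<close>

definition icosa_rotation :: "real \<Rightarrow> real^3^3" where
  "icosa_rotation g = vector [vector [(g - 1) / 2, - g / 2, 1 / 2], vector [g / 2, 1 / 2, (g - 1) / 2],
     vector [- 1 / 2, (g - 1) / 2, g / 2]]"

lemmas matrix3_simps = vec_eq_iff forall_3 matrix_matrix_mult_def matrix_vector_mult_def sum_3 mat_def transpose_def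

lemma rotation_matrix_cyclic_rotation: "s \<in> {1, - 1} \<Longrightarrow> rotation_matrix (cyclic_rotation s)"
  by (auto simp: rotation_matrix_def orthogonal_matrix cyclic_rotation_def det_3 matrix3_simps)

lemma cyclic_rotation_vector: "cyclic_rotation s *v vector [a, b, c] = vector [s * b, s * c, a]"
  by (simp add: cyclic_rotation_def matrix3_simps)

lemma cyclic_rotation_cube:
  "s \<in> {1, - 1} \<Longrightarrow> cyclic_rotation s ** cyclic_rotation s ** cyclic_rotation s = mat 1"
  by (auto simp: cyclic_rotation_def matrix3_simps)

lemma cyclic_rotation_noncommute:
  "cyclic_rotation 1 ** cyclic_rotation (- 1) \<noteq> cyclic_rotation (- 1) ** cyclic_rotation 1"
  by (simp add: cyclic_rotation_def matrix3_simps)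

lemma cyclic_rotation_tetrahedron: "s \<in> {1, - 1} \<Longrightarrow> cyclic_rotation s \<in> carrier (rotation_group tetrahedron)"
  unfolding tetrahedron_def
  by (intro rotation_groupI rotation_matrix_cyclic_rotation) (auto simp: cyclic_rotation_vector)

lemma cyclic_rotation_octahedron: "s \<in> {1, - 1} \<Longrightarrow> cyclic_rotation s \<in> carrier (rotation_group octahedron)"
  unfolding octahedron_def
  by (intro rotation_groupI rotation_matrix_cyclic_rotation) (auto simp: cyclic_rotation_vector)

lemma cyclic_rotation_icosahedron: "s \<in> {1, - 1} \<Longrightarrow> cyclic_rotation s \<in> carrier (rotation_group icosahedron)"
proof -
  assume s: "s \<in> {1, - 1}"
  define g :: real where "g = (1 + sqrt 5) / 2"
  show "cyclic_rotation s \<in> carrier (rotation_group icosahedron)"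
    unfolding icosahedron_def Let_def g_def[symmetric]
    using s by (intro rotation_groupI rotation_matrix_cyclic_rotation) (auto simp: cyclic_rotation_vector)
qed

lemma octa_rotation:
  "octa_rotation \<in> carrier (rotation_group octahedron)"
  "octa_rotation ** octa_rotation ** octa_rotation ** octa_rotation = mat 1"
  "octa_rotation ** octa_rotation \<noteq> mat 1"
proof -
  have "octa_rotation *v vector [a, b, c] = vector [- b, a, c]" for a b c
    by (simp add: octa_rotation_def matrix3_simps)
  moreover have "rotation_matrix octa_rotation"
    by (simp add: rotation_matrix_def orthogonal_matrix octa_rotation_def det_3 matrix3_simps)
  ultimately show "octa_rotation \<in> carrier (rotation_group octahedron)"
    unfolding octahedron_def by (intro rotation_groupI) auto
qed (simp_all add: octa_rotation_def matrix3_simps)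

lemma icosa_rotation:
  fixes g :: real
  defines "g \<equiv> (1 + sqrt 5) / 2"
  shows "icosa_rotation g \<in> carrier (rotation_group icosahedron)"
    "icosa_rotation g ** icosa_rotation g ** icosa_rotation g ** icosa_rotation g ** icosa_rotation g = mat 1"
    "icosa_rotation g \<noteq> mat 1"
proof -
  have gg: "g * g = g + 1" by (simp add: g_def field_simps)
  \<comment> \<open>With \<open>gg\<close> this reduces polynomials in \<open>g\<close> modulo g^2 =
    g + 1, also inside right-nested products.\<close>
  then have gg': "g * (g * x) = g * x + x" for x by (metis distrib_right mult.assoc mult_1)
  have rot: "rotation_matrix (icosa_rotation g)"
    by (simp add: rotation_matrix_def orthogonal_matrix icosa_rotation_def det_3 matrix3_simps)
      (simp add: field_simps gg gg')
  have vertices: 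
    "icosa_rotation g *v vector [0, 1, g] = vector [0, 1, g]"
    "icosa_rotation g *v vector [1, g, 0] = vector [- 1, g, 0]"
    "icosa_rotation g *v vector [g, 0, 1] = vector [1, g, 0]"
    "icosa_rotation g *v vector [0, 1, - g] = vector [- g, 0, - 1]"
    "icosa_rotation g *v vector [1, - g, 0] = vector [g, 0, - 1]"
    "icosa_rotation g *v vector [- g, 0, 1] = vector [0, - 1, g]"
    "icosa_rotation g *v vector [0, - 1, g] = vector [g, 0, 1]"
    "icosa_rotation g *v vector [- 1, g, 0] = vector [- g, 0, 1]"
    "icosa_rotation g *v vector [g, 0, - 1] = vector [0, 1, - g]"
    "icosa_rotation g *v vector [0, - 1, - g] = vector [0, - 1, - g]"
    "icosa_rotation g *v vector [- 1, - g, 0] = vector [1, - g, 0]"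
    "icosa_rotation g *v vector [- g, 0, - 1] = vector [- 1, - g, 0]"
    by (simp_all add: icosa_rotation_def matrix3_simps; simp add: field_simps gg)+
  show "icosa_rotation g \<in> carrier (rotation_group icosahedron)"
    unfolding icosahedron_def Let_def g_def[symmetric]
    by (intro rotation_groupI rot) (auto simp: vertices)
  show "icosa_rotation g ** icosa_rotation g ** icosa_rotation g ** icosa_rotation g ** icosa_rotation g = mat 1"
    by (simp add: icosa_rotation_def matrix3_simps) (simp add: field_simps gg gg')
  show "icosa_rotation g \<noteq> mat 1" by (simp add: icosa_rotation_def matrix3_simps)
qed

text \<open>
  A rotation is determined by the images of two vertices.  That vertices go to vertices follows from
  the norm \<open>\<surd>3\<close>, the enclosing cube and the face inequalities \<open>v \<bullet> x \<ge> -1\<close>, \<open>v\<close> a vertex.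
\<close>

lemma card_rotation_group_tetrahedron: "card (carrier (rotation_group tetrahedron)) \<le> 12"
proof -
  let ?v = "\<lambda>a b c. vector [a, b, c] :: real^3"
  let ?V = "{?v 1 1 1, ?v 1 (-1) (-1), ?v (-1) 1 (-1), ?v (-1) (-1) 1}"
  let ?C = "carrier (rotation_group tetrahedron)"
  let ?f = "\<lambda>A :: real^3^3. (A *v ?v 1 1 1, A *v ?v 1 (-1) (-1))"
  let ?Q = "{x. \<bar>x $ 1\<bar> \<le> 1 \<and> \<bar>x $ 2\<bar> \<le> 1 \<and> \<bar>x $ 3\<bar> \<le> 1 \<and> x $ 1 + x $ 2 + x $ 3 \<ge> -1 \<and>
    x $ 1 - x $ 2 - x $ 3 \<ge> -1 \<and> x $ 2 - x $ 1 - x $ 3 \<ge> -1 \<and> x $ 3 - x $ 1 - x $ 2 \<ge> -1} :: (real^3) set"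
  have "convex ?Q"
    unfolding convex_alt
  proof (intro ballI allI impI)
    fix x y :: "real^3" and u :: real assume x: "x \<in> ?Q" and y: "y \<in> ?Q" and u: "0 \<le> u \<and> u \<le> 1"
    have comb: "(1 - u) * a + u * b \<le> c" if "a \<le> c" "b \<le> c" for a b c :: real
      using convex_bound_le[of a c b "1 - u" u] that u by simp
    show "(1 - u) *\<^sub>R x + u *\<^sub>R y \<in> ?Q"
      using x y comb[of "x $ 1" 1 "y $ 1"] comb[of "- x $ 1" 1 "- y $ 1"]
        comb[of "x $ 2" 1 "y $ 2"] comb[of "- x $ 2" 1 "- y $ 2"]
        comb[of "x $ 3" 1 "y $ 3"] comb[of "- x $ 3" 1 "- y $ 3"]
        comb[of "- x $ 1 - x $ 2 - x $ 3" 1 "- y $ 1 - y $ 2 - y $ 3"]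
        comb[of "- x $ 1 + x $ 2 + x $ 3" 1 "- y $ 1 + y $ 2 + y $ 3"]
        comb[of "x $ 1 - x $ 2 + x $ 3" 1 "y $ 1 - y $ 2 + y $ 3"]
        comb[of "x $ 1 + x $ 2 - x $ 3" 1 "y $ 1 + y $ 2 - y $ 3"]
      by (simp add: abs_le_iff algebra_simps)
  qed
  moreover have "?V \<subseteq> ?Q" by auto
  ultimately have hull: "tetrahedron \<subseteq> ?Q"
    unfolding tetrahedron_def by (rule hull_minimal[rotated])
  have vertex: "A *v w \<in> ?V" if A: "A \<in> ?C" and w: "w \<in> ?V" for A w
  proof -
    let ?x = "A *v w"
    have "w \<in> tetrahedron" unfolding tetrahedron_def using w by (rule hull_inc)
    then have "?x \<in> tetrahedron" using A by (auto simp: rotation_group_def)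
    then have x: "?x \<in> ?Q" using hull by blast
    have "orthogonal_transformation (\<lambda>v. A *v v)"
      using A by (simp add: rotation_group_def rotation_matrix_def orthogonal_transformation_matrix
        matrix_vector_mul_linear matrix_of_matrix_vector_mul)
    then have "?x \<bullet> ?x = w \<bullet> w" by (simp add: orthogonal_transformation_def)
    also have "w \<bullet> w = 3" using w by (auto simp: inner_vec_def sum_3)
    finally have norm: "?x $ 1 * ?x $ 1 + ?x $ 2 * ?x $ 2 + ?x $ 3 * ?x $ 3 = 3" by (simp add: inner_vec_def sum_3)
    have sq: "?x $ i * ?x $ i \<le> 1" if "\<bar>?x $ i\<bar> \<le> 1" for i
      using that abs_square_le_1[of "?x $ i"] by (simp add: power2_eq_square)
    have "?x $ 1 * ?x $ 1 \<le> 1" "?x $ 2 * ?x $ 2 \<le> 1" "?x $ 3 * ?x $ 3 \<le> 1"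
      by (rule sq; use x in simp)+
    with norm have "?x $ 1 * ?x $ 1 = 1" "?x $ 2 * ?x $ 2 = 1" "?x $ 3 * ?x $ 3 = 1"
      by linarith+
    then have "?x $ 1 = 1 \<or> ?x $ 1 = -1" "?x $ 2 = 1 \<or> ?x $ 2 = -1" "?x $ 3 = 1 \<or> ?x $ 3 = -1"
      using square_eq_1_iff by blast+
    with x show ?thesis by (auto simp: vec_eq_iff forall_3)
  qed
  have inj: "inj_on ?f ?C"
  proof (rule inj_onI)
    fix A B assume A: "A \<in> ?C" and B: "B \<in> ?C" and eq: "?f A = ?f B"
    \<comment> \<open>Rotations commute with the cross product, so \<open>A\<close> and
      \<open>B\<close> also agree on a third vector independent of the two vertices.\<close>
    have "A *v cross3 (?v 1 1 1) (?v 1 (-1) (-1)) = B *v cross3 (?v 1 1 1) (?v 1 (-1) (-1))"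
      using A B eq by (simp add: rotation_group_def flip: cross_rotation_matrix)
    moreover have "cross3 (?v 1 1 1) (?v 1 (-1) (-1)) = ?v 0 2 (-2)" by (simp add: cross3_def)
    ultimately show "A = B" using eq
      by (simp add: matrix3_simps)
  qed
  have card_V: "card ?V = 4" by (simp add: vec_eq_iff forall_3)
  \<comment> \<open>Two vertices go to an ordered pair of distinct vertices, and there are 4 * 4 - 4
    = 12 of those.\<close>
  have "?f ` ?C \<subseteq> ?V \<times> ?V - (\<lambda>v. (v, v)) ` ?V"
  proof clarify
    fix A assume A: "A \<in> ?C"
    have "A *v ?v 1 1 1 \<noteq> A *v ?v 1 (-1) (-1)"
    proof
      assume "A *v ?v 1 1 1 = A *v ?v 1 (-1) (-1)"
      then have "transpose A *v (A *v ?v 1 1 1) = transpose A *v (A *v ?v 1 (-1) (-1))" by simp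
      then have "?v 1 1 1 = ?v 1 (-1) (-1)"
        using A by (simp add: matrix_vector_mul_assoc rotation_group_def rotation_matrix_def orthogonal_matrix_def)
      then show False by (simp add: vec_eq_iff forall_3)
    qed
    moreover have "A *v ?v 1 1 1 \<in> ?V" "A *v ?v 1 (-1) (-1) \<in> ?V"
      by (intro vertex[OF A]; simp)+
    moreover have "(a, b) \<in> V \<times> V - (\<lambda>v. (v, v)) ` V" if "a \<noteq> b" "a \<in> V" "b \<in> V"
      for a b :: "real^3" and V
      using that by blast
    ultimately show "?f A \<in> ?V \<times> ?V - (\<lambda>v. (v, v)) ` ?V" by presburger
  qed
  then have "card (?f ` ?C) \<le> card (?V \<times> ?V - (\<lambda>v. (v, v)) ` ?V)"
    by (intro card_mono) auto
  also have "\<dots> = card (?V \<times> ?V) - card ((\<lambda>v. (v, v)) ` ?V)"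
    by (intro card_Diff_subset) auto
  also have "card ((\<lambda>v. (v, v)) ` ?V) = card ?V" by (intro card_image) (simp add: inj_on_def)
  also have "card (?V \<times> ?V) = card ?V * card ?V" by (rule card_cartesian_product)
  finally show ?thesis using card_image[OF inj] card_V by simp
qed

section \<open>Recognizing the type of the group\<close>

lemma nu_mult_cong: "nu A = nu B \<Longrightarrow> nu (A ** C) = nu (B ** C)" for A B C :: "'a::field^2^2"
  by (auto simp: nu_eq_iff minus_mat_mult)

context finite_SL2
begin

text \<open>It translates orders in PSL2 into orders of squared eigenvalues.\<close>

lemma eigenvalue_square_eq_1_iff:
  assumes "A \<in> stab x"
  shows "eigenvalue A x ^ 2 = 1 \<longleftrightarrow> nu A = nu (mat 1)"
proof
  assume "nu A = nu (mat 1)"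
  then show "eigenvalue A x ^ 2 = 1"
    by (auto simp: nu_eq_iff eigenvalue_one eigenvalue_uminus_one)
next
  assume "eigenvalue A x ^ 2 = 1"
  then have "eigenvalue A x = eigenvalue (mat 1) x \<or> eigenvalue A x = eigenvalue (- mat 1) x"
    by (simp add: eigenvalue_one eigenvalue_uminus_one power2_eq_1_iff)
  then have "A = mat 1 \<or> A = - mat 1"
    using inj_on_eigenvalue[of x] assms uminus_mem_stab[OF one_mem_stab] one_mem_stab by (auto dest: inj_onD)
  then show "nu A = nu (mat 1)" by (simp add: nu_eq_iff)
qed

lemma klein_eigenvalue:
  assumes "klein_type a b c x y z" "card \<Gamma> > 2" "A \<in> \<Gamma>"
  obtains w e where "A \<in> stab w" "e \<in> {a, b, c}" "eigenvalue A w ^ (2 * e) = 1"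
proof -
  obtain w where w: "w \<in> special" "A \<in> stab w" using fixes_special[OF assms(2,3)] .
  obtain u where "u \<in> {x, y, z}" "card (stab w) = card (stab u)"
    using klein_type_cases[OF assms(1) w(1) invariant_set_orb] by metis
  then have "\<exists>e\<in>{a, b, c}. card (stab w) = 2 * e" using assms(1) by (auto simp: klein_type_def)
  with eigenvalue_power_card[OF w(2)] show thesis using that[OF w(2)] by metis
qed

text \<open>The squared eigenvalue has order exactly 4 and is killed by the exponent
  \<open>e\<close>, so 4 divides \<open>e\<close>; among 2, 3 and the possible \<open>c\<close> only
  \<open>c = 4\<close> is left.\<close>

lemma klein_type_order_4:
  assumes t: "klein_type 2 3 c x y z" "c \<in> {3, 4, 5}" "card \<Gamma> > 2" "A \<in> \<Gamma>"
    and A: "nu (A ** A ** A ** A) = nu (mat 1)" "nu (A ** A) \<noteq> nu (mat 1)"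
  shows "c = 4"
proof -
  obtain w e where w: "A \<in> stab w" "e \<in> {2, 3, c}" "eigenvalue A w ^ (2 * e) = 1"
    using klein_eigenvalue[OF t(1,3,4)] .
  let ?z = "eigenvalue A w"
  have pow: "?z ^ 4 = ?z ^ 2 * ?z ^ 2" "?z ^ 8 = ?z ^ 4 * ?z ^ 4" "?z ^ 8 = ?z ^ 6 * ?z ^ 2"
    "?z ^ 10 = ?z ^ 8 * ?z ^ 2" "?z ^ 12 = ?z ^ 6 * ?z ^ 6" "?z ^ 12 = ?z ^ 10 * ?z ^ 2"
    by (simp_all flip: power_add)
  have "eigenvalue (A ** A ** A ** A) w ^ 2 = 1"
    using A(1) w(1) by (simp add: eigenvalue_square_eq_1_iff stab_mult)
  then have z8: "?z ^ 8 = 1" using w(1) by (simp add: eigenvalue_mult stab_mult power2_eq_square eval_nat_numeral mult.assoc)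
  have "eigenvalue (A ** A) w ^ 2 \<noteq> 1"
    using A(2) w(1) by (simp add: eigenvalue_square_eq_1_iff stab_mult)
  then have z4: "?z ^ 4 \<noteq> 1" using w(1) by (simp add: eigenvalue_mult power2_eq_square eval_nat_numeral mult.assoc)
  then have z2: "?z ^ 2 \<noteq> 1" using pow(1) by (metis mult_1)
  have "e \<noteq> 2" using z4 w(3) by auto
  moreover have "e \<noteq> 3" using z2 z8 w(3) pow(3) by (auto simp del: power_add_numeral power_add_numeral2)
  moreover have "e \<noteq> 5" using z2 z8 w(3) pow(4) by (auto simp del: power_add_numeral power_add_numeral2)
  ultimately show ?thesis using w(2) t(2) by auto
qed

text \<open>As 5 is prime, a nontrivial squared eigenvalue killed by 5 has order 5, which must
  divide \<open>e\<close>.\<close>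

lemma klein_type_order_5:
  assumes t: "klein_type 2 3 c x y z" "c \<in> {3, 4, 5}" "card \<Gamma> > 2" "A \<in> \<Gamma>"
    and A: "nu (A ** A ** A ** A ** A) = nu (mat 1)" "nu A \<noteq> nu (mat 1)"
  shows "c = 5"
proof -
  obtain w e where w: "A \<in> stab w" "e \<in> {2, 3, c}" "eigenvalue A w ^ (2 * e) = 1"
    using klein_eigenvalue[OF t(1,3,4)] .
  let ?z = "eigenvalue A w"
  have pow: "?z ^ 4 = ?z ^ 2 * ?z ^ 2" "?z ^ 8 = ?z ^ 4 * ?z ^ 4" "?z ^ 8 = ?z ^ 6 * ?z ^ 2"
    "?z ^ 10 = ?z ^ 8 * ?z ^ 2" "?z ^ 12 = ?z ^ 6 * ?z ^ 6" "?z ^ 12 = ?z ^ 10 * ?z ^ 2"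
    by (simp_all flip: power_add)
  have "eigenvalue (A ** A ** A ** A ** A) w ^ 2 = 1"
    using A(1) w(1) by (simp add: eigenvalue_square_eq_1_iff stab_mult)
  then have z10: "?z ^ 10 = 1" using w(1) by (simp add: eigenvalue_mult stab_mult power2_eq_square eval_nat_numeral mult.assoc)
  have z2: "?z ^ 2 \<noteq> 1"
    using A(2) w(1) by (simp add: eigenvalue_square_eq_1_iff)
  have z8: "?z ^ 8 \<noteq> 1" using z2 z10 pow(4) by (metis mult_1)
  have "e \<noteq> 2" using z8 w(3) pow(2) by (auto simp del: power_add_numeral power_add_numeral2)
  moreover have "e \<noteq> 3" using z2 z10 w(3) pow(5,6) by (auto simp del: power_add_numeral power_add_numeral2)
  moreover have "e \<noteq> 4" using z8 w(3) by auto
  ultimately show ?thesis using w(2) t(2) by auto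
qed

lemma pact_cube:
  assumes "A \<in> \<Gamma>" "nu (A ** A ** A) = nu (mat 1)"
  shows "pact A (pact A (pact A x)) = x"
proof -
  have "A ** A ** A = mat 1 \<or> A ** A ** A = - mat 1" using assms by (simp add: nu_eq_iff)
  then have "pact (A ** A ** A) x = x" using pact_uminus[OF one_mem] by auto
  then show ?thesis using assms(1) by (simp add: pact_mult_mem mult_mem)
qed

text \<open>
  The other types have an abelian subgroup of index at most two, which contains all elements of
  order three.
\<close>

lemma polyhedral_type:
  assumes N: "card \<Gamma> = 2 * N" "N \<ge> 2"
    and A: "A \<in> \<Gamma>" "nu (A ** A ** A) = nu (mat 1)" and B: "B \<in> \<Gamma>" "nu (B ** B ** B) = nu (mat 1)"
    and AB: "A ** B \<noteq> B ** A"
  obtains c x y z where "klein_type 2 3 c x y z" "c \<in> {3, 4, 5}" "(c, N) \<in> {(3, 12), (4, 24), (5, 60)}"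
proof -
  have "\<not> stab x = \<Gamma>" for x using stab_commute[of A x B] A B AB by auto
  moreover have False if t: "klein_type 2 2 c x y z" "N = 2 * c" for c x y z
  proof -
    have "card (orb z) * c = N" using klein_type_card[OF t(1) N(1)] by simp
    then have "card (orb z) = 2" using t N by simp
    \<comment> \<open>An element whose cube is trivial cannot swap the two points of this orbit, so
      it lies in the abelian stabilizer of \<open>z\<close>.\<close>
    have mem: "C \<in> stab z" if C: "C \<in> \<Gamma>" "nu (C ** C ** C) = nu (mat 1)" for C
    proof (rule ccontr)
      assume "C \<notin> stab z"
      then have ne: "pact C z \<noteq> z" using C by (simp add: stab_def)
      have "pact C z \<in> orb z" "pact C (pact C z) \<in> orb z"
        using C(1) pact_image_orb[OF C(1), of z] self_mem_orb[of z] by blast+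
      then have "{z, pact C z, pact C (pact C z)} \<subseteq> orb z" by simp
      then have "card {z, pact C z, pact C (pact C z)} \<le> 2"
        using \<open>card (orb z) = 2\<close> by (metis card_mono finite_orb)
      with ne have "pact C (pact C z) = z \<or> pact C (pact C z) = pact C z"
        by (auto simp: card_insert_if split: if_splits)
      with pact_cube[OF C, of z] ne show False by metis
    qed
    show False using stab_commute[OF mem[OF A] mem[OF B]] AB by simp
  qed
  ultimately show thesis using klein_classification[OF N] that by blast
qed

end

text \<open>A rotation group need not lift to SL2 as a group, so the matrices are multiplicative
  only under \<open>nu\<close>; this suffices to transfer orders and noncommutation.\<close>

definition projective_lift :: "(real^3) set \<Rightarrow> ('a::field^2^2) set set \<Rightarrow> (real^3^3 \<Rightarrow> 'a^2^2) \<Rightarrow> bool" where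
  "projective_lift P G \<psi> \<longleftrightarrow> nu (\<psi> (mat 1)) = nu (mat 1) \<and>
     (\<forall>R\<in>carrier (rotation_group P). \<psi> R \<in> binary_group G \<and>
       (\<forall>S\<in>carrier (rotation_group P). nu (\<psi> (R ** S)) = nu (\<psi> R ** \<psi> S) \<and> (nu (\<psi> R) = nu (\<psi> S) \<longrightarrow> R = S)))"

lemma projective_liftD:
  assumes "projective_lift P G \<psi>"
  shows "R \<in> carrier (rotation_group P) \<Longrightarrow> \<psi> R \<in> binary_group G"
    "R \<in> carrier (rotation_group P) \<Longrightarrow> S \<in> carrier (rotation_group P) \<Longrightarrow> nu (\<psi> (R ** S)) = nu (\<psi> R ** \<psi> S)"
    "R \<in> carrier (rotation_group P) \<Longrightarrow> S \<in> carrier (rotation_group P) \<Longrightarrow> nu (\<psi> R) = nu (\<psi> S) \<Longrightarrow> R = S"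
    "nu (\<psi> (mat 1)) = nu (mat 1)"
  using assms by (auto simp: projective_lift_def)

text \<open>It expands \<open>nu\<close> of a long product one factor at a time, the product so far
  being known only up to sign.\<close>

lemma projective_lift_mult:
  assumes "projective_lift P G \<psi>" "R \<in> carrier (rotation_group P)" "S \<in> carrier (rotation_group P)"
    and "nu (\<psi> R) = nu A"
  shows "nu (\<psi> (R ** S)) = nu (A ** \<psi> S)"
  using projective_liftD(2)[OF assms(1-3)] nu_mult_cong[OF assms(4)] by simp

lemma projective_lift_exists:
  fixes G :: "('a::field^2^2) set set"
  assumes G: "subgroup G PSL2" and iso: "PSL2\<lparr>carrier := G\<rparr> \<cong> rotation_group P"
  obtains \<psi> where "projective_lift P G \<psi>"
proof -
  let ?C = "carrier (rotation_group P)"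
  obtain f where f: "f \<in> hom (PSL2\<lparr>carrier := G\<rparr>) (rotation_group P)" "bij_betw f G ?C"
    using iso by (auto simp: is_iso_def iso_def)
  define h where "h = inv_into G f"
  have h: "h R \<in> G" "f (h R) = R" if "R \<in> ?C" for R
    using that f(2) by (auto simp: h_def bij_betw_def inv_into_into f_inv_into_f)
  have "\<exists>A. A \<in> binary_group G \<and> nu A = h R" if "R \<in> ?C" for R
    using h(1)[OF that] G_subset_nu[OF G] by blast
  then obtain \<psi> where \<psi>: "\<And>R. R \<in> ?C \<Longrightarrow> \<psi> R \<in> binary_group G \<and> nu (\<psi> R) = h R" by metis
  have mult: "nu (\<psi> (R ** S)) = nu (\<psi> R ** \<psi> S)" if R: "R \<in> ?C" and S: "S \<in> ?C" for R S
  proof -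
    note RS = rotation_group_mult_closed[OF R S]
    have "f (h R \<otimes>\<^bsub>PSL2\<^esub> h S) = f (h R) ** f (h S)"
      using f(1) h(1)[OF R] h(1)[OF S] by (simp add: hom_def rotation_group_def)
    then have "f (h R \<otimes>\<^bsub>PSL2\<^esub> h S) = f (h (R ** S))" using h(2) R S RS by simp
    moreover have "h R \<otimes>\<^bsub>PSL2\<^esub> h S \<in> G" using h R S subgroup.m_closed[OF G] by blast
    ultimately have "h R \<otimes>\<^bsub>PSL2\<^esub> h S = h (R ** S)"
      using f(2) h(1)[OF RS] by (auto simp: bij_betw_def dest: inj_onD)
    then show ?thesis using \<psi> R S RS nu_mult by metis
  qed
  moreover have "R = S" if "R \<in> ?C" "S \<in> ?C" "nu (\<psi> R) = nu (\<psi> S)" for R S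
    using that \<psi> h by metis
  moreover have "nu (\<psi> (mat 1)) = nu (mat 1)"
  proof -
    let ?A = "\<psi> (mat 1)"
    \<comment> \<open>The image of the identity is idempotent, hence neutral.\<close>
    have "nu (mat 1) \<otimes>\<^bsub>PSL2\<^esub> nu ?A = nu ?A \<otimes>\<^bsub>PSL2\<^esub> nu ?A"
      using mult[OF rotation_group_one_closed rotation_group_one_closed]
      unfolding nu_mult matrix_mul_lid .
    moreover have "nu ?A \<in> carrier PSL2" "nu (mat 1 :: 'a^2^2) \<in> carrier PSL2"
      using \<psi>[OF rotation_group_one_closed] by (auto simp: carrier_PSL2 binary_group_def SL2_def)
    ultimately show ?thesis
      using group.right_cancel[OF group_PSL2] by metis
  qed
  ultimately have "projective_lift P G \<psi>" using \<psi> by (simp add: projective_lift_def)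
  then show thesis by (rule that)
qed

section \<open>The cases of the theorem\<close>

locale finite_PSL2 =
  fixes G :: "('a::{alg_closed_field, field_char_0}^2^2) set set"
  assumes subgroup: "subgroup G PSL2" and finite_G: "finite G" and nontrivial: "G \<noteq> {\<one>\<^bsub>PSL2\<^esub>}"

sublocale finite_PSL2 \<subseteq> finite_SL2 "binary_group G"
  using finite_SL2_binary_group[OF subgroup finite_G] .

context finite_PSL2
begin

lemma card_G: "card (binary_group G) = 2 * card G" "card G \<ge> 2"
proof -
  show "card (binary_group G) = 2 * card G" using card_binary_group[OF subgroup finite_G] .
  have "\<one>\<^bsub>PSL2\<^esub> \<in> G" using subgroup.one_closed[OF subgroup] .
  with nontrivial obtain g where "g \<in> G" "g \<noteq> \<one>\<^bsub>PSL2\<^esub>" by blast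
  with \<open>\<one>\<^bsub>PSL2\<^esub> \<in> G\<close> have "card {g, \<one>\<^bsub>PSL2\<^esub>} \<le> card G" using finite_G by (intro card_mono) auto
  with \<open>g \<noteq> _\<close> show "card G \<ge> 2" by simp
qed

text \<open>If the lifts of the two rotations of order three commuted, so would the rotations, by
  injectivity; \<open>polyhedral_type\<close> therefore applies to the lifts.\<close>

lemma polyhedral_klein_type:
  assumes iso: "PSL2\<lparr>carrier := G\<rparr> \<cong> rotation_group P"
    and P: "\<And>s. s \<in> {1, - 1} \<Longrightarrow> cyclic_rotation s \<in> carrier (rotation_group P)"
  obtains c x y z where "klein_type 2 3 c x y z" "c \<in> {3, 4, 5}" "(c, card G) \<in> {(3, 12), (4, 24), (5, 60)}"
proof -
  obtain \<psi> where "projective_lift P G \<psi>"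
    using projective_lift_exists[OF subgroup iso] .
  note \<psi> = projective_liftD[OF this] and step = projective_lift_mult[OF this]
  let ?C = cyclic_rotation
  have cube: "nu (\<psi> (?C s) ** \<psi> (?C s) ** \<psi> (?C s)) = nu (mat 1)" if s: "s \<in> {1, - 1}" for s
  proof -
    have "nu (\<psi> (?C s ** ?C s ** ?C s)) = nu (\<psi> (?C s) ** \<psi> (?C s) ** \<psi> (?C s))"
      by (intro step rotation_group_mult_closed P[OF s] refl)
    then show ?thesis using cyclic_rotation_cube[OF s] \<psi>(4) by simp
  qed
  have "\<psi> (?C 1) ** \<psi> (?C (- 1)) \<noteq> \<psi> (?C (- 1)) ** \<psi> (?C 1)"
  proof
    assume eq: "\<psi> (?C 1) ** \<psi> (?C (- 1)) = \<psi> (?C (- 1)) ** \<psi> (?C 1)"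
    have C: "?C 1 \<in> carrier (rotation_group P)" "?C (- 1) \<in> carrier (rotation_group P)" using P by auto
    have "nu (\<psi> (?C 1 ** ?C (- 1))) = nu (\<psi> (?C (- 1) ** ?C 1))"
      using \<psi>(2)[OF C] \<psi>(2)[OF C(2,1)] eq by simp
    then have "?C 1 ** ?C (- 1) = ?C (- 1) ** ?C 1"
      using \<psi>(3) rotation_group_mult_closed C by blast
    with cyclic_rotation_noncommute show False by blast
  qed
  then show thesis
    using polyhedral_type[OF card_G(1) card_G(2), of "\<psi> (?C 1)" "\<psi> (?C (- 1))"] cube \<psi>(1) P that by auto
qed

text \<open>The tetrahedral group has no element of order 4 or 5 to single out its solution; instead
  the bound 12 on its order excludes 24 and 60.\<close>

lemma tetrahedral_compression:
  assumes iso: "PSL2\<lparr>carrier := G\<rparr> \<cong> rotation_group tetrahedron"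
    and d: "fps_nth (polyhedral_series 3) d \<noteq> 0"
  shows "has_compression (binary_group G) G d"
proof -
  obtain c x y z where t: "klein_type 2 3 c x y z" "(c, card G) \<in> {(3, 12), (4, 24), (5, 60)}"
    using polyhedral_klein_type[OF iso cyclic_rotation_tetrahedron] by metis
  have "card G \<le> 12"
    using iso_same_card[OF iso] card_rotation_group_tetrahedron by simp
  with t have c: "c = 3" "card (binary_group G) = 24" using card_G(1) by auto
  note comp = compression_tetrahedral[OF t(1)[unfolded c(1)] c(2) G_subset_nu[OF subgroup]]
  have "(3::nat) \<ge> 2" by simp
  from this d show ?thesis
  proof (cases rule: polyhedral_series_nth)
    case (1 n m)
    then show ?thesis using comp(1)[of n m] by (simp add: mult.commute)
  next
    case (2 n m)
    \<comment> \<open>For a = 3 the exponent 4a - 6 equals 2a, so this term only shifts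
      \<open>n\<close> by one.\<close>
    then show ?thesis using comp(1)[of "n + 1" m] by (simp add: algebra_simps)
  next
    case (3 n)
    then show ?thesis using comp(2)[of n] by simp
  qed
qed

lemma octahedral_compression:
  assumes iso: "PSL2\<lparr>carrier := G\<rparr> \<cong> rotation_group octahedron"
    and d: "fps_nth (polyhedral_series 4) d \<noteq> 0"
  shows "has_compression (binary_group G) G d"
proof -
  obtain c x y z where t: "klein_type 2 3 c x y z" "c \<in> {3, 4, 5}" "(c, card G) \<in> {(3, 12), (4, 24), (5, 60)}"
    using polyhedral_klein_type[OF iso cyclic_rotation_octahedron] by metis
  obtain \<psi> where "projective_lift octahedron G \<psi>"
    using projective_lift_exists[OF subgroup iso] .
  note \<psi> = projective_liftD[OF this] and step = projective_lift_mult[OF this]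
  let ?R = octa_rotation
  let ?A = "\<psi> ?R"
  note R = octa_rotation
  have R2: "nu (\<psi> (?R ** ?R)) = nu (?A ** ?A)" using \<psi>(2)[OF R(1) R(1)] .
  have R4: "nu (\<psi> (?R ** ?R ** ?R ** ?R)) = nu (?A ** ?A ** ?A ** ?A)"
    by (intro step rotation_group_mult_closed R(1) refl)
  have "nu (?A ** ?A ** ?A ** ?A) = nu (mat 1)" using R4 R(2) \<psi>(4) by simp
  moreover have "nu (?A ** ?A) \<noteq> nu (mat 1)"
  proof
    assume "nu (?A ** ?A) = nu (mat 1)"
    then have "?R ** ?R = mat 1"
      using R2 \<psi>(4) \<psi>(3)[OF rotation_group_mult_closed[OF R(1) R(1)] rotation_group_one_closed] by simp
    with R(3) show False by simp
  qed
  ultimately have "c = 4"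
    using klein_type_order_4[OF t(1,2) _ \<psi>(1)[OF R(1)]] card_G by simp
  then have c: "c = 4" "card (binary_group G) = 48" using t(3) card_G(1) by auto
  note comp = compression_octahedral[OF t(1)[unfolded c(1)] c(2) G_subset_nu[OF subgroup]]
  have "(4::nat) \<ge> 2" by simp
  from this d show ?thesis
  proof (cases rule: polyhedral_series_nth)
    case (1 n m)
    then show ?thesis using comp(1)[of n m] by (simp add: mult.commute)
  next
    case (2 n m)
    then show ?thesis using comp(2)[of n m] by (simp add: algebra_simps)
  next
    case (3 n)
    then show ?thesis using comp(3)[of n] by simp
  qed
qed

lemma icosahedral_compression:
  assumes iso: "PSL2\<lparr>carrier := G\<rparr> \<cong> rotation_group icosahedron"
    and d: "fps_nth (polyhedral_series 6) d \<noteq> 0"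
  shows "has_compression (binary_group G) G d"
proof -
  obtain c x y z where t: "klein_type 2 3 c x y z" "c \<in> {3, 4, 5}" "(c, card G) \<in> {(3, 12), (4, 24), (5, 60)}"
    using polyhedral_klein_type[OF iso cyclic_rotation_icosahedron] by metis
  obtain \<psi> where "projective_lift icosahedron G \<psi>"
    using projective_lift_exists[OF subgroup iso] .
  note \<psi> = projective_liftD[OF this] and step = projective_lift_mult[OF this]
  let ?R = "icosa_rotation ((1 + sqrt 5) / 2)"
  let ?A = "\<psi> ?R"
  note R = icosa_rotation
  have R5: "nu (\<psi> (?R ** ?R ** ?R ** ?R ** ?R)) = nu (?A ** ?A ** ?A ** ?A ** ?A)"
    by (intro step rotation_group_mult_closed R(1) refl)
  have "nu (?A ** ?A ** ?A ** ?A ** ?A) = nu (mat 1)" using R5 R(2) \<psi>(4) by simp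
  moreover have "nu ?A \<noteq> nu (mat 1)"
    using \<psi>(4) \<psi>(3)[OF R(1) rotation_group_one_closed] R(3) by metis
  ultimately have "c = 5"
    using klein_type_order_5[OF t(1,2) _ \<psi>(1)[OF R(1)]] card_G by simp
  then have c: "c = 5" "card (binary_group G) = 120" using t(3) card_G(1) by auto
  note comp = compression_icosahedral[OF t(1)[unfolded c(1)] c(2) G_subset_nu[OF subgroup]]
  have "(6::nat) \<ge> 2" by simp
  from this d show ?thesis
  proof (cases rule: polyhedral_series_nth)
    case (1 n m)
    then show ?thesis using comp(1)[of n m] by (simp add: mult.commute)
  next
    case (2 n m)
    then show ?thesis using comp(2)[of n m] by (simp add: algebra_simps)
  next
    case (3 n)
    then show ?thesis using comp(3)[of n] by simp
  qed
qed

text \<open>A global fixed point makes the group abelian. This alone does not exclude the Klein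
  four-group, but an abelian dihedral group has exponent two, so all eigenvalues at the fixed point
  are fourth roots of unity, and injectivity of the character leaves at most two elements in
  \<open>G\<close>.\<close>

lemma not_dihedral_if_fixed_point:
  assumes "stab x = binary_group G" "dihedral_group l (PSL2\<lparr>carrier := G\<rparr>)" "l \<ge> 2"
  shows False
proof -
  let ?H = "PSL2\<lparr>carrier := G\<rparr>"
  interpret H: group ?H using assms(2) by (simp add: dihedral_group_def)
  have comm: "g \<otimes>\<^bsub>PSL2\<^esub> h = h \<otimes>\<^bsub>PSL2\<^esub> g" if gh: "g \<in> G" "h \<in> G" for g h
  proof -
    obtain A B where "A \<in> binary_group G" "B \<in> binary_group G" "g = nu A" "h = nu B"
      using gh G_subset_nu[OF subgroup] by blast
    then show ?thesis using stab_commute[of A x B] assms(1) by (simp add: nu_mult)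
  qed
  obtain r s where rs: "r \<in> G" "s \<in> G" "generate ?H {r, s} = G"
    "s [^]\<^bsub>?H\<^esub> (2::nat) = \<one>\<^bsub>?H\<^esub>" "s \<otimes>\<^bsub>?H\<^esub> r \<otimes>\<^bsub>?H\<^esub> s = inv\<^bsub>?H\<^esub> r"
    using assms(2) by (auto simp: dihedral_group_def)
  have ss: "s \<otimes>\<^bsub>?H\<^esub> s = \<one>\<^bsub>?H\<^esub>" using rs(2,4) H.l_one[of s] by (simp add: numeral_2_eq_2)
  \<comment> \<open>Commutativity turns the relation s r s = r^-1 into r = r^-1.\<close>
  have "inv\<^bsub>?H\<^esub> r = r \<otimes>\<^bsub>?H\<^esub> s \<otimes>\<^bsub>?H\<^esub> s" using rs comm by simp
  also have "\<dots> = r" using rs ss H.m_assoc[of r s s] H.r_one[of r] by simp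
  finally have rr: "r \<otimes>\<^bsub>?H\<^esub> r = \<one>\<^bsub>?H\<^esub>" using H.r_inv[of r] rs(1) by simp
  have "g \<in> G \<and> g \<otimes>\<^bsub>?H\<^esub> g = \<one>\<^bsub>?H\<^esub>" if "g \<in> generate ?H {r, s}" for g
    using that
  proof induction
    case one
    then show ?case using H.one_closed H.l_one[OF H.one_closed] by simp
  next
    case (incl h)
    then show ?case using rs ss rr by auto
  next
    case (inv h)
    then have "h \<in> G" "inv\<^bsub>?H\<^esub> h = h" using rs ss rr H.inv_equality[of h h] by auto
    then show ?case using inv ss rr by auto
  next
    case (eng g h)
    then have gh: "g \<in> G" "h \<in> G" "g \<otimes>\<^bsub>?H\<^esub> g = \<one>\<^bsub>?H\<^esub>" "h \<otimes>\<^bsub>?H\<^esub> h = \<one>\<^bsub>?H\<^esub>" by auto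
    have "(g \<otimes>\<^bsub>?H\<^esub> h) \<otimes>\<^bsub>?H\<^esub> (g \<otimes>\<^bsub>?H\<^esub> h) = (g \<otimes>\<^bsub>?H\<^esub> g) \<otimes>\<^bsub>?H\<^esub> (h \<otimes>\<^bsub>?H\<^esub> h)"
    proof -
      have "a \<otimes>\<^bsub>?H\<^esub> b \<otimes>\<^bsub>?H\<^esub> c = a \<otimes>\<^bsub>?H\<^esub> (b \<otimes>\<^bsub>?H\<^esub> c)" "a \<otimes>\<^bsub>?H\<^esub> b \<in> G"
        if "a \<in> G" "b \<in> G" "c \<in> G" for a b c
        using that H.m_assoc[of a b c] H.m_closed[of a b] by simp_all
      moreover have "h \<otimes>\<^bsub>?H\<^esub> g = g \<otimes>\<^bsub>?H\<^esub> h" using comm gh by simp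
      ultimately show ?thesis using gh(1,2) by metis
    qed
    then show ?case using gh H.m_closed[of g h] H.l_one[OF H.one_closed] by simp
  qed
  then have sq: "g \<otimes>\<^bsub>PSL2\<^esub> g = nu (mat 1)" if "g \<in> G" for g using that rs(3) by (simp add: one_PSL2)
  have root: "eigenvalue A x ^ 4 = 1" if A: "A \<in> stab x" for A
  proof -
    have "nu (A ** A) = nu (mat 1)"
      using sq[of "nu A"] A assms(1) by (simp add: nu_mult binary_group_def)
    then have "eigenvalue (A ** A) x ^ 2 = 1"
      using eigenvalue_square_eq_1_iff stab_mult[OF A A] by blast
    then show ?thesis using eigenvalue_mult[OF A A] by (simp add: power2_eq_square eval_nat_numeral mult.assoc)
  qed
  let ?p = "monom 1 4 - 1 :: 'a poly"
  have p: "?p \<noteq> 0" "degree ?p \<le> 4"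
  proof -
    have "coeff ?p 4 = 1" by simp
    then show "?p \<noteq> 0" by (metis coeff_0 zero_neq_one)
    show "degree ?p \<le> 4" by (intro degree_diff_le degree_monom_le) simp
  qed
  have "(\<lambda>A. eigenvalue A x) ` stab x \<subseteq> {z. poly ?p z = 0}" using root by (auto simp: poly_monom)
  then have "card (stab x) \<le> card {z. poly ?p z = 0}"
    using card_mono[OF poly_roots_finite[OF p(1)]] card_image[OF inj_on_eigenvalue] by metis
  also have "\<dots> \<le> 4" using card_poly_roots_bound[OF p(1)] p(2) by linarith
  finally have "card G \<le> 2" using assms(1) card_G(1) by simp
  moreover have "card G = 2 * l" using assms(2) by (simp add: dihedral_group_def Coset.order_def)
  ultimately show False using assms(3) by simp
qed

text \<open>The order of the group determines \<open>l\<close>, so the definite description is well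
  defined. The solution of the class equation is not identified: it suffices that there is no global
  fixed point.\<close>

lemma dihedral_compression:
  assumes l: "l \<ge> 2" "dihedral_group l (PSL2\<lparr>carrier := G\<rparr>)"
    and d: "fps_nth (dihedral_cyclic_series (THE l. dihedral_group l (PSL2\<lparr>carrier := G\<rparr>))) d \<noteq> 0"
  shows "has_compression (binary_group G) G d"
proof -
  have card: "card G = 2 * l'" if "dihedral_group l' (PSL2\<lparr>carrier := G\<rparr>)" for l'
    using that by (simp add: dihedral_group_def Coset.order_def)
  have "(THE l. dihedral_group l (PSL2\<lparr>carrier := G\<rparr>)) = l"
  proof (rule the_equality)
    show "dihedral_group l (PSL2\<lparr>carrier := G\<rparr>)" by (rule l(2))
    show "l' = l" if "dihedral_group l' (PSL2\<lparr>carrier := G\<rparr>)" for l'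
      using card[OF that] card[OF l(2)] by simp
  qed
  then obtain n where n: "d = 2 * l * (n + 1) - 1"
    using dihedral_cyclic_series_nth[of l d] l(1) d by auto
  have "\<not> stab x = binary_group G" for x using not_dihedral_if_fixed_point l by blast
  then obtain a b c x y z where "klein_type a b c x y z"
    "(a, b, c, card G) \<in> {(2, 2, c, 2 * c), (2, 3, 3, 12), (2, 3, 4, 24), (2, 3, 5, 60)}"
    using klein_classification[OF card_G] by blast
  from compression_dihedral[OF this card_G(1) _ G_subset_nu[OF subgroup], of n]
  show ?thesis using card[OF l(2)] l(1) n by simp
qed

lemma cyclic_compression:
  assumes "fps_nth (dihedral_cyclic_series (Coset.order (PSL2\<lparr>carrier := G\<rparr>))) d \<noteq> 0"
  shows "has_compression (binary_group G) G d"
proof -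
  obtain n where "d = 2 * card G * (n + 1) - 1"
    using dihedral_cyclic_series_nth[of "card G" d] assms card_G(2) by (auto simp: Coset.order_def)
  then show ?thesis
    using compression_cyclic[OF _ G_subset_nu[OF subgroup], of n] card_G by simp
qed

end

theorem theorem2p1:
  fixes G :: "('a::{alg_closed_field, field_char_0}^2^2) set set" and d :: nat
  assumes "subgroup G PSL2" and "finite G" and "G \<noteq> {\<one>\<^bsub>PSL2\<^esub>}"
    and "fps_nth (S_series G) d \<noteq> 0"
  shows "\<exists>f1 f2 :: 'a poly poly.
     is_form d f1 \<and> is_form d f2 \<and>
     self_compression A2 ((\<lambda>A. total_rmap (\<lambda>v. A *v v)) ` binary_group G)
       (total_rmap (poly_map f1 f2)) \<and>
     (\<exists>\<phi>. is_descent (poly_map f1 f2) \<phi> \<and>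
       nontrivial_self_compression P1 ((\<lambda>g. total_rmap (psl_act g)) ` G) (total_rmap \<phi>))"
proof -
  interpret finite_PSL2 G by (rule finite_PSL2.intro) fact+
  let ?H = "PSL2\<lparr>carrier := G\<rparr>"
  have "has_compression (binary_group G) G d"
  proof -
    \<comment> \<open>A nonzero coefficient excludes the default series 0. The last case keeps only
      the order of \<open>G\<close>, because two free orbits give these degrees for every
      group.\<close>
    consider "?H \<cong> rotation_group tetrahedron" "fps_nth (polyhedral_series 3) d \<noteq> 0"
      | "?H \<cong> rotation_group octahedron" "fps_nth (polyhedral_series 4) d \<noteq> 0"
      | "?H \<cong> rotation_group icosahedron" "fps_nth (polyhedral_series 6) d \<noteq> 0"
      | l where "l \<ge> 2" "dihedral_group l ?H" "fps_nth (dihedral_cyclic_series (THE l. dihedral_group l ?H)) d \<noteq> 0"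
      | "fps_nth (dihedral_cyclic_series (Coset.order ?H)) d \<noteq> 0"
      using assms(4) by (auto simp: S_series_def Let_def split: if_splits)
    then show ?thesis
      using tetrahedral_compression octahedral_compression icosahedral_compression
        dihedral_compression cyclic_compression by cases blast+
  qed
  then show ?thesis by (simp add: has_compression_def)
qed

end
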